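(* Let $\omega(k)=-k^3$ and let $q$ be the solution of the initial-boundary value problem $q_t+q_{xxx}=0$ for $x>0$, $t\in(0,T]$, with $q(\cdot,0)=q_o$ and $q(0,\cdot)=g_0$, where $q_o,g_0$ satisfy the regularity assumptions listed in the context (no compatibility between $q_o(0)$ and $g_0(0)$ is required). Then, as $(x,t)\to(0,0)$ with $x>0$, $t>0$, $$q(x,t)=q_{\rm loc}(x,t)+\mathcal O\big(|x|^{1/2}+|t|^{1/6}\big),\qquad q_{\rm loc}(x,t)=-3g_0(0)\,I_{\omega,0,1}(x,t)+3q_o(0)\Big(I_{\omega,0,1}(x,t)+\tfrac13\Big),$$ where $q_o(0)$ and $g_0(0)$ denote the one-sided limits $q_o(0^+)$, $g_0(0^+)$.
   Context: Assumptions on the data: (i) $q_o\in L^2(\mathbb R^+)\cap L^1(\mathbb R^+,(1+|x|)^\ell)$ for some $\ell\ge 0$; (ii) there are $0=x_0<x_1<\dots<x_M<x_{M+1}=\infty$ such that $q_o\in H^1((x_i,x_{i+1}))$ for each $i=0,\dots,M$ and $q_o(x_i^+)\ne q_o(x_i^-)$ for $i=1,\dots,M$; (iii) there are $0=t_0<t_1<\dots<t_K<t_{K+1}=T$ such that $g_0\in H^1((t_i,t_{i+1}))$ for each $i=0,\dots,K$ ($g_0$ may or may not be discontinuous at each $t_i$, $i\ge 1$). Let $\alpha=e^{2\pi i/3}$ and let $D^+=\{k: \pi/3\le\arg k\le 2\pi/3\}$, i.e. the part of $\{\mathrm{Im}(-k^3)\ge 0\}$ lying in the open upper half-plane. For a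 fixed $R>0$ let $D_1^+=D^+\setminus\{|k|<R\}$. Boundaries are oriented with the region on the left, so $\partial D_1^+$ runs from $e^{2\pi i/3}\infty$ to $e^{i\pi/3}\infty$, avoiding the origin. Integrals over unbounded contours are limits, as $r\to\infty$, of the integrals over the part of the contour in $\{|k|<r\}$. The solution $q$ is the $L^2$ solution (weak solution in $\mathbb R^+\times(0,T)$, $q\in C^0([0,T];L^2(\mathbb R^+))$ with $q(\cdot,0)=q_o$ a.e., $q\in C^0([0,\infty);H^{1/3}(0,T))$ with $q(0,\cdot)=g_0$ a.e.), which for $x>0$, $t>0$ is given by $$q(x,t)=\frac1{2\pi}\int_{\mathbb R}e^{ikx-i\omega(k)t}\hat q_o(k)\,dk-\frac1{2\pi}\int_{\partial D^+}3k^2e^{ikx-i\omega(k)t}\tilde g_0(-\omega(k),t)\,dk+\frac1{2\pi}\int_{\partial D^+}e^{ikx-i\omega(k)t}\big[\alpha\hat q_o(\alpha k)+\alpha^2\hat q_o(\alpha^2k)\big]dk,$$ with $\hat q_o(k)=\int_0^\infty e^{-ikx}q_o(x)\,dx$ and $\tilde g_0(\kappa,t)=\int_0^te^{-i\kappa s}g_0(s)\,ds$. The special function is $$I_{\omega,0,1}(x,t)=\frac1{2\pi}\int_{\partial D_1^+}e^{ikx-i\omega(k)t}\frac{dk}{ik}.$$ *)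

theory Defs
  imports "HOL-Complex_Analysis.Complex_Analysis" "HOL-Library.Landau_Symbols"
begin

text \<open>
  Elements of Lebesgue and Sobolev spaces are represented by functions that matter only up to
  null sets; the conditions imposed on the data are invariant under changes on null sets.
\<close>

definition L2_on :: "'a::euclidean_space set \<Rightarrow> ('a \<Rightarrow> complex) \<Rightarrow> bool" where
  "L2_on S f \<longleftrightarrow> set_borel_measurable lebesgue S f \<and>
     set_integrable lebesgue S (\<lambda>x. (cmod (f x))\<^sup>2)"

definition L2_normsq :: "'a::euclidean_space set \<Rightarrow> ('a \<Rightarrow> complex) \<Rightarrow> real" where
  "L2_normsq S f = (LINT x:S|lebesgue. (cmod (f x))\<^sup>2)"

definition weighted_L1 :: "real \<Rightarrow> (real \<Rightarrow> complex) \<Rightarrow> bool" where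
  "weighted_L1 l f \<longleftrightarrow> set_integrable lebesgue {0<..} (\<lambda>x. (1 + \<bar>x\<bar>) powr l *\<^sub>R f x)"

text \<open>
  The Sobolev space H^1 of an open interval S, by weak derivatives tested against
  continuously differentiable functions with compact support in S.
\<close>

definition H1_on :: "real set \<Rightarrow> (real \<Rightarrow> complex) \<Rightarrow> bool" where
  "H1_on S f \<longleftrightarrow> L2_on S f \<and>
     (\<exists>g. L2_on S g \<and>
       (\<forall>\<phi> \<phi>' :: real \<Rightarrow> real.
          (\<forall>x. (\<phi> has_real_derivative \<phi>' x) (at x)) \<longrightarrow> continuous_on UNIV \<phi>' \<longrightarrow>
          (\<exists>C. compact C \<and> C \<subseteq> S \<and> (\<forall>x. x \<notin> C \<longrightarrow> \<phi> x = 0)) \<longrightarrow>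
          (LINT x:S|lebesgue. \<phi>' x *\<^sub>R f x) = - (LINT x:S|lebesgue. \<phi> x *\<^sub>R g x)))"

text \<open>
  The Sobolev space H^s, for s strictly between 0 and 1, of an interval S, with the
  Gagliardo--Slobodeckij norm.
\<close>

definition gagliardo :: "real \<Rightarrow> (real \<Rightarrow> complex) \<Rightarrow> real \<times> real \<Rightarrow> real" where
  "gagliardo s f = (\<lambda>(a, b). (cmod (f a - f b))\<^sup>2 / \<bar>a - b\<bar> powr (1 + 2 * s))"

definition Hs_on :: "real \<Rightarrow> real set \<Rightarrow> (real \<Rightarrow> complex) \<Rightarrow> bool" where
  "Hs_on s S f \<longleftrightarrow> L2_on S f \<and> set_integrable lebesgue (S \<times> S) (gagliardo s f)"

definition Hs_normsq :: "real \<Rightarrow> real set \<Rightarrow> (real \<Rightarrow> complex) \<Rightarrow> real" where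
  "Hs_normsq s S f = L2_normsq S f + (LINT z:S \<times> S|lebesgue. gagliardo s f z)"

text \<open>
  One-sided limits f(a+) and f(a-) of a function known up to null sets: the limit of any
  representative that has one. For f in H^1 near a on the relevant side, this is the limit of
  the continuous representative.
\<close>

definition right_value :: "(real \<Rightarrow> complex) \<Rightarrow> real \<Rightarrow> complex" where
  "right_value f a = (THE v. \<exists>h. (AE x in lebesgue. h x = f x) \<and> (h \<longlongrightarrow> v) (at_right a))"

definition left_value :: "(real \<Rightarrow> complex) \<Rightarrow> real \<Rightarrow> complex" where
  "left_value f a = (THE v. \<exists>h. (AE x in lebesgue. h x = f x) \<and> (h \<longlongrightarrow> v) (at_left a))"

definition admissible_initial :: "real \<Rightarrow> (real \<Rightarrow> complex) \<Rightarrow> bool" where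
  "admissible_initial l q0 \<longleftrightarrow> L2_on {0<..} q0 \<and> weighted_L1 l q0 \<and>
     (\<exists>(M::nat) (xs :: nat \<Rightarrow> ereal).
        xs 0 = 0 \<and> xs (Suc M) = \<infinity> \<and> (\<forall>i\<le>M. xs i < xs (Suc i)) \<and>
        (\<forall>i\<le>M. H1_on (einterval (xs i) (xs (Suc i))) q0) \<and>
        (\<forall>i\<in>{1..M}. right_value q0 (real_of_ereal (xs i)) \<noteq> left_value q0 (real_of_ereal (xs i))))"

definition admissible_boundary :: "real \<Rightarrow> (real \<Rightarrow> complex) \<Rightarrow> bool" where
  "admissible_boundary T g0 \<longleftrightarrow>
     (\<exists>(K::nat) (ts :: nat \<Rightarrow> real).
        ts 0 = 0 \<and> ts (Suc K) = T \<and> (\<forall>i\<le>K. ts i < ts (Suc i)) \<and>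
        (\<forall>i\<le>K. H1_on {ts i <..< ts (Suc i)} g0))"

text \<open>
  The witness D m n is the (m, n)-th partial derivative of \<phi>.
\<close>

definition smooth2 :: "(real \<Rightarrow> real \<Rightarrow> real) \<Rightarrow> bool" where
  "smooth2 \<phi> \<longleftrightarrow> (\<exists>D :: nat \<Rightarrow> nat \<Rightarrow> real \<Rightarrow> real \<Rightarrow> real. D 0 0 = \<phi> \<and>
     (\<forall>m n. continuous_on UNIV (\<lambda>(x, t). D m n x t) \<and>
        (\<forall>x t. ((\<lambda>y. D m n y t) has_real_derivative D (Suc m) n x t) (at x) \<and>
               ((\<lambda>s. D m n x s) has_real_derivative D m (Suc n) x t) (at t))))"

definition test_function :: "(real \<times> real) set \<Rightarrow> (real \<Rightarrow> real \<Rightarrow> real) \<Rightarrow> bool" where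
  "test_function \<Omega> \<phi> \<longleftrightarrow> smooth2 \<phi> \<and>
     (\<exists>C. compact C \<and> C \<subseteq> \<Omega> \<and> (\<forall>x t. (x, t) \<notin> C \<longrightarrow> \<phi> x t = 0))"

text \<open>
  q_t + q_xxx = 0 in the sense of distributions; both derivatives are of odd order, so the
  two signs from integration by parts agree.
\<close>

definition weak_solution :: "(real \<times> real) set \<Rightarrow> (real \<Rightarrow> real \<Rightarrow> complex) \<Rightarrow> bool" where
  "weak_solution \<Omega> q \<longleftrightarrow>
     (\<forall>C. compact C \<and> C \<subseteq> \<Omega> \<longrightarrow> set_integrable lebesgue C (\<lambda>(x, t). q x t)) \<and>
     (\<forall>\<phi>. test_function \<Omega> \<phi> \<longrightarrow>
        (LINT z:\<Omega>|lebesgue.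
           (case z of (x, t) \<Rightarrow>
              (deriv (\<lambda>s. \<phi> x s) t + (deriv ^^ 3) (\<lambda>y. \<phi> y t) x) *\<^sub>R q x t)) = 0)"

definition L2_solution ::
  "real \<Rightarrow> (real \<Rightarrow> complex) \<Rightarrow> (real \<Rightarrow> complex) \<Rightarrow> (real \<Rightarrow> real \<Rightarrow> complex) \<Rightarrow> bool" where
  "L2_solution T q0 g0 q \<longleftrightarrow>
     weak_solution ({0<..} \<times> {0<..<T}) q \<and>
     (\<forall>t\<in>{0..T}. L2_on {0<..} (\<lambda>x. q x t)) \<and>
     (\<forall>t\<in>{0..T}. ((\<lambda>s. L2_normsq {0<..} (\<lambda>x. q x s - q x t)) \<longlongrightarrow> 0) (at t within {0..T})) \<and>
     (AE x in lebesgue. x > 0 \<longrightarrow> q x 0 = q0 x) \<and>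
     (\<forall>x\<in>{0..}. Hs_on (1/3) {0<..<T} (q x)) \<and>
     (\<forall>x\<in>{0..}. ((\<lambda>y. Hs_normsq (1/3) {0<..<T} (\<lambda>t. q y t - q x t)) \<longlongrightarrow> 0)
        (at x within {0..})) \<and>
     (AE t in lebesgue. 0 < t \<and> t < T \<longrightarrow> q 0 t = g0 t)"

definition \<omega> :: "complex \<Rightarrow> complex" where
  "\<omega> k = - (k ^ 3)"

definition \<alpha> :: complex where
  "\<alpha> = cis (2 * pi / 3)"

text \<open>
  A contour is given by its truncations to the disc of radius r. The set D+ is the sector
  of the complex numbers with argument between pi/3 and 2 pi/3.
\<close>

definition improper_contour_integral ::
  "(real \<Rightarrow> real \<Rightarrow> complex) \<Rightarrow> (complex \<Rightarrow> complex) \<Rightarrow> complex" where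
  "improper_contour_integral \<gamma> f = Lim at_top (\<lambda>r. contour_integral (\<gamma> r) f)"

definition real_line :: "real \<Rightarrow> real \<Rightarrow> complex" where
  "real_line r = linepath (- of_real r) (of_real r)"

definition bdry_D :: "real \<Rightarrow> real \<Rightarrow> complex" where
  "bdry_D r = linepath (of_real r * cis (2 * pi / 3)) 0 +++ linepath 0 (of_real r * cis (pi / 3))"

text \<open>The boundary of D+ with the disc of radius R about 0 removed, D+ on the left.\<close>

definition bdry_D1 :: "real \<Rightarrow> real \<Rightarrow> real \<Rightarrow> complex" where
  "bdry_D1 R r =
     linepath (of_real r * cis (2 * pi / 3)) (of_real R * cis (2 * pi / 3)) +++
     (part_circlepath 0 R (2 * pi / 3) (pi / 3) +++
      linepath (of_real R * cis (pi / 3)) (of_real r * cis (pi / 3)))"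

definition half_line_transform :: "(real \<Rightarrow> complex) \<Rightarrow> complex \<Rightarrow> complex" where
  "half_line_transform q0 k = (LINT x:{0<..}|lebesgue. exp (- \<i> * k * of_real x) * q0 x)"

definition time_transform :: "(real \<Rightarrow> complex) \<Rightarrow> complex \<Rightarrow> real \<Rightarrow> complex" where
  "time_transform g0 \<kappa> t = (LINT s:{0<..<t}|lebesgue. exp (- \<i> * \<kappa> * of_real s) * g0 s)"

definition phase :: "real \<Rightarrow> real \<Rightarrow> complex \<Rightarrow> complex" where
  "phase x t k = exp (\<i> * k * of_real x - \<i> * \<omega> k * of_real t)"

definition solution_formula ::
  "(real \<Rightarrow> complex) \<Rightarrow> (real \<Rightarrow> complex) \<Rightarrow> real \<Rightarrow> real \<Rightarrow> complex" where
  "solution_formula q0 g0 x t =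
     1 / (2 * of_real pi) * improper_contour_integral real_line
       (\<lambda>k. phase x t k * half_line_transform q0 k)
   - 1 / (2 * of_real pi) * improper_contour_integral bdry_D
       (\<lambda>k. 3 * k\<^sup>2 * phase x t k * time_transform g0 (- \<omega> k) t)
   + 1 / (2 * of_real pi) * improper_contour_integral bdry_D
       (\<lambda>k. phase x t k *
          (\<alpha> * half_line_transform q0 (\<alpha> * k) + \<alpha>\<^sup>2 * half_line_transform q0 (\<alpha>\<^sup>2 * k)))"

definition I_\<omega>_0_1 :: "real \<Rightarrow> real \<Rightarrow> real \<Rightarrow> complex" where
  "I_\<omega>_0_1 R x t = 1 / (2 * of_real pi) * improper_contour_integral (bdry_D1 R)
     (\<lambda>k. phase x t k / (\<i> * k))"

definition q_loc ::
  "real \<Rightarrow> (real \<Rightarrow> complex) \<Rightarrow> (real \<Rightarrow> complex) \<Rightarrow> real \<Rightarrow> real \<Rightarrow> complex" where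
  "q_loc R q0 g0 x t =
     - 3 * right_value g0 0 * I_\<omega>_0_1 R x t + 3 * right_value q0 0 * (I_\<omega>_0_1 R x t + 1 / 3)"

end

theory Submission
  imports Defs "HOL-Probability.Distributions" "HOL-Real_Asymp.Real_Asymp"
begin

text \<open>
  Write \<open>e(z, t, k) = exp (i k z + i k^3 t)\<close>. Since \<open>\<alpha>\<close> is a cube root of unity, the substitution
  \<open>k \<mapsto> \<alpha> k\<close> leaves \<open>k^3\<close> unchanged, so every kernel in the solution formula is a value of one entire
  function: with \<open>K(z) = 1/(2 pi) \<integral> e(z, t, k) dk\<close> over a horizontal line in the upper half plane, the two
  integrals over the initial datum add up to \<open>\<integral> N(x, y) q\<^sub>o(y) dy\<close> where
  \<open>N(x, y) = K(x - y) + \<alpha> K(x - \<alpha> y) + \<alpha>^2 K(x - \<alpha>^2 y)\<close>. The primitive \<open>W\<close> of \<open>K\<close>, with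
  weight \<open>1/(i k)\<close>, is an Airy primitive, and the special function \<open>I\<close> of the theorem is its restriction
  to positive reals (\<open>I_eq_airy_primitive\<close>). Hence \<open>N(x, y)\<close> is minus the \<open>y\<close>-derivative of
  \<open>M(x, a) = 1 + W(x - a) + W(x - \<alpha> a) + W(x - \<alpha>^2 a)\<close>, and \<open>M(x, 0) = 1 + 3 I(x, t)\<close>, which is
  the coefficient of \<open>q\<^sub>o(0)\<close> in the local solution.

  On each interval between jumps the datum is \<open>c + \<integral> g\<close> with \<open>g\<close> square integrable
  (\<open>H1_representation\<close>). Integration by parts (\<open>ac_integration_by_parts\<close>) turns its contribution
  into \<open>c M(x, p)\<close> at the left end \<open>p\<close>, a term at the right end and \<open>\<integral> g M\<close>. The term at
  \<open>p = 0\<close> is the part of the local solution due to \<open>q\<^sub>o\<close>; the rest is small because of two facts about \<open>M\<close>: it is bounded, and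
  it is \<open>O((t^(1/3) / (a - x))^(3/4))\<close> for \<open>a > x\<close>. So \<open>M\<close> is \<open>O(t^(1/4))\<close> at the jumps
  and its square has integral \<open>O(x + t^(1/3))\<close>, and the Cauchy--Schwarz inequality gives the error
  \<open>O(x^(1/2) + t^(1/6))\<close>.

  Both facts follow from \<open>|W(z)| \<le> min 1 (t^(1/4) (Re z)^(-3/4))\<close> in the sector
  \<open>|arg z| \<le> pi/3\<close> (\<open>airy_primitive_bounds\<close>), obtained by putting absolute values inside the integral
  over the best horizontal line. The points \<open>x - \<alpha> a\<close> and \<open>x - \<alpha>^2 a\<close> lie in the sector;
  for \<open>x - a < 0\<close> the connection formula \<open>W(z) + W(\<alpha> z) + W(\<alpha>^2 z) = -1\<close>
  (\<open>airy_primitive_connection\<close>), a residue computation on an equilateral triangle, moves the argument there.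

  The boundary datum is simpler: integrating by parts in time gives \<open>-3 g\<^sub>0(0) I(x, t)\<close> and
  \<open>-3 \<integral> g\<^sub>0'(s) I(x, t - s) ds\<close>, which is \<open>O(t^(1/2))\<close> since \<open>I\<close> is bounded.

  The improper contour integrals have to be shown to converge. Along the two rays of the boundary of the sector
  the factor \<open>exp (i k x)\<close> decays; along the real line convergence is conditional, and a second-derivative test
  (\<open>van_der_Corput_bound\<close>) gives the bound that dominates the truncated kernels.
\<close>

section \<open>The Airy phase on horizontal lines\<close>

text \<open>
  The spatial argument is complex so that the points \<open>x - \<alpha> y\<close> and \<open>x - \<alpha>^2 y\<close>, which
  the reflected terms produce, need no separate treatment.
\<close>

definition airy_phase :: "complex \<Rightarrow> real \<Rightarrow> complex \<Rightarrow> complex" where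
  "airy_phase z t k = exp (\<i> * k * z + \<i> * k ^ 3 * of_real t)"

lemma phase_eq_airy_phase: "phase x t k = airy_phase (of_real x) t k"
  by (simp add: phase_def airy_phase_def \<omega>_def)

lemma airy_phase_holomorphic [holomorphic_intros]:
  "f holomorphic_on S \<Longrightarrow> (\<lambda>k. airy_phase z t (f k)) holomorphic_on S"
  unfolding airy_phase_def by (intro holomorphic_intros)

lemma continuous_on_airy_phase [continuous_intros]:
  "continuous_on S f \<Longrightarrow> continuous_on S g \<Longrightarrow> continuous_on S h \<Longrightarrow>
     continuous_on S (\<lambda>k. airy_phase (f k) (g k) (h k))"
  unfolding airy_phase_def by (intro continuous_intros)

lemma norm_airy_phase:
  "norm (airy_phase z t (Complex \<xi> \<eta>)) =
     exp (- \<xi> * Im z - \<eta> * Re z + t * (\<eta> ^ 3 - 3 * \<xi>\<^sup>2 * \<eta>))"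
proof -
  have "Re (\<i> * Complex \<xi> \<eta> * z + \<i> * Complex \<xi> \<eta> ^ 3 * of_real t) =
      - \<xi> * Im z - \<eta> * Re z + t * (\<eta> ^ 3 - 3 * \<xi>\<^sup>2 * \<eta>)"
    by (simp add: power3_eq_cube power2_eq_square algebra_simps)
  then show ?thesis by (simp add: airy_phase_def)
qed

lemma airy_phase_rotate:
  assumes "c ^ 3 = 1"
  shows "airy_phase z t (c * k) = airy_phase (c * z) t k"
  by (simp add: airy_phase_def power_mult_distrib assms mult_ac)

lemma alpha_cube: "\<alpha> ^ 3 = 1"
  by (simp add: \<alpha>_def Complex.DeMoivre)

lemma has_bochner_integral_gaussian:
  fixes c m :: real
  assumes "c > 0"
  shows "has_bochner_integral lborel (\<lambda>x. exp (- c * (x - m)\<^sup>2)) (sqrt (pi / c))"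
proof -
  define s where "s = 1 / sqrt (2 * c)"
  have s2: "2 * s\<^sup>2 = 1 / c" using assms by (simp add: s_def power_divide)
  have sp: "s > 0" using assms by (simp add: s_def)
  have "has_bochner_integral lborel (normal_density m s) 1"
    using sp by (simp add: has_bochner_integral_iff)
  then have "has_bochner_integral lborel (\<lambda>x. sqrt (pi / c) * normal_density m s x) (sqrt (pi / c) * 1)"
    by (rule has_bochner_integral_mult_right)
  moreover have "sqrt (pi / c) * normal_density m s x = exp (- c * (x - m)\<^sup>2)" for x
  proof -
    have "2 * pi * s\<^sup>2 = pi / c" using s2 by (simp add: field_simps)
    moreover have "(x - m)\<^sup>2 / (2 * s\<^sup>2) = c * (x - m)\<^sup>2" unfolding s2 by simp
    ultimately show ?thesis using assms by (simp add: normal_density_def)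
  qed
  ultimately show ?thesis by simp
qed

lemma norm_airy_phase_gaussian:
  assumes "t > 0" "\<eta> > 0"
  shows "norm (airy_phase z t (Complex \<xi> \<eta>)) =
     exp (t * \<eta> ^ 3 - \<eta> * Re z + (Im z)\<^sup>2 / (12 * t * \<eta>)) *
     exp (- (3 * t * \<eta>) * (\<xi> - (- Im z / (6 * t * \<eta>)))\<^sup>2)"
proof -
  have "- \<xi> * Im z - \<eta> * Re z + t * (\<eta> ^ 3 - 3 * \<xi>\<^sup>2 * \<eta>) =
     (t * \<eta> ^ 3 - \<eta> * Re z + (Im z)\<^sup>2 / (12 * t * \<eta>)) +
     - (3 * t * \<eta>) * (\<xi> - (- Im z / (6 * t * \<eta>)))\<^sup>2"
    using assms by (simp add: field_simps power2_eq_square)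
  then show ?thesis unfolding norm_airy_phase by (simp only: exp_add)
qed

text \<open>
  The weights that occur are \<open>1\<close>, for the kernel, and \<open>1/(i k)\<close>, for its primitive; the bound
  covers both.
\<close>

definition upper_weight :: "(complex \<Rightarrow> complex) \<Rightarrow> bool" where
  "upper_weight g \<longleftrightarrow> g holomorphic_on {k. Im k > 0} \<and>
     (\<forall>k. Im k > 0 \<longrightarrow> norm (g k) \<le> 1 + 1 / Im k)"

lemma upper_weight_one: "upper_weight (\<lambda>k. 1)"
  by (auto simp: upper_weight_def)

lemma upper_weight_inverse: "upper_weight (\<lambda>k. 1 / (\<i> * k))"
proof -
  have "norm (1 / (\<i> * k)) \<le> 1 + 1 / Im k" if "Im k > 0" for k
  proof -
    have "Im k \<le> norm k" using abs_Im_le_cmod[of k] by linarith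
    then have "norm (1 / (\<i> * k)) \<le> 1 / Im k" using that
      by (simp add: norm_divide norm_mult frac_le)
    then show ?thesis by simp
  qed
  moreover have "(\<lambda>k. 1 / (\<i> * k)) holomorphic_on {k. Im k > 0}"
    by (intro holomorphic_intros) auto
  ultimately show ?thesis by (simp add: upper_weight_def)
qed

definition line_integral :: "(complex \<Rightarrow> complex) \<Rightarrow> real \<Rightarrow> complex \<Rightarrow> real \<Rightarrow> complex" where
  "line_integral g \<eta> z t = (LINT \<xi>|lborel. airy_phase z t (Complex \<xi> \<eta>) * g (Complex \<xi> \<eta>))"

lemma continuous_on_horizontal:
  assumes "upper_weight g" "\<eta> > 0"
  shows "continuous_on UNIV (\<lambda>\<xi>. airy_phase z t (Complex \<xi> \<eta>) * g (Complex \<xi> \<eta>))"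
proof -
  have "continuous_on UNIV (g \<circ> (\<lambda>\<xi>. Complex \<xi> \<eta>))"
    using assms unfolding upper_weight_def
    by (intro continuous_on_compose[OF _ continuous_on_subset[OF holomorphic_on_imp_continuous_on]])
       (auto simp: Complex_eq intro!: continuous_intros)
  then show ?thesis
    by (intro continuous_intros) (auto simp: Complex_eq o_def intro!: continuous_intros)
qed

lemma integrable_norm_airy_phase:
  assumes "t > 0" "\<eta> > 0"
  shows "integrable lborel (\<lambda>\<xi>. norm (airy_phase z t (Complex \<xi> \<eta>)))"
  unfolding norm_airy_phase_gaussian[OF assms]
  using has_bochner_integral_gaussian[of "3 * t * \<eta>" "- Im z / (6 * t * \<eta>)"] assms
  by (intro integrable_mult_right) (simp add: has_bochner_integral_iff)

lemma integrable_horizontal: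
  assumes "upper_weight g" "t > 0" "\<eta> > 0"
  shows "integrable lborel (\<lambda>\<xi>. airy_phase z t (Complex \<xi> \<eta>) * g (Complex \<xi> \<eta>))"
proof (rule Bochner_Integration.integrable_bound)
  show "integrable lborel (\<lambda>\<xi>. (1 + 1 / \<eta>) * norm (airy_phase z t (Complex \<xi> \<eta>)))"
    using integrable_norm_airy_phase[OF assms(2,3)] by (intro integrable_mult_right)
  show "(\<lambda>\<xi>. airy_phase z t (Complex \<xi> \<eta>) * g (Complex \<xi> \<eta>)) \<in> borel_measurable lborel"
    using borel_measurable_continuous_onI[OF continuous_on_horizontal[OF assms(1,3)]] by simp
  have "norm (g (Complex \<xi> \<eta>)) \<le> 1 + 1 / \<eta>" for \<xi>
    using assms unfolding upper_weight_def by (metis complex.sel(2))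
  then have "norm (airy_phase z t (Complex \<xi> \<eta>) * g (Complex \<xi> \<eta>))
      \<le> norm (airy_phase z t (Complex \<xi> \<eta>)) * (1 + 1 / \<eta>)" for \<xi>
    by (simp add: norm_mult mult_left_mono)
  then show "AE \<xi> in lborel. norm (airy_phase z t (Complex \<xi> \<eta>) * g (Complex \<xi> \<eta>))
      \<le> norm ((1 + 1 / \<eta>) * norm (airy_phase z t (Complex \<xi> \<eta>)))"
    using assms(3) by (auto simp: mult.commute)
qed

text \<open>
  Completing the square in \<open>\<xi>\<close> leaves a Gaussian and the exponent
  \<open>t \<eta>^3 - \<eta> Re z + (Im z)^2/(12 t \<eta>)\<close>. The condition on \<open>z\<close> (a sector of half-angle pi/3) makes
  it at most a perfect square, which vanishes for a suitable height \<open>\<eta>\<close>; this is what replaces the method of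
  steepest descent.
\<close>

lemma norm_line_integral_inverse_le:
  assumes "t > 0" "\<eta> > 0" "Re z \<ge> 0" "\<bar>Im z\<bar> \<le> sqrt 3 * Re z"
  shows "norm (line_integral (\<lambda>k. 1 / (\<i> * k)) \<eta> z t) \<le>
    1 / \<eta> * (exp ((t * \<eta>\<^sup>2 - Re z / 2)\<^sup>2 / (\<eta> * t)) * sqrt (pi / (3 * t * \<eta>)))"
proof -
  let ?G = "\<lambda>\<xi>. exp (- (3 * t * \<eta>) * (\<xi> - (- Im z / (6 * t * \<eta>)))\<^sup>2)"
  let ?E = "exp ((t * \<eta>\<^sup>2 - Re z / 2)\<^sup>2 / (\<eta> * t))"
  have G: "has_bochner_integral lborel ?G (sqrt (pi / (3 * t * \<eta>)))"
    by (rule has_bochner_integral_gaussian) (use assms in auto)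
  have "norm (line_integral (\<lambda>k. 1 / (\<i> * k)) \<eta> z t) \<le>
    (LINT \<xi>|lborel. 1 / \<eta> * (?E * ?G \<xi>))"
    unfolding line_integral_def
  proof (rule Bochner_Integration.integral_norm_bound_integral)
    show "integrable lborel (\<lambda>\<xi>. airy_phase z t (Complex \<xi> \<eta>) * (1 / (\<i> * Complex \<xi> \<eta>)))"
      by (rule integrable_horizontal[OF upper_weight_inverse]) (use assms in auto)
    show "integrable lborel (\<lambda>\<xi>. 1 / \<eta> * (?E * ?G \<xi>))"
      using G by (intro integrable_mult_right) (auto simp: has_bochner_integral_iff)
    fix \<xi> :: real
    have y2: "(Im z)\<^sup>2 \<le> 3 * (Re z)\<^sup>2"
      using power_mono[OF assms(4), of 2] by (simp add: power_mult_distrib)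
    have "t * \<eta> ^ 3 - \<eta> * Re z + (Im z)\<^sup>2 / (12 * t * \<eta>)
        \<le> t * \<eta> ^ 3 - \<eta> * Re z + (3 * (Re z)\<^sup>2) / (12 * t * \<eta>)"
      using y2 assms by (intro add_left_mono divide_right_mono) auto
    also have "\<dots> = (t * \<eta>\<^sup>2 - Re z / 2)\<^sup>2 / (\<eta> * t)"
      using assms by (simp add: field_simps power2_eq_square power3_eq_cube)
    finally have 1: "norm (airy_phase z t (Complex \<xi> \<eta>)) \<le> ?E * ?G \<xi>"
      unfolding norm_airy_phase_gaussian[OF assms(1,2)] by (intro mult_right_mono) auto
    have "\<eta> \<le> norm (Complex \<xi> \<eta>)" using abs_Im_le_cmod[of "Complex \<xi> \<eta>"] by simp
    then have 2: "norm (1 / (\<i> * Complex \<xi> \<eta>)) \<le> 1 / \<eta>"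
      using assms by (simp add: norm_divide norm_mult frac_le)
    show "norm (airy_phase z t (Complex \<xi> \<eta>) * (1 / (\<i> * Complex \<xi> \<eta>))) \<le> 1 / \<eta> * (?E * ?G \<xi>)"
      unfolding norm_mult using mult_mono[OF 1 2] assms by (simp add: norm_mult mult.commute)
  qed
  also have "\<dots> = 1 / \<eta> * (?E * sqrt (pi / (3 * t * \<eta>)))"
    using G by (simp add: has_bochner_integral_iff)
  finally show ?thesis .
qed

text \<open>
  All deformations of contours go through primitives: a contour integral and an integral over a
  horizontal segment agree as soon as the end points do.
\<close>

lemma horizontal_segment_integral:
  assumes F: "\<And>k. k \<in> S \<Longrightarrow> (F has_field_derivative f k) (at k)"
    and f: "continuous_on S f" and "a \<le> b"
    and sub: "\<And>\<xi>. \<xi> \<in> {a..b} \<Longrightarrow> Complex \<xi> \<eta> \<in> S"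
  shows "(LINT \<xi>:{a..b}|lborel. f (Complex \<xi> \<eta>)) = F (Complex b \<eta>) - F (Complex a \<eta>)"
  unfolding set_lebesgue_integral_def
proof (rule integral_FTC_atLeastAtMost[OF \<open>a \<le> b\<close>])
  show "continuous_on {a..b} (\<lambda>\<xi>. f (Complex \<xi> \<eta>))"
    by (rule continuous_on_compose2[OF f]) (auto simp: Complex_eq sub[unfolded Complex_eq] intro!: continuous_intros)
  fix \<xi> assume "a \<le> \<xi>" "\<xi> \<le> b"
  then have *: "(F has_field_derivative f (Complex \<xi> \<eta>)) (at (Complex \<xi> \<eta>))"
    by (intro F sub) auto
  have A: "((\<lambda>\<xi>. Complex \<xi> \<eta>) has_vector_derivative 1) (at \<xi> within {a..b})"
    unfolding Complex_eq
    by (auto intro!: derivative_eq_intros simp: has_vector_derivative_def scaleR_conv_of_real)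
  from field_vector_diff_chain_within[OF A DERIV_subset[OF *]]
  show "((\<lambda>\<xi>. F (Complex \<xi> \<eta>)) has_vector_derivative f (Complex \<xi> \<eta>)) (at \<xi> within {a..b})"
    by (simp add: o_def)
qed

section \<open>Shifting contours to horizontal lines\<close>

lemma tendsto_truncated_integral:
  fixes h :: "real \<Rightarrow> complex"
  assumes "integrable lborel h"
  shows "((\<lambda>r. LINT x:{-r..r}|lborel. h x) \<longlongrightarrow> (LINT x|lborel. h x)) at_top"
  unfolding set_lebesgue_integral_def
proof (rule integral_dominated_convergence_at_top[where w = "\<lambda>x. norm (h x)"])
  show "h \<in> borel_measurable lborel" using assms by auto
  then show "(\<lambda>x. indicat_real {-t..t} x *\<^sub>R h x) \<in> borel_measurable lborel" for t by measurable
  show "integrable lborel (\<lambda>x. norm (h x))" using assms by auto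
  have "((\<lambda>i. indicat_real {-i..i} x *\<^sub>R h x) \<longlongrightarrow> h x) at_top" for x
  proof (rule tendsto_eventually)
    show "\<forall>\<^sub>F i in at_top. indicat_real {-i..i} x *\<^sub>R h x = h x"
      using eventually_ge_at_top[of "\<bar>x\<bar>"] by eventually_elim (auto simp: indicator_def abs_le_iff)
  qed
  then show "AE x in lborel. ((\<lambda>i. indicat_real {-i..i} x *\<^sub>R h x) \<longlongrightarrow> h x) at_top" by simp
  show "\<forall>\<^sub>F i in at_top. AE x in lborel. norm (indicat_real {-i..i} x *\<^sub>R h x) \<le> norm (h x)"
    by (simp split: split_indicator)
qed

lemma upper_weight_bound: "upper_weight g \<Longrightarrow> \<eta> > 0 \<Longrightarrow> norm (g (Complex \<xi> \<eta>)) \<le> 1 + 1 / \<eta>"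
  unfolding upper_weight_def by (metis complex.sel(2))

lemma upper_half_plane_primitive:
  assumes "f holomorphic_on {k. Im k > 0}"
  obtains F where "\<And>k. Im k > 0 \<Longrightarrow> (F has_field_derivative f k) (at k)"
proof -
  obtain F where "\<And>k. k \<in> {k. Im k > 0} \<Longrightarrow> (F has_field_derivative f k) (at k within {k. Im k > 0})"
    using holomorphic_convex_primitive'[OF convex_halfspace_Im_gt open_halfspace_Im_gt assms] by blast
  then have "(F has_field_derivative f k) (at k)" if "Im k > 0" for k
    using that at_within_open[OF _ open_halfspace_Im_gt[of 0]] by fastforce
  then show thesis using that by blast
qed

lemma entire_primitive:
  assumes "f holomorphic_on UNIV"
  obtains F where "\<And>k. (F has_field_derivative f k) (at k)"
  using holomorphic_convex_primitive'[OF convex_UNIV open_UNIV assms] by auto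

lemma tendsto_gaussian_tail:
  fixes c d b M :: real
  assumes "c > 0"
  shows "((\<lambda>r. exp (d * r + b - c * r\<^sup>2) * M) \<longlongrightarrow> 0) at_top"
  using assms by real_asymp

text \<open>
  The two horizontal lines are joined by vertical segments at real part \<open>\<plusminus>r\<close>, where the integrand is
  of size \<open>exp (- 3 t \<eta> r^2 + O(r))\<close>.
\<close>

lemma line_integral_indep_le:
  assumes g: "upper_weight g" and t: "t > 0" and eta: "0 < \<eta>1" "\<eta>1 \<le> \<eta>2"
  shows "line_integral g \<eta>1 z t = line_integral g \<eta>2 z t"
proof -
  define f where "f = (\<lambda>k. airy_phase z t k * g k)"
  have f: "f holomorphic_on {k. Im k > 0}"
    using g unfolding f_def upper_weight_def by (intro holomorphic_intros) auto
  obtain F where F: "\<And>k. Im k > 0 \<Longrightarrow> (F has_field_derivative f k) (at k)"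
    using upper_half_plane_primitive[OF f] by blast
  define A where "A = (\<lambda>\<eta> r. LINT \<xi>:{-r..r}|lborel. f (Complex \<xi> \<eta>))"
  have A: "A \<eta> r = F (Complex r \<eta>) - F (Complex (-r) \<eta>)" if "\<eta> > 0" "r \<ge> 0" for \<eta> r
    unfolding A_def
    by (rule horizontal_segment_integral[of "{k. Im k > 0}"])
       (use that F holomorphic_on_imp_continuous_on[OF f] in auto)
  have lim: "(A \<eta> \<longlongrightarrow> line_integral g \<eta> z t) at_top" if "\<eta> > 0" for \<eta>
    unfolding A_def line_integral_def f_def
    by (rule tendsto_truncated_integral[OF integrable_horizontal[OF g t that]])
  define B where "B = (\<lambda>r. exp (\<bar>Im z\<bar> * r + (\<eta>2 * \<bar>Re z\<bar> + t * \<eta>2 ^ 3) - (3 * t * \<eta>1) * r\<^sup>2) * ((1 + 1 / \<eta>1) * (\<eta>2 - \<eta>1)))"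
  have B0: "(B \<longlongrightarrow> 0) at_top"
    unfolding B_def by (rule tendsto_gaussian_tail) (use t eta in auto)
  have side: "norm (F (Complex s \<eta>2) - F (Complex s \<eta>1)) \<le> B r" if "\<bar>s\<bar> = r" for s r
  proof -
    let ?l = "linepath (Complex s \<eta>1) (Complex s \<eta>2)"
    have seg: "k = Complex s (Im k) \<and> \<eta>1 \<le> Im k \<and> Im k \<le> \<eta>2"
      if "k \<in> closed_segment (Complex s \<eta>1) (Complex s \<eta>2)" for k
      using that eta by (auto simp: closed_segment_same_Re closed_segment_eq_real_ivl complex_eq_iff)
    have "(f has_contour_integral (F (pathfinish ?l) - F (pathstart ?l))) ?l"
      by (rule contour_integral_primitive[of "{k. Im k > 0}"])
         (use eta seg in \<open>auto intro!: DERIV_subset[OF F] dest!: seg\<close>)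
    then have "norm (F (pathfinish ?l) - F (pathstart ?l)) \<le>
       (exp (\<bar>Im z\<bar> * r + (\<eta>2 * \<bar>Re z\<bar> + t * \<eta>2 ^ 3) - (3 * t * \<eta>1) * r\<^sup>2) * (1 + 1 / \<eta>1)) *
         norm (Complex s \<eta>2 - Complex s \<eta>1)"
    proof (rule has_contour_integral_bound_linepath)
      fix k assume "k \<in> closed_segment (Complex s \<eta>1) (Complex s \<eta>2)"
      from seg[OF this] obtain y where k: "k = Complex s y" and y: "\<eta>1 \<le> y" "y \<le> \<eta>2" by auto
      have 1: "norm (g k) \<le> 1 + 1 / \<eta>1"
      proof -
        have "norm (g k) \<le> 1 + 1 / y" using upper_weight_bound[OF g, of y s] k y eta by simp
        also have "\<dots> \<le> 1 + 1 / \<eta>1" using y eta by (simp add: frac_le)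
        finally show ?thesis .
      qed
      have "- s * Im z \<le> \<bar>Im z\<bar> * r"
        using that abs_ge_self[of "- s * Im z"] by (simp add: abs_mult mult.commute)
      moreover have "- y * Re z \<le> \<eta>2 * \<bar>Re z\<bar>"
        using abs_ge_self[of "- y * Re z"] y eta mult_right_mono[of y \<eta>2 "\<bar>Re z\<bar>"] by (simp add: abs_mult)
      moreover have "t * y ^ 3 \<le> t * \<eta>2 ^ 3"
        using t y eta by (intro mult_left_mono power_mono) auto
      moreover have "3 * t * \<eta>1 * r\<^sup>2 \<le> 3 * t * y * r\<^sup>2"
        using t y eta by (intro mult_right_mono mult_left_mono) auto
      moreover have "s\<^sup>2 = r\<^sup>2" using that by auto
      ultimately have 2: "norm (airy_phase z t k) \<le>
          exp (\<bar>Im z\<bar> * r + (\<eta>2 * \<bar>Re z\<bar> + t * \<eta>2 ^ 3) - (3 * t * \<eta>1) * r\<^sup>2)"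
        unfolding k norm_airy_phase by (simp add: algebra_simps)
      show "norm (f k) \<le> exp (\<bar>Im z\<bar> * r + (\<eta>2 * \<bar>Re z\<bar> + t * \<eta>2 ^ 3) - (3 * t * \<eta>1) * r\<^sup>2) * (1 + 1 / \<eta>1)"
        unfolding f_def norm_mult by (rule mult_mono[OF 2 1]) auto
    qed (use eta in auto)
    also have "norm (Complex s \<eta>2 - Complex s \<eta>1) = \<eta>2 - \<eta>1"
      using eta by (simp add: cmod_def)
    finally show ?thesis by (simp add: B_def)
  qed
  have "((\<lambda>r. A \<eta>2 r - A \<eta>1 r) \<longlongrightarrow> 0) at_top"
  proof (rule Lim_null_comparison)
    show "((\<lambda>r. B r + B r) \<longlongrightarrow> 0) at_top" using tendsto_add[OF B0 B0] by simp
    show "\<forall>\<^sub>F r in at_top. norm (A \<eta>2 r - A \<eta>1 r) \<le> B r + B r"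
      using eventually_ge_at_top[of 0]
    proof eventually_elim
      case (elim r)
      have "A \<eta>2 r - A \<eta>1 r = (F (Complex r \<eta>2) - F (Complex r \<eta>1)) - (F (Complex (-r) \<eta>2) - F (Complex (-r) \<eta>1))"
        using A elim eta by simp
      then show ?case
        using norm_triangle_ineq4 side[of r r] side[of "-r" r] elim
        by (smt (verit))
    qed
  qed
  moreover have "((\<lambda>r. A \<eta>2 r - A \<eta>1 r) \<longlongrightarrow> line_integral g \<eta>2 z t - line_integral g \<eta>1 z t) at_top"
    using eta by (intro tendsto_diff lim) auto
  ultimately show ?thesis using tendsto_unique[OF trivial_limit_at_top_linorder] by fastforce
qed

lemma line_integral_indep:
  assumes "upper_weight g" "t > 0" "\<eta> > 0"
  shows "line_integral g \<eta> z t = line_integral g 1 z t"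
  using line_integral_indep_le[OF assms(1,2), of \<eta> 1] line_integral_indep_le[OF assms(1,2), of 1 \<eta>] assms(3)
  by (cases "\<eta> \<le> 1") auto

text \<open>
  The height may vary with the truncation parameter: the end points of the
  truncated contours run to infinity along rays, and the horizontal segment that joins them rises with them.
\<close>

lemma tendsto_line_integral_of_tail_bound:
  assumes g: "upper_weight g" and t: "t > 0"
    and eta: "\<forall>\<^sub>F r in at_top. \<eta> r > 0"
    and D: "\<forall>\<^sub>F r in at_top. has_bochner_integral lborel (D r) (I r)"
    and nonneg: "\<forall>\<^sub>F r in at_top. \<forall>\<xi>. D r \<xi> \<ge> 0"
    and bound: "\<forall>\<^sub>F r in at_top. \<forall>\<xi>. \<xi> \<notin> {- b r..b r} \<longrightarrow>
       norm (airy_phase z t (Complex \<xi> (\<eta> r)) * g (Complex \<xi> (\<eta> r))) \<le> D r \<xi>"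
    and I: "(I \<longlongrightarrow> 0) at_top"
  shows "((\<lambda>r. LINT \<xi>:{- b r..b r}|lborel. airy_phase z t (Complex \<xi> (\<eta> r)) * g (Complex \<xi> (\<eta> r)))
     \<longlongrightarrow> line_integral g 1 z t) at_top"
proof (rule Lim_transform2[OF tendsto_const])
  show "((\<lambda>r. (line_integral g 1 z t) -
      (LINT \<xi>:{- b r..b r}|lborel. airy_phase z t (Complex \<xi> (\<eta> r)) * g (Complex \<xi> (\<eta> r)))) \<longlongrightarrow> 0) at_top"
  proof (rule Lim_null_comparison[OF _ I])
    show "\<forall>\<^sub>F r in at_top. norm (line_integral g 1 z t -
      (LINT \<xi>:{- b r..b r}|lborel. airy_phase z t (Complex \<xi> (\<eta> r)) * g (Complex \<xi> (\<eta> r)))) \<le> I r"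
      using eta D nonneg bound
    proof eventually_elim
      case (elim r)
      let ?h = "\<lambda>\<xi>. airy_phase z t (Complex \<xi> (\<eta> r)) * g (Complex \<xi> (\<eta> r))"
      have h: "integrable lborel ?h" by (rule integrable_horizontal[OF g t elim(1)])
      have h1: "integrable lborel (\<lambda>\<xi>. indicat_real {- b r..b r} \<xi> *\<^sub>R ?h \<xi>)"
        using integrable_mult_indicator[OF _ h, of "{- b r..b r}"] by simp
      have "line_integral g 1 z t - (LINT \<xi>:{- b r..b r}|lborel. ?h \<xi>)
        = (LINT \<xi>|lborel. ?h \<xi> - indicat_real {- b r..b r} \<xi> *\<^sub>R ?h \<xi>)"
        using h h1 line_integral_indep[OF g t elim(1), of z]
        by (simp add: line_integral_def set_lebesgue_integral_def)
      also have "norm \<dots> \<le> (LINT \<xi>|lborel. D r \<xi>)"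
      proof (rule Bochner_Integration.integral_norm_bound_integral)
        show "integrable lborel (D r)" using elim(2) by (simp add: has_bochner_integral_iff)
        show "integrable lborel (\<lambda>\<xi>. ?h \<xi> - indicat_real {- b r..b r} \<xi> *\<^sub>R ?h \<xi>)"
          using h h1 by (rule Bochner_Integration.integrable_diff)
        show "norm (?h \<xi> - indicat_real {- b r..b r} \<xi> *\<^sub>R ?h \<xi>) \<le> D r \<xi>" for \<xi>
          using elim(3,4) by (cases "\<xi> \<in> {- b r..b r}") auto
      qed
      also have "\<dots> = I r" using elim(2) by (simp add: has_bochner_integral_iff)
      finally show ?case .
    qed
  qed
qed

text \<open>
  The segment has its end points \<open>r exp (i pi/3)\<close> and \<open>r exp (2 i pi/3)\<close> on the rays where
  \<open>i k^3\<close> is imaginary. Outside it the cubic term decays like a Gaussian in the distance to the end points, and the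
  assumption on \<open>z\<close> lets \<open>exp (i k z)\<close> contribute the factor \<open>exp (- \<eta> x)\<close>.
\<close>

lemma sector_limit:
  assumes g: "upper_weight g" and t: "t > 0" and x: "x > 0" and z: "Re z = x + \<bar>Im z\<bar> / sqrt 3"
  shows "((\<lambda>r. LINT \<xi>:{- (r / 2)..r / 2}|lborel.
      airy_phase z t (Complex \<xi> (sqrt 3 / 2 * r)) * g (Complex \<xi> (sqrt 3 / 2 * r)))
     \<longlongrightarrow> line_integral g 1 z t) at_top"
proof (rule tendsto_line_integral_of_tail_bound[OF g t])
  define c where "c = sqrt 3 / 2"
  have c: "c > 0" "sqrt 3 / 2 = c" "c\<^sup>2 = 3 / 4" by (auto simp: c_def power_divide)
  define A where "A = (\<lambda>r. (1 + 1 / (c * r)) * exp (- (c * r) * x))"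
  define G where "G = (\<lambda>r m \<xi>. exp (- (3 * t * (c * r)) * (\<xi> - m)\<^sup>2))"
  show "\<forall>\<^sub>F r in at_top. sqrt 3 / 2 * r > 0"
    using eventually_gt_at_top[of 0] by eventually_elim auto
  show "\<forall>\<^sub>F r in at_top. has_bochner_integral lborel
      (\<lambda>\<xi>. A r * (G r (r / 2) \<xi> + G r (- (r / 2)) \<xi>))
      (A r * (sqrt (pi / (3 * t * (c * r))) + sqrt (pi / (3 * t * (c * r)))))"
    using eventually_gt_at_top[of 0]
  proof eventually_elim
    case (elim r)
    show ?case unfolding G_def
      by (intro has_bochner_integral_mult_right has_bochner_integral_add has_bochner_integral_gaussian)
         (use elim t c in auto)
  qed
  show "\<forall>\<^sub>F r in at_top. \<forall>\<xi>. 0 \<le> A r * (G r (r / 2) \<xi> + G r (- (r / 2)) \<xi>)"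
    using eventually_gt_at_top[of 0]
    by eventually_elim (use c in \<open>auto simp: A_def G_def intro!: mult_nonneg_nonneg add_nonneg_nonneg\<close>)
  show "((\<lambda>r. A r * (sqrt (pi / (3 * t * (c * r))) + sqrt (pi / (3 * t * (c * r))))) \<longlongrightarrow> 0) at_top"
    unfolding A_def using t c(1) x by real_asymp
  have "filterlim (\<lambda>r. 3 * t * (c * r)) at_top at_top" using t c(1) by real_asymp
  then have ev: "\<forall>\<^sub>F r in at_top. \<bar>Im z\<bar> \<le> 3 * t * (c * r)" by (simp add: filterlim_at_top)
  have ev2: "\<forall>\<^sub>F r in at_top. \<bar>Im z\<bar> \<le> 3 * t * (c * r) * r"
    using ev eventually_ge_at_top[of 1]
  proof eventually_elim
    case (elim r)
    have "3 * t * (c * r) * 1 \<le> 3 * t * (c * r) * r" using elim t c by (intro mult_left_mono) auto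
    then show ?case using elim by simp
  qed
  show "\<forall>\<^sub>F r in at_top. \<forall>\<xi>. \<xi> \<notin> {- (r / 2)..r / 2} \<longrightarrow>
      norm (airy_phase z t (Complex \<xi> (sqrt 3 / 2 * r)) * g (Complex \<xi> (sqrt 3 / 2 * r)))
        \<le> A r * (G r (r / 2) \<xi> + G r (- (r / 2)) \<xi>)"
    using ev2 eventually_gt_at_top[of 0]
  proof (eventually_elim, intro allI impI)
    fix r \<xi> :: real
    assume r: "\<bar>Im z\<bar> \<le> 3 * t * (c * r) * r" "r > 0" and xi: "\<xi> \<notin> {- (r / 2)..r / 2}"
    let ?k = "Complex \<xi> (c * r)"
    define u where "u = \<bar>\<xi>\<bar> - r / 2"
    have u: "u \<ge> 0" "\<bar>\<xi>\<bar> = u + r / 2" using xi by (auto simp: u_def)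
    have xi2: "\<xi>\<^sup>2 = (u + r / 2)\<^sup>2" using u(2) by (metis power2_abs)
    have 1: "norm (g ?k) \<le> 1 + 1 / (c * r)"
      by (rule upper_weight_bound[OF g]) (use r c in simp)
    have "- \<xi> * Im z \<le> (u + r / 2) * \<bar>Im z\<bar>"
      using abs_ge_self[of "- \<xi> * Im z"] u by (simp add: abs_mult)
    moreover have "c * r * Re z = c * r * x + r / 2 * \<bar>Im z\<bar>"
      unfolding z c_def by (simp add: algebra_simps)
    moreover have "t * ((c * r) ^ 3 - 3 * \<xi>\<^sup>2 * (c * r)) = - 3 * t * (c * r) * u * r - 3 * t * (c * r) * u\<^sup>2"
    proof -
      have "(c * r) ^ 3 = 3 / 4 * r\<^sup>2 * (c * r)"
        using c(3) by (simp add: power3_eq_cube power2_eq_square)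
      then show ?thesis unfolding xi2 by (simp add: power2_eq_square algebra_simps)
    qed
    moreover have "u * \<bar>Im z\<bar> \<le> u * (3 * t * (c * r) * r)" using u r by (intro mult_left_mono) auto
    ultimately have "- \<xi> * Im z - (c * r) * Re z + t * ((c * r) ^ 3 - 3 * \<xi>\<^sup>2 * (c * r))
       \<le> - (c * r) * x + - (3 * t * (c * r)) * u\<^sup>2"
      by (simp add: algebra_simps)
    then have "norm (airy_phase z t ?k) \<le> exp (- (c * r) * x) * exp (- (3 * t * (c * r)) * u\<^sup>2)"
      unfolding norm_airy_phase exp_add[symmetric] by simp
    also have "exp (- (3 * t * (c * r)) * u\<^sup>2) \<le> G r (r / 2) \<xi> + G r (- (r / 2)) \<xi>"
    proof (cases "\<xi> \<ge> 0")
      case True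
      then have "u = \<xi> - r / 2" by (simp add: u_def)
      then show ?thesis by (simp add: G_def)
    next
      case False
      then have "u\<^sup>2 = (\<xi> - - (r / 2))\<^sup>2" by (simp add: u_def power2_eq_square algebra_simps)
      then show ?thesis by (simp add: G_def)
    qed
    finally have 2: "norm (airy_phase z t ?k) \<le> exp (- (c * r) * x) * (G r (r / 2) \<xi> + G r (- (r / 2)) \<xi>)"
      by simp
    have "norm (airy_phase z t ?k * g ?k) \<le>
       exp (- (c * r) * x) * (G r (r / 2) \<xi> + G r (- (r / 2)) \<xi>) * (1 + 1 / (c * r))"
      unfolding norm_mult by (rule mult_mono[OF 2 1]) (auto simp: G_def)
    then show "norm (airy_phase z t (Complex \<xi> (sqrt 3 / 2 * r)) * g (Complex \<xi> (sqrt 3 / 2 * r)))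
        \<le> A r * (G r (r / 2) \<xi> + G r (- (r / 2)) \<xi>)"
      unfolding c(2) A_def by (simp add: mult_ac)
  qed
qed

definition airy_primitive :: "complex \<Rightarrow> real \<Rightarrow> complex" where
  "airy_primitive z t = 1 / (2 * of_real pi) * line_integral (\<lambda>k. 1 / (\<i> * k)) 1 z t"

definition airy_kernel :: "complex \<Rightarrow> real \<Rightarrow> complex" where
  "airy_kernel z t = 1 / (2 * of_real pi) * line_integral (\<lambda>k. 1) 1 z t"

lemma ray_points:
  "of_real r * cis (2 * pi / 3) = Complex (- (r / 2)) (sqrt 3 / 2 * r)"
  "of_real r * cis (pi / 3) = Complex (r / 2) (sqrt 3 / 2 * r)"
  by (auto simp: complex_eq_iff cos_120 sin_120 cos_60 sin_60)

text \<open>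
  The contour stays in the upper half plane, where the integrand has no singularity, so the arc around the
  origin may be replaced by the segment joining the end points; the radius \<open>R\<close> disappears.
\<close>

lemma contour_integral_bdry_D1:
  assumes f: "f holomorphic_on {k. Im k > 0}" and "R > 0" "r > 0"
  shows "contour_integral (bdry_D1 R r) f =
     (LINT \<xi>:{- (r / 2)..r / 2}|lborel. f (Complex \<xi> (sqrt 3 / 2 * r)))"
proof -
  obtain F where F: "\<And>k. Im k > 0 \<Longrightarrow> (F has_field_derivative f k) (at k)"
    using upper_half_plane_primitive[OF f] by blast
  let ?U = "{k. Im k > 0}"
  have seg: "closed_segment a b \<subseteq> ?U" if "Im a > 0" "Im b > 0" for a b
    using that by (intro closed_segment_subset convex_halfspace_Im_gt) auto
  have arc: "path_image (part_circlepath 0 R (2 * pi / 3) (pi / 3)) \<subseteq> ?U"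
  proof -
    have "closed_segment (2 * pi / 3) (pi / 3) \<subseteq> {0<..<pi}"
      by (auto simp: closed_segment_eq_real_ivl) (use pi_gt_zero in linarith)+
    then show ?thesis
      using \<open>R > 0\<close> by (auto simp: path_image_part_circlepath' sin_gt_zero)
  qed
  have ends: "part_circlepath 0 R a b 0 = of_real R * cis a"
    "part_circlepath 0 R a b 1 = of_real R * cis b" for a b
    by (simp_all add: part_circlepath_def linepath_def cis_conv_exp)
  have ends': "pathstart (part_circlepath 0 R (2 * pi / 3) (pi / 3)) = of_real R * cis (2 * pi / 3)"
    "pathfinish (part_circlepath 0 R (2 * pi / 3) (pi / 3)) = of_real R * cis (pi / 3)"
    unfolding pathstart_def pathfinish_def ends by (rule refl)+
  have "(f has_contour_integral (F (pathfinish (bdry_D1 R r)) - F (pathstart (bdry_D1 R r)))) (bdry_D1 R r)"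
  proof (rule contour_integral_primitive[of ?U])
    show "(F has_field_derivative f k) (at k within ?U)" if "k \<in> ?U" for k
      using DERIV_subset[OF F] that by auto
    show "valid_path (bdry_D1 R r)"
      unfolding bdry_D1_def by (intro valid_path_join)
        (auto simp: ends' simp del: pathstart_part_circlepath pathfinish_part_circlepath)
    show "path_image (bdry_D1 R r) \<subseteq> ?U"
      unfolding bdry_D1_def using seg arc assms
      by (simp add: path_image_join ends' ray_points del: pathstart_part_circlepath pathfinish_part_circlepath)
  qed
  moreover have "pathstart (bdry_D1 R r) = of_real r * cis (2 * pi / 3)"
    "pathfinish (bdry_D1 R r) = of_real r * cis (pi / 3)"
    by (simp_all add: bdry_D1_def)
  ultimately have "contour_integral (bdry_D1 R r) f =
     F (of_real r * cis (pi / 3)) - F (of_real r * cis (2 * pi / 3))"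
    using contour_integral_unique by simp
  also have "\<dots> = (LINT \<xi>:{- (r / 2)..r / 2}|lborel. f (Complex \<xi> (sqrt 3 / 2 * r)))"
    unfolding ray_points
    by (subst horizontal_segment_integral[of ?U F f])
       (use assms F holomorphic_on_imp_continuous_on[OF f] in auto)
  finally show ?thesis .
qed

lemma contour_integral_bdry_D:
  assumes f: "f holomorphic_on UNIV" and "r > 0"
  shows "contour_integral (bdry_D r) f =
     (LINT \<xi>:{- (r / 2)..r / 2}|lborel. f (Complex \<xi> (sqrt 3 / 2 * r)))"
proof -
  obtain F where F: "\<And>k. (F has_field_derivative f k) (at k)"
    using entire_primitive[OF f] by blast
  have "(f has_contour_integral (F (pathfinish (bdry_D r)) - F (pathstart (bdry_D r)))) (bdry_D r)"
    using F by (intro contour_integral_primitive[of UNIV]) (auto simp: bdry_D_def)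
  then have "contour_integral (bdry_D r) f =
     F (of_real r * cis (pi / 3)) - F (of_real r * cis (2 * pi / 3))"
    using contour_integral_unique by (simp add: bdry_D_def)
  also have "\<dots> = (LINT \<xi>:{- (r / 2)..r / 2}|lborel. f (Complex \<xi> (sqrt 3 / 2 * r)))"
    unfolding ray_points
    by (subst horizontal_segment_integral[of UNIV F f])
       (use assms F holomorphic_on_imp_continuous_on[OF f] in auto)
  finally show ?thesis .
qed

lemma I_eq_airy_primitive:
  assumes "R > 0" "x > 0" "t > 0"
  shows "I_\<omega>_0_1 R x t = airy_primitive (of_real x) t"
proof -
  let ?f = "\<lambda>k. airy_phase (of_real x) t k * (1 / (\<i> * k))"
  have hol: "?f holomorphic_on {k. Im k > 0}" by (intro holomorphic_intros) auto
  have "((\<lambda>r. LINT \<xi>:{- (r / 2)..r / 2}|lborel. ?f (Complex \<xi> (sqrt 3 / 2 * r)))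
     \<longlongrightarrow> line_integral (\<lambda>k. 1 / (\<i> * k)) 1 (of_real x) t) at_top"
    by (rule sector_limit[OF upper_weight_inverse]) (use assms in auto)
  moreover have "\<forall>\<^sub>F r in at_top. (LINT \<xi>:{- (r / 2)..r / 2}|lborel. ?f (Complex \<xi> (sqrt 3 / 2 * r)))
      = contour_integral (bdry_D1 R r) ?f"
    using eventually_gt_at_top[of 0]
    by eventually_elim (simp only: contour_integral_bdry_D1[OF hol assms(1)])
  ultimately have "((\<lambda>r. contour_integral (bdry_D1 R r) ?f)
     \<longlongrightarrow> line_integral (\<lambda>k. 1 / (\<i> * k)) 1 (of_real x) t) at_top"
    by (rule Lim_transform_eventually)
  then have "improper_contour_integral (bdry_D1 R) ?f = line_integral (\<lambda>k. 1 / (\<i> * k)) 1 (of_real x) t"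
    unfolding improper_contour_integral_def by (intro tendsto_Lim) auto
  then show ?thesis
    by (simp add: I_\<omega>_0_1_def airy_primitive_def phase_eq_airy_phase)
qed

section \<open>The real line, and decay of the Airy primitive\<close>

text \<open>
  The vertical sides start on the real line, where there is no decay, so that they are integrated rather than
  estimated by their supremum; this leaves a factor \<open>1/r^2\<close>.
\<close>

lemma real_line_limit:
  assumes "t > 0"
  shows "((\<lambda>r. contour_integral (real_line r) (airy_phase (of_real x) t))
     \<longlongrightarrow> line_integral (\<lambda>k. 1) 1 (of_real x) t) at_top"
proof -
  let ?f = "airy_phase (of_real x) t"
  have hol: "?f holomorphic_on UNIV"
    using airy_phase_holomorphic[OF holomorphic_on_ident] by simp
  obtain F where F: "\<And>k. (F has_field_derivative ?f k) (at k)"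
    using entire_primitive[OF hol] by blast
  define C where "C = exp (\<bar>x\<bar> + t)"
  define J where "J = (\<lambda>r. LINT \<xi>:{-r..r}|lborel. ?f (Complex \<xi> 1) * 1)"
  have J: "(J \<longlongrightarrow> line_integral (\<lambda>k. 1) 1 (of_real x) t) at_top"
    unfolding J_def line_integral_def
    by (rule tendsto_truncated_integral[OF integrable_horizontal[OF upper_weight_one assms]]) simp
  have side: "norm (F (Complex s 1) - F (Complex s 0)) \<le> C / (3 * t * r\<^sup>2)" if "\<bar>s\<bar> = r" "r > 0" for s r
  proof -
    define c where "c = 3 * t * r\<^sup>2"
    have c: "c > 0" using assms that by (simp add: c_def)
    have s2: "s\<^sup>2 = r\<^sup>2" using that by auto
    have "norm (F (Complex s 1) - F (Complex s 0)) \<le> - (C / c) * exp (- c * 1) - - (C / c) * exp (- c * 0)"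
    proof (rule differentiable_bound_general[where f = "\<lambda>y. F (Complex s y)" and f' = "\<lambda>y. \<i> * ?f (Complex s y)"
          and \<phi> = "\<lambda>y. - (C / c) * exp (- c * y)" and \<phi>' = "\<lambda>y. C * exp (- c * y)"])
      have A: "((\<lambda>y. F (Complex s y)) has_vector_derivative \<i> * ?f (Complex s y)) (at y within S)" for y S
      proof -
        have B: "((\<lambda>y. Complex s y) has_vector_derivative \<i>) (at y within S)"
          unfolding Complex_eq
          by (auto intro!: derivative_eq_intros simp: has_vector_derivative_def scaleR_conv_of_real)
        from field_vector_diff_chain_within[OF B DERIV_subset[OF F]] show ?thesis by (simp add: o_def)
      qed
      then show "((\<lambda>y. F (Complex s y)) has_vector_derivative \<i> * ?f (Complex s y)) (at y)" for y .
      show "continuous_on {0..1} (\<lambda>y. F (Complex s y))"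
        using A has_vector_derivative_continuous unfolding continuous_on_eq_continuous_within by blast
      show "continuous_on {0..1} (\<lambda>y. - (C / c) * exp (- c * y))" by (intro continuous_intros)
      show "((\<lambda>y. - (C / c) * exp (- c * y)) has_vector_derivative C * exp (- c * y)) (at y)" for y
        unfolding has_real_derivative_iff_has_vector_derivative[symmetric]
        using c by (auto intro!: derivative_eq_intros)
      fix y :: real assume y: "0 < y" "y < 1"
      have "- y * x \<le> \<bar>x\<bar>"
        using abs_ge_self[of "- y * x"] y mult_right_mono[of y 1 "\<bar>x\<bar>"] by (simp add: abs_mult)
      moreover have "t * y ^ 3 \<le> t" using y assms power_le_one[of y 3] mult_left_mono[of "y^3" 1 t] by simp
      ultimately have "norm (?f (Complex s y)) \<le> exp ((\<bar>x\<bar> + t) + - c * y)"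
        unfolding norm_airy_phase by (simp add: c_def s2 algebra_simps)
      then show "norm (\<i> * ?f (Complex s y)) \<le> C * exp (- c * y)"
        unfolding exp_add C_def by (simp add: norm_mult)
    qed auto
    also have "\<dots> \<le> C / c" using c by (simp add: C_def)
    finally show ?thesis by (simp add: c_def)
  qed
  show ?thesis
  proof (rule Lim_transform[OF J])
    show "((\<lambda>r. contour_integral (real_line r) ?f - J r) \<longlongrightarrow> 0) at_top"
    proof (rule Lim_null_comparison)
      show "((\<lambda>r. C / (3 * t * r\<^sup>2) + C / (3 * t * r\<^sup>2)) \<longlongrightarrow> 0) at_top"
        using assms by real_asymp
      show "\<forall>\<^sub>F r in at_top. norm (contour_integral (real_line r) ?f - J r)
          \<le> C / (3 * t * r\<^sup>2) + C / (3 * t * r\<^sup>2)"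
        using eventually_gt_at_top[of 0]
      proof eventually_elim
        case (elim r)
        have 1: "J r = F (Complex r 1) - F (Complex (-r) 1)"
          unfolding J_def mult_1_right
          by (rule horizontal_segment_integral[of UNIV])
             (use elim F holomorphic_on_imp_continuous_on[OF hol] in auto)
        have "(?f has_contour_integral (F (pathfinish (real_line r)) - F (pathstart (real_line r)))) (real_line r)"
          using F by (intro contour_integral_primitive[of UNIV]) (auto simp: real_line_def)
        moreover have "- complex_of_real r = Complex (-r) 0" by (simp add: complex_eq_iff)
        ultimately have 2: "contour_integral (real_line r) ?f = F (Complex r 0) - F (Complex (-r) 0)"
          using contour_integral_unique by (simp add: real_line_def complex_of_real_def)
        have "contour_integral (real_line r) ?f - J r =
          (F (Complex (-r) 1) - F (Complex (-r) 0)) - (F (Complex r 1) - F (Complex r 0))"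
          unfolding 1 2 by simp
        then show ?case
          using norm_triangle_ineq4 side[of r r] side[of "-r" r] elim by (smt (verit))
      qed
    qed
  qed
qed

text \<open>
  The second-derivative test. The function \<open>cis \<phi> * A(\<phi>')\<close> with \<open>A(s) = s/(i (1 + s^2))\<close>
  has derivative \<open>cis \<phi>\<close> up to an error bounded by \<open>(1 + |\<phi>''|)/(1 + \<phi>'^2)\<close>, which is at most
  \<open>1 + 1/\<mu>\<close> times the modulus of the derivative of \<open>arctan \<phi>'\<close>. No splitting at the stationary point is needed.
\<close>

lemma van_der_Corput_bound:
  fixes \<phi> \<phi>1 \<phi>2 :: "real \<Rightarrow> real"
  assumes "u \<le> v" "\<mu> > 0" "\<epsilon> = 1 \<or> \<epsilon> = -1"
    and d1: "\<And>k. (\<phi> has_real_derivative \<phi>1 k) (at k)"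
    and d2: "\<And>k. (\<phi>1 has_real_derivative \<phi>2 k) (at k)"
    and lb: "\<And>k. u \<le> k \<Longrightarrow> k \<le> v \<Longrightarrow> \<mu> \<le> \<epsilon> * \<phi>2 k"
    and F: "\<And>k. (F has_vector_derivative cis (\<phi> k)) (at k)"
  shows "norm (F v - F u) \<le> (1 + 1 / \<mu>) * pi + 1"
proof (cases "u = v")
  case True then show ?thesis using assms(2) by simp
next
  case False
  then have uv: "u < v" using assms by simp
  define D where "D = (\<lambda>k. 1 + (\<phi>1 k)\<^sup>2)"
  have D: "D k \<ge> 1" for k by (simp add: D_def)
  \<comment> \<open>The correction term is of size \<open>1/2\<close> at most and vanishes at the stationary point.\<close>
  define A where "A = (\<lambda>k. \<phi>1 k / D k)"
  define A' where "A' = (\<lambda>k. \<phi>2 k * (1 - (\<phi>1 k)\<^sup>2) / (D k)\<^sup>2)"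
  have dA: "(A has_real_derivative A' k) (at k)" for k
  proof -
    have "D k \<noteq> 0" using D[of k] by simp
    then show ?thesis unfolding A_def A'_def D_def
      by (auto intro!: derivative_eq_intros d2 simp: field_simps power2_eq_square)
  qed
  define H where "H = (\<lambda>k. F k + \<i> * (of_real (A k) * cis (\<phi> k)))"
  define H' where "H' = (\<lambda>k. cis (\<phi> k) * (of_real (1 - \<phi>1 k * A k) + \<i> * of_real (A' k)))"
  have dcis: "((\<lambda>k. cis (\<phi> k)) has_vector_derivative \<i> * of_real (\<phi>1 k) * cis (\<phi> k)) (at k)" for k
  proof -
    have "((\<lambda>k. cos (\<phi> k)) has_real_derivative - sin (\<phi> k) * \<phi>1 k) (at k)"
      "((\<lambda>k. sin (\<phi> k)) has_real_derivative cos (\<phi> k) * \<phi>1 k) (at k)"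
      by (auto intro!: derivative_eq_intros d1)
    then show ?thesis
      by (auto simp: has_vector_derivative_complex_iff has_real_derivative_iff_has_vector_derivative mult.commute)
  qed
  have dAv: "((\<lambda>k. complex_of_real (A k)) has_vector_derivative of_real (A' k)) (at k)" for k
    using dA has_vector_derivative_of_real by (auto simp: has_real_derivative_iff_has_vector_derivative)
  have dH: "(H has_vector_derivative H' k) (at k)" for k
    unfolding H_def H'_def
    by (rule derivative_eq_intros F dcis dAv refl)+ (simp add: algebra_simps)
  have "norm (H v - H u) \<le> (1 + 1 / \<mu>) * (\<epsilon> * arctan (\<phi>1 v)) - (1 + 1 / \<mu>) * (\<epsilon> * arctan (\<phi>1 u))"
  proof (rule differentiable_bound_general[OF uv, where f' = H'
        and \<phi> = "\<lambda>k. (1 + 1 / \<mu>) * (\<epsilon> * arctan (\<phi>1 k))" and \<phi>' = "\<lambda>k. (1 + 1 / \<mu>) * (\<epsilon> * (\<phi>2 k / D k))"])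
    show "continuous_on {u..v} H"
      using dH has_vector_derivative_at_within has_vector_derivative_continuous
      unfolding continuous_on_eq_continuous_within by blast
    have da: "((\<lambda>k. (1 + 1 / \<mu>) * (\<epsilon> * arctan (\<phi>1 k))) has_real_derivative
        (1 + 1 / \<mu>) * (\<epsilon> * (\<phi>2 k / D k))) (at k)" for k
    proof -
      have "((\<lambda>k. arctan (\<phi>1 k)) has_real_derivative \<phi>2 k / D k) (at k)"
        by (auto intro!: derivative_eq_intros d2 simp: D_def inverse_eq_divide)
      then show ?thesis by (rule DERIV_cmult[OF DERIV_cmult])
    qed
    show "continuous_on {u..v} (\<lambda>k. (1 + 1 / \<mu>) * (\<epsilon> * arctan (\<phi>1 k)))"
      by (rule DERIV_continuous_on) (rule has_field_derivative_at_within[OF da])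
    show "((\<lambda>k. (1 + 1 / \<mu>) * (\<epsilon> * arctan (\<phi>1 k))) has_vector_derivative
        (1 + 1 / \<mu>) * (\<epsilon> * (\<phi>2 k / D k))) (at k)" for k
      using da[of k] unfolding has_real_derivative_iff_has_vector_derivative .
    show "(H has_vector_derivative H' k) (at k)" for k by (rule dH)
    fix k assume k: "u < k" "k < v"
    have L: "\<mu> \<le> \<epsilon> * \<phi>2 k" using lb k by simp
    then have absL: "\<bar>\<phi>2 k\<bar> = \<epsilon> * \<phi>2 k" using assms(2,3) by auto
    have Dp: "D k > 0" using D[of k] by simp
    have 1: "1 - \<phi>1 k * A k = 1 / D k"
      using Dp by (simp add: A_def D_def field_simps power2_eq_square)
    have 2: "\<bar>A' k\<bar> \<le> \<epsilon> * \<phi>2 k / D k"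
    proof -
      have "\<bar>1 - (\<phi>1 k)\<^sup>2\<bar> \<le> D k" by (simp add: D_def abs_if)
      then have "\<bar>\<phi>2 k\<bar> * \<bar>1 - (\<phi>1 k)\<^sup>2\<bar> / (D k)\<^sup>2 \<le> \<bar>\<phi>2 k\<bar> * D k / (D k)\<^sup>2"
        by (intro divide_right_mono mult_left_mono) auto
      then show ?thesis using Dp by (simp add: A'_def abs_mult absL power2_eq_square)
    qed
    have 3: "1 / D k \<le> 1 / \<mu> * (\<epsilon> * \<phi>2 k / D k)"
      using L assms(2) Dp by (simp add: field_simps)
    have "norm (H' k) \<le> \<bar>1 / D k\<bar> + \<bar>A' k\<bar>"
      unfolding H'_def norm_mult 1
      using norm_triangle_ineq[of "of_real (1 / D k)" "\<i> * of_real (A' k) :: complex"]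
      by (simp add: norm_mult del: of_real_divide)
    also have "\<dots> \<le> 1 / \<mu> * (\<epsilon> * \<phi>2 k / D k) + \<epsilon> * \<phi>2 k / D k" using 2 3 Dp by simp
    also have "\<dots> = (1 + 1 / \<mu>) * (\<epsilon> * \<phi>2 k / D k)"
      by (simp only: distrib_right mult_1_left add.commute)
    finally show "norm (H' k) \<le> (1 + 1 / \<mu>) * (\<epsilon> * (\<phi>2 k / D k))"
      by (simp only: times_divide_eq_right)
  qed
  also have "\<dots> = (1 + 1 / \<mu>) * (\<epsilon> * arctan (\<phi>1 v) - \<epsilon> * arctan (\<phi>1 u))" by (simp add: algebra_simps)
  also have "\<dots> \<le> (1 + 1 / \<mu>) * pi"
    using assms(2,3) arctan_bounded[of "\<phi>1 v"] arctan_bounded[of "\<phi>1 u"] by (intro mult_left_mono) auto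
  finally have 1: "norm (H v - H u) \<le> (1 + 1 / \<mu>) * pi" .
  have A12: "\<bar>A k\<bar> \<le> 1 / 2" for k
  proof -
    have "2 * \<bar>\<phi>1 k\<bar> \<le> D k"
      using sum_squares_bound[of "\<bar>\<phi>1 k\<bar>" 1] by (simp add: D_def)
    then show ?thesis using D[of k] by (simp add: A_def abs_divide field_simps)
  qed
  have "F v - F u = (H v - H u) - \<i> * (of_real (A v) * cis (\<phi> v)) + \<i> * (of_real (A u) * cis (\<phi> u))"
    by (simp add: H_def)
  also have "norm \<dots> \<le> norm (H v - H u) + \<bar>A v\<bar> + \<bar>A u\<bar>"
    using norm_triangle_ineq[of "(H v - H u) - \<i> * (of_real (A v) * cis (\<phi> v))" "\<i> * (of_real (A u) * cis (\<phi> u))"]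
      norm_triangle_ineq4[of "H v - H u" "\<i> * (of_real (A v) * cis (\<phi> v))"]
    by (simp add: norm_mult)
  finally show ?thesis using 1 A12[of v] A12[of u] by simp
qed

text \<open>
  Uniformity in \<open>x\<close> matters here: the bound dominates the truncated kernel at \<open>x - y\<close> for all
  \<open>y\<close> at once.
\<close>

lemma real_line_bound:
  assumes "t > 0" "r \<ge> 1"
  shows "norm (contour_integral (real_line r) (airy_phase (of_real x) t)) \<le> 2 * ((1 + 1 / (6 * t)) * pi + 1) + 2"
proof -
  let ?f = "airy_phase (of_real x) t"
  have hol: "?f holomorphic_on UNIV"
    using airy_phase_holomorphic[OF holomorphic_on_ident] by simp
  obtain F where F: "\<And>k. (F has_field_derivative ?f k) (at k)"
    using entire_primitive[OF hol] by blast
  define f where "f = (\<lambda>k::real. F (of_real k))"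
  have "(?f has_contour_integral (F (pathfinish (real_line r)) - F (pathstart (real_line r)))) (real_line r)"
    using F by (intro contour_integral_primitive[of UNIV]) (auto simp: real_line_def)
  then have 1: "contour_integral (real_line r) ?f = (f r - f 1) + (f 1 - f (-1)) + (f (-1) - f (-r))"
    using contour_integral_unique by (simp add: real_line_def f_def)
  have cis: "?f (of_real k) = cis (k * x + t * k ^ 3)" for k
    by (simp add: airy_phase_def cis_conv_exp algebra_simps)
  have df: "(f has_vector_derivative cis (k * x + t * k ^ 3)) (at k)" for k
  proof -
    have "(of_real has_vector_derivative (1::complex)) (at k)"
      by (auto intro!: derivative_eq_intros simp: has_vector_derivative_def scaleR_conv_of_real)
    from field_vector_diff_chain_within[OF this DERIV_subset[OF F]]
    show ?thesis by (simp add: f_def o_def cis)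
  qed
  have d1: "((\<lambda>k. k * x + t * k ^ 3) has_real_derivative x + 3 * t * k\<^sup>2) (at k)" for k
    by (auto intro!: derivative_eq_intros)
  have d2: "((\<lambda>k. x + 3 * t * k\<^sup>2) has_real_derivative 6 * t * k) (at k)" for k
    by (auto intro!: derivative_eq_intros)
  have 2: "norm (f r - f 1) \<le> (1 + 1 / (6 * t)) * pi + 1"
    by (rule van_der_Corput_bound[OF _ _ _ d1 d2 _ df, where \<epsilon> = 1]) (use assms in auto)
  have 3: "norm (f (-1) - f (-r)) \<le> (1 + 1 / (6 * t)) * pi + 1"
  proof (rule van_der_Corput_bound[OF _ _ _ d1 d2 _ df, where \<epsilon> = "-1"])
    show "6 * t \<le> - 1 * (6 * t * k)" if "- r \<le> k" "k \<le> - 1" for k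
      using mult_left_mono[of 1 "- k" t] that assms by (simp add: mult.commute)
  qed (use assms in auto)
  have 4: "norm (f 1 - f (-1)) \<le> 1 - (-1)"
  proof (rule differentiable_bound_general[where f' = "\<lambda>k. cis (k * x + t * k ^ 3)" and \<phi> = "\<lambda>k. k" and \<phi>' = "\<lambda>_. 1"])
    show "continuous_on {-1..1} f"
      using df has_vector_derivative_at_within has_vector_derivative_continuous
      unfolding continuous_on_eq_continuous_within by blast
    show "((\<lambda>k. k) has_vector_derivative 1) (at k)" for k :: real by (auto intro!: derivative_eq_intros)
  qed (auto intro: df continuous_intros)
  have "norm (contour_integral (real_line r) ?f) \<le>
      norm (f r - f 1) + norm (f 1 - f (-1)) + norm (f (-1) - f (-r))"
    unfolding 1 by (rule order_trans[OF norm_triangle_ineq add_right_mono[OF norm_triangle_ineq]])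
  then show ?thesis using 2 3 4 by (simp only: mult_2)
qed

lemma bdry_D_limit:
  assumes "t > 0" "x > 0" "Re z = x + \<bar>Im z\<bar> / sqrt 3"
  shows "((\<lambda>r. contour_integral (bdry_D r) (airy_phase z t)) \<longlongrightarrow> line_integral (\<lambda>k. 1) 1 z t) at_top"
proof -
  have hol: "(\<lambda>k. airy_phase z t k * 1) holomorphic_on UNIV"
    by (intro holomorphic_intros)
  have "\<forall>\<^sub>F r in at_top. (LINT \<xi>:{- (r / 2)..r / 2}|lborel. airy_phase z t (Complex \<xi> (sqrt 3 / 2 * r)) * 1)
      = contour_integral (bdry_D r) (\<lambda>k. airy_phase z t k * 1)"
    using eventually_gt_at_top[of 0]
    by eventually_elim (simp only: contour_integral_bdry_D[OF hol])
  from Lim_transform_eventually[OF sector_limit[OF upper_weight_one assms] this]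
  show ?thesis by simp
qed

text \<open>
  The decay comes from the height at which the exponent vanishes. Near the origin that height tends to \<open>0\<close>
  and the weight \<open>1/(i k)\<close> blows up; there the height \<open>t^(-1/3)\<close>, dictated by scaling, is used.
\<close>

lemma airy_primitive_bounds:
  assumes t: "t > 0" and z: "Re z \<ge> 0" "\<bar>Im z\<bar> \<le> sqrt 3 * Re z"
  shows norm_airy_primitive_le: "Re z > 0 \<Longrightarrow> norm (airy_primitive z t) \<le> t powr (1/4) * Re z powr (-3/4)"
    and norm_airy_primitive_le_1: "norm (airy_primitive z t) \<le> 1"
proof -
  let ?x = "Re z"
  have key: "norm (airy_primitive z t) \<le>
     1 / (2 * pi) * (1 / \<eta> * (exp ((t * \<eta>\<^sup>2 - ?x / 2)\<^sup>2 / (\<eta> * t)) * sqrt (pi / (3 * t * \<eta>))))"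
    if "\<eta> > 0" for \<eta>
  proof -
    have "norm (airy_primitive z t) = 1 / (2 * pi) * norm (line_integral (\<lambda>k. 1 / (\<i> * k)) \<eta> z t)"
      by (simp add: airy_primitive_def norm_divide norm_mult line_integral_indep[OF upper_weight_inverse t that])
    then show ?thesis
      using norm_line_integral_inverse_le[OF t that z] by (simp add: mult_left_mono del: times_divide_eq_left)
  qed
  show decay: "norm (airy_primitive z t) \<le> t powr (1/4) * ?x powr (-3/4)" if x: "?x > 0"
  proof -
    \<comment> \<open>The height at which the exponent vanishes.\<close>
    define \<eta> where "\<eta> = (?x / (2 * t)) powr (1/2)"
    have eta: "\<eta> > 0" using x t by (simp add: \<eta>_def)
    have eta2: "\<eta>\<^sup>2 = ?x / (2 * t)" using x t by (simp add: \<eta>_def powr_half_sqrt)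
    have e0: "t * \<eta>\<^sup>2 - ?x / 2 = 0" using t by (simp add: eta2)
    have "sqrt (pi / (3 * t * \<eta>)) \<le> 2 * sqrt (1 / (t * \<eta>))"
    proof -
      have "pi / (3 * t * \<eta>) \<le> 4 * (1 / (t * \<eta>))"
        using t eta pi_less_4 by (simp add: field_simps)
      then have "sqrt (pi / (3 * t * \<eta>)) \<le> sqrt (4 * (1 / (t * \<eta>)))" by (rule real_sqrt_le_mono)
      then show ?thesis by (simp only: real_sqrt_mult real_sqrt_four)
    qed
    then have "1 / (2 * pi) * (1 / \<eta> * (1 * sqrt (pi / (3 * t * \<eta>))))
       \<le> 1 / (2 * pi) * (1 / \<eta> * (1 * (2 * sqrt (1 / (t * \<eta>)))))"
      using eta by (intro mult_left_mono) auto
    then have "norm (airy_primitive z t) \<le> 1 / (2 * pi) * (1 / \<eta> * (1 * (2 * sqrt (1 / (t * \<eta>)))))"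
      using key[OF eta] unfolding e0 by simp
    also have "\<dots> = 1 / pi * (1 / \<eta> * sqrt (1 / (t * \<eta>)))" by simp
    also have "1 / \<eta> * sqrt (1 / (t * \<eta>)) = 2 powr (3/4) * (t powr (1/4) * ?x powr (-3/4))"
    proof -
      have "1 / \<eta> * sqrt (1 / (t * \<eta>)) = \<eta> powr (-1) * (t * \<eta>) powr (-1/2)"
        using t eta by (simp add: powr_minus_divide powr_half_sqrt real_sqrt_divide)
      also have "\<dots> = (\<eta> powr (-1) * \<eta> powr (-1/2)) * t powr (-1/2)"
        using t eta by (simp only: powr_mult mult_ac)
      also have "\<eta> powr (-1) * \<eta> powr (-1/2) = \<eta> powr (-3/2)"
        by (simp only: powr_add[symmetric]) simp
      also have "\<eta> powr (-3/2) = (?x / (2 * t)) powr (-3/4)"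
        unfolding \<eta>_def by (simp add: powr_powr)
      also have "\<dots> = 2 powr (3/4) * t powr (3/4) * ?x powr (-3/4)"
        using x t by (simp add: powr_divide powr_mult powr_minus field_simps)
      also have "\<dots> * t powr (-1/2) = 2 powr (3/4) * (t powr (3/4) * t powr (-1/2)) * ?x powr (-3/4)"
        by (simp add: mult_ac)
      also have "t powr (3/4) * t powr (-1/2) = t powr (1/4)"
        using t by (simp add: powr_add[symmetric])
      finally show ?thesis by (simp add: mult_ac)
    qed
    also have "1 / pi * (2 powr (3/4) * (t powr (1/4) * ?x powr (-3/4)))
       = (2 powr (3/4) / pi) * (t powr (1/4) * ?x powr (-3/4))" by simp
    also have "\<dots> \<le> 1 * (t powr (1/4) * ?x powr (-3/4))"
    proof (rule mult_right_mono)
      have "2 powr (3/4) \<le> (2::real) powr 1" by (rule powr_mono) auto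
      then show "2 powr (3/4) / pi \<le> 1" using pi_gt3 by simp
    qed auto
    finally show ?thesis by simp
  qed
  show "norm (airy_primitive z t) \<le> 1"
  proof (cases "?x \<le> t powr (1/3)")
    case True
    define \<tau> where "\<tau> = t powr (1/3)"
    have tau: "\<tau> > 0" using t by (simp add: \<tau>_def)
    have tau3: "t = \<tau> ^ 3" using t tau by (simp add: \<tau>_def powr_realpow[symmetric] powr_powr)
    have eta: "1 / \<tau> > 0" using tau by simp
    have e: "(t * (1 / \<tau>)\<^sup>2 - ?x / 2)\<^sup>2 / (1 / \<tau> * t) \<le> 1"
    proof -
      have "(t * (1 / \<tau>)\<^sup>2 - ?x / 2)\<^sup>2 = (\<tau> - ?x / 2)\<^sup>2"
        using tau by (simp add: tau3 power2_eq_square power3_eq_cube)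
      also have "\<dots> \<le> \<tau>\<^sup>2" using True z tau by (intro power_mono) (auto simp: \<tau>_def)
      finally show ?thesis using tau by (simp add: tau3 field_simps power2_eq_square power3_eq_cube)
    qed
    have s: "1 / (1 / \<tau>) * sqrt (pi / (3 * t * (1 / \<tau>))) \<le> 2"
    proof -
      have "sqrt (pi / (3 * t * (1 / \<tau>))) = sqrt (pi / 3) / \<tau>"
        using tau by (simp add: tau3 power3_eq_cube real_sqrt_divide real_sqrt_mult field_simps)
      moreover have "sqrt (pi / 3) \<le> 2" using pi_less_4 by (intro real_le_lsqrt) auto
      ultimately show ?thesis using tau by simp
    qed
    have "norm (airy_primitive z t) \<le>
      1 / (2 * pi) * (1 / (1/\<tau>) * (exp ((t * (1/\<tau>)\<^sup>2 - ?x / 2)\<^sup>2 / ((1/\<tau>) * t)) * sqrt (pi / (3 * t * (1/\<tau>)))))"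
      by (rule key[OF eta])
    also have "\<dots> = 1 / (2 * pi) * (exp ((t * (1/\<tau>)\<^sup>2 - ?x / 2)\<^sup>2 / ((1/\<tau>) * t)) * (1 / (1/\<tau>) * sqrt (pi / (3 * t * (1/\<tau>)))))"
      by (simp only: mult_ac)
    also have "\<dots> \<le> 1 / (2 * pi) * (exp 1 * 2)"
      using e s tau t by (intro mult_left_mono mult_mono) auto
    also have "\<dots> \<le> 1" using exp_le pi_gt3 by simp
    finally show ?thesis .
  next
    case False
    then have x: "?x > 0" using t by (smt (verit) powr_gt_zero)
    have "?x powr (-3/4) \<le> (t powr (1/3)) powr (-3/4)"
      using False t by (intro powr_mono2') auto
    then have "t powr (1/4) * ?x powr (-3/4) \<le> t powr (1/4) * t powr (-1/4)"
      by (intro mult_left_mono) (auto simp: powr_powr)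
    also have "\<dots> = 1" using t by (simp add: powr_add[symmetric])
    finally show ?thesis using decay[OF x] by simp
  qed
qed

section \<open>The connection formula\<close>

text \<open>
  Both \<open>k^3\<close> and \<open>dk/k\<close> are invariant under multiplication of \<open>k\<close> by a cube root of
  unity.
\<close>

lemma contour_integral_linepath_rotate:
  assumes "c ^ 3 = 1"
  shows "contour_integral (linepath (c * a) (c * b)) (\<lambda>k. airy_phase z t k * (1 / (\<i> * k)))
     = contour_integral (linepath a b) (\<lambda>k. airy_phase (c * z) t k * (1 / (\<i> * k)))"
proof -
  have c0: "c \<noteq> 0" using assms by auto
  have lp: "linepath (c * a) (c * b) x = c * linepath a b x" for x
    by (simp add: linepath_def scaleR_conv_of_real algebra_simps)
  have "airy_phase z t (c * k) * (1 / (\<i> * (c * k))) * (c * b - c * a)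
     = airy_phase (c * z) t k * (1 / (\<i> * k)) * (b - a)" for k
    unfolding airy_phase_rotate[OF assms] right_diff_distrib[symmetric] using c0 by (cases "k = 0") auto
  then show ?thesis
    by (simp add: contour_integral_integral lp)
qed

lemma horizontal_segment_contour_integral:
  assumes f: "f holomorphic_on {k. Im k > 0}" and "\<eta> > 0" "a \<le> b"
  shows "contour_integral (linepath (Complex a \<eta>) (Complex b \<eta>)) f = (LINT \<xi>:{a..b}|lborel. f (Complex \<xi> \<eta>))"
proof -
  obtain F where F: "\<And>k. Im k > 0 \<Longrightarrow> (F has_field_derivative f k) (at k)"
    using upper_half_plane_primitive[OF f] by blast
  let ?l = "linepath (Complex a \<eta>) (Complex b \<eta>)"
  have "(f has_contour_integral (F (pathfinish ?l) - F (pathstart ?l))) ?l"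
  proof (rule contour_integral_primitive[of "{k. Im k > 0}"])
    show "path_image ?l \<subseteq> {k. Im k > 0}"
      using assms closed_segment_subset[OF _ _ convex_halfspace_Im_gt] by simp
  qed (auto intro: DERIV_subset[OF F])
  then have "contour_integral ?l f = F (Complex b \<eta>) - F (Complex a \<eta>)"
    using contour_integral_unique by simp
  also have "\<dots> = (LINT \<xi>:{a..b}|lborel. f (Complex \<xi> \<eta>))"
    by (subst horizontal_segment_integral[of "{k. Im k > 0}" F f])
       (use assms F holomorphic_on_imp_continuous_on[OF f] in auto)
  finally show ?thesis .
qed

text \<open>
  The segment is the top side of an equilateral triangle centred at the origin.
\<close>

lemma triangle_limit:
  assumes t: "t > 0"
  shows "((\<lambda>r. LINT \<xi>:{- (sqrt 3 * r)..sqrt 3 * r}|lborel.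
      airy_phase z t (Complex \<xi> r) * (1 / (\<i> * Complex \<xi> r)))
     \<longlongrightarrow> line_integral (\<lambda>k. 1 / (\<i> * k)) 1 z t) at_top"
proof (rule tendsto_line_integral_of_tail_bound[OF upper_weight_inverse t])
  define D where "D = (\<lambda>r \<xi>. (1 / r) * exp (- (t * r) * (\<xi> - 0)\<^sup>2))"
  show "\<forall>\<^sub>F r in at_top. (r::real) > 0" by (rule eventually_gt_at_top)
  show "\<forall>\<^sub>F r in at_top. has_bochner_integral lborel (D r) ((1 / r) * sqrt (pi / (t * r)))"
    using eventually_gt_at_top[of 0]
    by eventually_elim
       (unfold D_def, intro has_bochner_integral_mult_right has_bochner_integral_gaussian, use t in auto)
  show "\<forall>\<^sub>F r in at_top. \<forall>\<xi>. 0 \<le> D r \<xi>"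
    using eventually_gt_at_top[of 0] by eventually_elim (simp add: D_def)
  show "((\<lambda>r. (1 / r) * sqrt (pi / (t * r))) \<longlongrightarrow> 0) at_top"
    using t by real_asymp
  have "filterlim (\<lambda>r. t * r\<^sup>2) at_top at_top" using t by real_asymp
  then have "\<forall>\<^sub>F r in at_top. \<bar>Im z\<bar> + \<bar>Re z\<bar> \<le> t * r\<^sup>2" by (simp add: filterlim_at_top)
  then show "\<forall>\<^sub>F r in at_top. \<forall>\<xi>. \<xi> \<notin> {- (sqrt 3 * r)..sqrt 3 * r} \<longrightarrow>
      norm (airy_phase z t (Complex \<xi> r) * (1 / (\<i> * Complex \<xi> r))) \<le> D r \<xi>"
    using eventually_gt_at_top[of 0]
  proof (eventually_elim, intro allI impI)
    fix r \<xi> :: real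
    assume r: "\<bar>Im z\<bar> + \<bar>Re z\<bar> \<le> t * r\<^sup>2" "r > 0" and "\<xi> \<notin> {- (sqrt 3 * r)..sqrt 3 * r}"
    then have xi: "sqrt 3 * r \<le> \<bar>\<xi>\<bar>" by auto
    have xi2: "3 * r\<^sup>2 \<le> \<xi>\<^sup>2"
      using power_mono[OF xi, of 2] r by (simp add: power_mult_distrib)
    have "1 * r \<le> sqrt 3 * r" using r by (intro mult_right_mono) auto
    then have xi1: "r \<le> \<bar>\<xi>\<bar>" using xi by simp
    have "- \<xi> * Im z \<le> \<bar>\<xi>\<bar> * \<bar>Im z\<bar>" using abs_ge_self[of "- \<xi> * Im z"] by (simp add: abs_mult)
    moreover have "- r * Re z \<le> \<bar>\<xi>\<bar> * \<bar>Re z\<bar>"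
      using abs_ge_self[of "- r * Re z"] r mult_right_mono[OF xi1, of "\<bar>Re z\<bar>"] by (simp add: abs_mult)
    moreover have "\<bar>\<xi>\<bar> * (\<bar>Im z\<bar> + \<bar>Re z\<bar>) \<le> t * r * \<xi>\<^sup>2"
    proof -
      have "\<bar>\<xi>\<bar> * (\<bar>Im z\<bar> + \<bar>Re z\<bar>) \<le> \<bar>\<xi>\<bar> * (t * r * r)"
        using r by (intro mult_left_mono) (auto simp: power2_eq_square mult_ac)
      also have "\<dots> \<le> \<bar>\<xi>\<bar> * (t * r * \<bar>\<xi>\<bar>)"
        using r t xi1 by (intro mult_left_mono) auto
      finally show ?thesis by (simp add: power2_eq_square mult_ac abs_mult_self_eq)
    qed
    moreover have "t * (r ^ 3 - 3 * \<xi>\<^sup>2 * r) \<le> - 2 * (t * r * \<xi>\<^sup>2)"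
    proof -
      have "t * r * (3 * r\<^sup>2) \<le> t * r * \<xi>\<^sup>2" using xi2 r t by (intro mult_left_mono) auto
      moreover have "0 \<le> t * r * r\<^sup>2" using r t by simp
      ultimately have "t * r * r\<^sup>2 \<le> t * r * \<xi>\<^sup>2" by linarith
      then show ?thesis by (simp add: power2_eq_square power3_eq_cube algebra_simps)
    qed
    ultimately have "- \<xi> * Im z - r * Re z + t * (r ^ 3 - 3 * \<xi>\<^sup>2 * r) \<le> - (t * r) * (\<xi> - 0)\<^sup>2"
      by (simp add: algebra_simps)
    then have 1: "norm (airy_phase z t (Complex \<xi> r)) \<le> exp (- (t * r) * (\<xi> - 0)\<^sup>2)"
      unfolding norm_airy_phase by simp
    have "r \<le> norm (Complex \<xi> r)" using abs_Im_le_cmod[of "Complex \<xi> r"] by simp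
    then have 2: "norm (1 / (\<i> * Complex \<xi> r)) \<le> 1 / r"
      using r by (simp add: norm_divide norm_mult frac_le)
    show "norm (airy_phase z t (Complex \<xi> r) * (1 / (\<i> * Complex \<xi> r))) \<le> D r \<xi>"
      unfolding D_def norm_mult[of "airy_phase z t (Complex \<xi> r)"]
      using mult_mono[OF 1 2] by (simp add: mult.commute)
  qed
qed

text \<open>
  The triangle is run through clockwise, and the residue of \<open>e(z, t, k)/(i k)\<close> at the origin is
  \<open>1/i\<close>.
\<close>

lemma triangle_contour:
  assumes r: "r > 0"
  defines "a \<equiv> Complex (- (sqrt 3 * r)) r" and "b \<equiv> Complex (sqrt 3 * r) r" and "c \<equiv> Complex 0 (- 2 * r)"
  shows "contour_integral (linepath a b) (\<lambda>k. airy_phase z t k * (1 / (\<i> * k)))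
       + contour_integral (linepath b c) (\<lambda>k. airy_phase z t k * (1 / (\<i> * k)))
       + contour_integral (linepath c a) (\<lambda>k. airy_phase z t k * (1 / (\<i> * k))) = - (2 * of_real pi)"
proof -
  let ?f = "\<lambda>k. airy_phase z t k * (1 / (\<i> * k))"
  let ?\<gamma> = "linepath a b +++ linepath b c +++ linepath c a"
  have seg: "0 \<notin> closed_segment a b" "0 \<notin> closed_segment b c" "0 \<notin> closed_segment c a"
    using r by (auto simp: closed_segment_def complex_eq_iff a_def b_def c_def algebra_simps)
  have hull: "0 \<in> convex hull {a, b, c}"
    unfolding convex_hull_3
    by (rule CollectI, rule exI[of _ "1/3"], rule exI[of _ "1/3"], rule exI[of _ "1/3"])
       (simp add: a_def b_def c_def complex_eq_iff)
  have "0 \<in> interior (convex hull {a, b, c})"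
    using hull seg by (subst interior_of_triangle) auto
  from winding_number_triangle[OF this] have wn: "winding_number ?\<gamma> 0 = -1"
    using r mult_pos_pos[of r "r * sqrt 3", THEN less_not_sym] by (simp add: a_def b_def c_def)
  have eqs: "(\<lambda>w. (airy_phase z t w / \<i>) / (w - 0)) = ?f"
    "of_real (2 * pi) * \<i> * (-1) * (airy_phase z t 0 / \<i>) = - (2 * of_real pi)"
  proof -
    have "airy_phase z t w / \<i> / (w - 0) = ?f w" for w
      by (simp only: divide_divide_eq_left diff_zero times_divide_eq_right mult_1_right)
    then show "(\<lambda>w. (airy_phase z t w / \<i>) / (w - 0)) = ?f" by (rule ext)
  qed (simp add: airy_phase_def)
  have "((\<lambda>w. (airy_phase z t w / \<i>) / (w - 0)) has_contour_integral
     (2 * pi * \<i> * winding_number ?\<gamma> 0 * (airy_phase z t 0 / \<i>))) ?\<gamma>"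
    using seg by (intro Cauchy_integral_formula_convex_simple[of UNIV])
      (auto simp: path_image_join intro!: holomorphic_intros)
  then have "(?f has_contour_integral (- (2 * of_real pi))) ?\<gamma>"
    unfolding wn eqs .
  then have 1: "contour_integral ?\<gamma> ?f = - (2 * of_real pi)" by (rule contour_integral_unique)
  have ci: "?f contour_integrable_on linepath p q" if "0 \<notin> closed_segment p q" for p q
    by (rule contour_integrable_continuous_linepath) (use that in \<open>auto intro!: continuous_intros\<close>)
  have "contour_integral ?\<gamma> ?f = contour_integral (linepath a b) ?f + (contour_integral (linepath b c) ?f
     + contour_integral (linepath c a) ?f)"
    by (subst contour_integral_join | rule ci[OF seg(1)] ci[OF seg(2)] ci[OF seg(3)]
        contour_integrable_joinI | simp add: valid_path_join)+
  then show ?thesis unfolding 1 by (simp add: add.assoc)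
qed

lemma alpha_eq: "\<alpha> = Complex (- 1 / 2) (sqrt 3 / 2)" "\<alpha>\<^sup>2 = Complex (- 1 / 2) (- sqrt 3 / 2)"
  by (simp_all add: \<alpha>_def complex_eq_iff cos_120 sin_120 power2_eq_square)

text \<open>
  Rotating the top side of the triangle onto the other two replaces \<open>z\<close> by \<open>\<alpha>^2 z\<close> and
  \<open>\<alpha> z\<close>, so the three line integrals add up to the integral over the whole triangle.
\<close>

lemma airy_primitive_connection:
  assumes t: "t > 0"
  shows "airy_primitive z t + airy_primitive (\<alpha> * z) t + airy_primitive (\<alpha>\<^sup>2 * z) t = -1"
proof -
  let ?f = "\<lambda>z k. airy_phase z t k * (1 / (\<i> * k))"
  let ?L = "\<lambda>z. line_integral (\<lambda>k. 1 / (\<i> * k)) 1 z t"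
  define J where "J = (\<lambda>z r. LINT \<xi>:{- (sqrt 3 * r)..sqrt 3 * r}|lborel. ?f z (Complex \<xi> r))"
  have "((\<lambda>r. J z r + J (\<alpha>\<^sup>2 * z) r + J (\<alpha> * z) r) \<longlongrightarrow> ?L z + ?L (\<alpha>\<^sup>2 * z) + ?L (\<alpha> * z)) at_top"
    unfolding J_def by (intro tendsto_add triangle_limit t)
  moreover have "\<forall>\<^sub>F r in at_top. J z r + J (\<alpha>\<^sup>2 * z) r + J (\<alpha> * z) r = - (2 * of_real pi)"
    using eventually_gt_at_top[of 0]
  proof eventually_elim
    case (elim r)
    let ?a = "Complex (- (sqrt 3 * r)) r" and ?b = "Complex (sqrt 3 * r) r" and ?c = "Complex 0 (- 2 * r)"
    have J: "J w r = contour_integral (linepath ?a ?b) (?f w)" for w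
      unfolding J_def
      by (rule horizontal_segment_contour_integral[symmetric])
         (use elim in \<open>auto intro!: holomorphic_intros\<close>)
    have p1: "?b = \<alpha>\<^sup>2 * ?a" "?c = \<alpha>\<^sup>2 * ?b"
      unfolding alpha_eq(2) by (simp_all add: complex_eq_iff algebra_simps)
    have p2: "?c = \<alpha> * ?a" "?a = \<alpha> * ?b"
      unfolding alpha_eq(1) by (simp_all add: complex_eq_iff algebra_simps)
    have a6: "(\<alpha>\<^sup>2) ^ 3 = 1" unfolding power_mult[symmetric] mult.commute[of 2] power_mult alpha_cube by simp
    have "contour_integral (linepath ?b ?c) (?f z) = J (\<alpha>\<^sup>2 * z) r"
      unfolding J contour_integral_linepath_rotate[OF a6, symmetric] p1[symmetric] ..
    moreover have "contour_integral (linepath ?c ?a) (?f z) = J (\<alpha> * z) r"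
      unfolding J contour_integral_linepath_rotate[OF alpha_cube, symmetric] p2[symmetric] ..
    ultimately show ?case using triangle_contour[OF elim, of z t] J[of z] by simp
  qed
  ultimately have "?L z + ?L (\<alpha>\<^sup>2 * z) + ?L (\<alpha> * z) = - (2 * of_real pi)"
    using tendsto_unique[OF trivial_limit_at_top_linorder _ tendsto_eventually] by blast
  then have "1 / (2 * of_real pi) * (?L z + ?L (\<alpha>\<^sup>2 * z) + ?L (\<alpha> * z)) = -1"
    by simp
  then show ?thesis unfolding airy_primitive_def by (simp only: distrib_left add_ac)
qed

section \<open>Interchanging integrals, and integration by parts\<close>

lemma sigma_finite_lebesgue: "sigma_finite_measure (lebesgue :: real measure)"
proof
  obtain A :: "nat \<Rightarrow> real set" where A: "range A \<subseteq> sets lborel" "(\<Union>i. A i) = space lborel"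
    "\<And>i. emeasure lborel (A i) \<noteq> \<infinity>"
    using lborel.sigma_finite by blast
  show "\<exists>B. countable B \<and> B \<subseteq> sets lebesgue \<and> \<Union> B = space (lebesgue :: real measure) \<and>
     (\<forall>a\<in>B. emeasure lebesgue a \<noteq> \<infinity>)"
  proof (intro exI[of _ "range A"] conjI ballI)
    show "range A \<subseteq> sets lebesgue" using A(1) by auto
    show "emeasure lebesgue a \<noteq> \<infinity>" if "a \<in> range A" for a
      using that A(1,3) by (auto simp: subset_eq)
  qed (use A(2) in auto)
qed

lemma pair_lborel_lebesgue: "pair_sigma_finite (lborel :: real measure) (lebesgue :: real measure)"
  using sigma_finite_lebesgue sigma_finite_lborel by (simp add: pair_sigma_finite_def)

lemma pair_lebesgue_lebesgue: "pair_sigma_finite (lebesgue :: real measure) (lebesgue :: real measure)"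
  using sigma_finite_lebesgue by (simp add: pair_sigma_finite_def)

lemma (in pair_sigma_finite) integrable_tensor:
  fixes f g :: "_ \<Rightarrow> complex"
  assumes f: "integrable M1 f" and g: "integrable M2 g"
  shows "integrable (M1 \<Otimes>\<^sub>M M2) (\<lambda>(x, y). f x * g y)"
proof (rule Fubini_integrable)
  have [measurable]: "f \<in> borel_measurable M1" "g \<in> borel_measurable M2" using f g by auto
  show "(\<lambda>(x, y). f x * g y) \<in> borel_measurable (M1 \<Otimes>\<^sub>M M2)" by measurable
  have "(\<lambda>x. \<integral>y. norm (case (x, y) of (x, y) \<Rightarrow> f x * g y) \<partial>M2) = (\<lambda>x. norm (f x) * (\<integral>y. norm (g y) \<partial>M2))"
    by (simp add: norm_mult)
  then show "integrable M1 (\<lambda>x. \<integral>y. norm (case (x, y) of (x, y) \<Rightarrow> f x * g y) \<partial>M2)"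
    using f by simp
  show "AE x in M1. integrable M2 (\<lambda>y. case (x, y) of (x, y) \<Rightarrow> f x * g y)" using g by simp
qed

lemma lebesgue_borel_measurableI: "f \<in> borel_measurable borel \<Longrightarrow> f \<in> borel_measurable lebesgue"
  by (simp add: measurable_completion)

lemma set_integrable_continuous_mult:
  fixes f w :: "real \<Rightarrow> complex"
  assumes f: "set_integrable lebesgue S f" and w: "continuous_on UNIV w" "\<And>y. y \<in> S \<Longrightarrow> norm (w y) \<le> B"
  shows "set_integrable lebesgue S (\<lambda>y. w y * f y)"
  unfolding set_integrable_def
proof (rule Bochner_Integration.integrable_bound)
  show "integrable lebesgue (\<lambda>y. \<bar>B\<bar> *\<^sub>R (indicat_real S y *\<^sub>R f y))"
    using f by (intro integrable_scaleR_right) (simp add: set_integrable_def)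
  have m1: "w \<in> borel_measurable lebesgue"
    using w(1) by (intro lebesgue_borel_measurableI borel_measurable_continuous_onI)
  have m2: "(\<lambda>y. indicat_real S y *\<^sub>R f y) \<in> borel_measurable lebesgue"
    using f by (auto simp: set_integrable_def)
  show "(\<lambda>y. indicat_real S y *\<^sub>R (w y * f y)) \<in> borel_measurable lebesgue"
    using borel_measurable_times[OF m1 m2] by simp
  have "norm (w y) \<le> \<bar>B\<bar>" if "y \<in> S" for y using w(2)[OF that] by simp
  then show "AE y in lebesgue. norm (indicat_real S y *\<^sub>R (w y * f y)) \<le> norm (\<bar>B\<bar> *\<^sub>R (indicat_real S y *\<^sub>R f y))"
    by (auto simp: norm_mult indicator_def intro!: AE_I2 mult_right_mono)
qed

lemma continuous_set_integrable_lebesgue: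
  fixes f :: "real \<Rightarrow> complex"
  assumes "continuous_on {a..b} f"
  shows "set_integrable lebesgue {a<..<b} f"
proof -
  have "set_integrable lborel {a..b} f"
    unfolding set_integrable_def by (rule borel_integrable_compact) (use assms in auto)
  then have "set_integrable lebesgue {a..b} f"
    unfolding set_integrable_def by (subst integrable_completion) auto
  then show ?thesis by (rule set_integrable_subset) auto
qed

lemma id_pair_borel:
  assumes "(\<lambda>x. x) \<in> M1 \<rightarrow>\<^sub>M (borel :: real measure)" "(\<lambda>x. x) \<in> M2 \<rightarrow>\<^sub>M (borel :: real measure)"
  shows "(\<lambda>p. p) \<in> M1 \<Otimes>\<^sub>M M2 \<rightarrow>\<^sub>M (borel :: (real \<times> real) measure)"
proof -
  have 1: "(\<lambda>p. fst p) \<in> M1 \<Otimes>\<^sub>M M2 \<rightarrow>\<^sub>M (borel :: real measure)"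
    using measurable_compose[OF measurable_fst assms(1)] .
  have 2: "(\<lambda>p. snd p) \<in> M1 \<Otimes>\<^sub>M M2 \<rightarrow>\<^sub>M (borel :: real measure)"
    using measurable_compose[OF measurable_snd assms(2)] .
  have "(\<lambda>p. (fst p, snd p)) \<in> M1 \<Otimes>\<^sub>M M2 \<rightarrow>\<^sub>M (borel \<Otimes>\<^sub>M borel :: (real \<times> real) measure)"
    by (rule measurable_Pair[OF 1 2])
  then show ?thesis by (simp add: borel_prod)
qed

lemma contour_integral_linepath_eq:
  "contour_integral (linepath a b) f = integral {0..1} (\<lambda>s. f (linepath a b s) * (b - a))"
  by (simp add: contour_integral_integral)

text \<open>
  The kernel is bounded on the segment and \<open>f\<close> is integrable, so the product is integrable over
  segment and parameter together. Integrability of the inner contour integral against \<open>f\<close> comes out of the same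
  application of Fubini and supplies measurability later.
\<close>

lemma linepath_fubini:
  fixes f :: "real \<Rightarrow> complex" and e :: "complex \<Rightarrow> real \<Rightarrow> complex"
  assumes f: "set_integrable lebesgue S f"
    and cont: "continuous_on UNIV (\<lambda>p. e (fst p) (snd p))"
    and bound: "\<And>k y. k \<in> closed_segment a b \<Longrightarrow> y \<in> S \<Longrightarrow> norm (e k y) \<le> B"
  shows has_contour_integral_parameter: "((\<lambda>k. LINT y:S|lebesgue. e k y * f y) has_contour_integral
      (LINT y:S|lebesgue. contour_integral (linepath a b) (\<lambda>k. e k y) * f y)) (linepath a b)"
    and "set_integrable lebesgue S (\<lambda>y. contour_integral (linepath a b) (\<lambda>k. e k y) * f y)"
proof -
  interpret pair_sigma_finite "lborel :: real measure" "lebesgue :: real measure" by (rule pair_lborel_lebesgue)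
  define l where "l = linepath a b"
  define f0 where "f0 = (\<lambda>y. indicat_real S y *\<^sub>R f y)"
  have f0: "integrable lebesgue f0" using f by (simp add: f0_def set_integrable_def)
  define i where "i = (\<lambda>s::real. complex_of_real (indicat_real {0..1} s))"
  have i: "integrable lborel i" unfolding i_def by (rule integrable_of_real) simp
  have T: "integrable (lborel \<Otimes>\<^sub>M lebesgue) (\<lambda>(s, y). i s * f0 y)"
    by (rule integrable_tensor[OF i f0])
  define h where "h = (\<lambda>s y. e (l s) y * (i s * f0 y) * (b - a))"
  have lcont: "continuous_on A (\<lambda>s. l s)" for A unfolding l_def linepath_def by (intro continuous_intros)
  have ce: "continuous_on A (\<lambda>s. e (g1 s) (g2 s))" if "continuous_on A g1" "continuous_on A g2"
    for A :: "'t::topological_space set" and g1 g2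
    using continuous_on_compose2[OF cont continuous_on_Pair[OF that]] by simp
  have "continuous_on UNIV (\<lambda>p. e (l (fst p)) (snd p))"
    by (rule ce) (auto intro!: continuous_on_compose2[OF lcont] continuous_intros)
  then have "(\<lambda>p. e (l (fst p)) (snd p)) \<in> borel_measurable borel"
    by (rule borel_measurable_continuous_onI)
  then have "(\<lambda>p. e (l (fst p)) (snd p)) \<in> borel_measurable (lborel \<Otimes>\<^sub>M lebesgue)"
    by (rule measurable_compose[OF id_pair_borel, rotated 2]) (auto intro: measurable_completion)
  then have meas: "case_prod h \<in> borel_measurable (lborel \<Otimes>\<^sub>M lebesgue)"
    unfolding h_def using borel_measurable_integrable[OF T]
    by (auto simp: case_prod_unfold intro!: borel_measurable_times)
  have H: "integrable (lborel \<Otimes>\<^sub>M lebesgue) (case_prod h)"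
  proof (rule Bochner_Integration.integrable_bound)
    show "integrable (lborel \<Otimes>\<^sub>M lebesgue) (\<lambda>p. (\<bar>B\<bar> * norm (b - a)) *\<^sub>R (case p of (s, y) \<Rightarrow> i s * f0 y))"
      using T by (rule integrable_scaleR_right[rotated]) 
    have "norm (h s y) \<le> norm ((\<bar>B\<bar> * norm (b - a)) *\<^sub>R (i s * f0 y))" for s y
    proof (cases "s \<in> {0..1} \<and> y \<in> S")
      case True
      then have "l s \<in> closed_segment a b" unfolding l_def using linepath_in_path by blast
      then have "norm (e (l s) y) \<le> \<bar>B\<bar>" using bound True by force
      then have "norm (e (l s) y) * (norm (i s * f0 y) * norm (b - a)) \<le> \<bar>B\<bar> * (norm (i s * f0 y) * norm (b - a))"
        by (intro mult_right_mono) auto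
      then show ?thesis by (simp add: h_def norm_mult mult_ac)
    next
      case False
      then have "i s * f0 y = 0" by (auto simp: i_def f0_def)
      then show ?thesis unfolding h_def by (simp only: mult_zero_right mult_zero_left norm_zero scaleR_zero_right order_refl)
    qed
    then show "AE p in lborel \<Otimes>\<^sub>M lebesgue. norm (case_prod h p) \<le>
        norm ((\<bar>B\<bar> * norm (b - a)) *\<^sub>R (case p of (s, y) \<Rightarrow> i s * f0 y))" by auto
  qed (rule meas)
  have inner: "(LINT s|lborel. h s y) = indicat_real S y *\<^sub>R (contour_integral l (\<lambda>k. e k y) * f y)" for y
  proof -
    have c: "continuous_on {0..1} (\<lambda>s. e (l s) y * (b - a))"
      by (intro continuous_intros ce lcont)
    have si: "set_integrable lborel {0..1} (\<lambda>s. e (l s) y * (b - a))"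
      by (rule borel_integrable_compact[unfolded set_integrable_def[symmetric]]) (use c in auto)
    have "(LINT s|lborel. h s y) = (LINT s|lborel. indicat_real {0..1} s *\<^sub>R (e (l s) y * (b - a)) * f0 y)"
      by (rule Bochner_Integration.integral_cong) (auto simp: h_def i_def scaleR_conv_of_real)
    also have "\<dots> = (LINT s:{0..1}|lborel. e (l s) y * (b - a)) * f0 y"
      by (simp only: set_lebesgue_integral_def integral_mult_left_zero)
    also have "(LINT s:{0..1}|lborel. e (l s) y * (b - a)) = contour_integral l (\<lambda>k. e k y)"
      unfolding l_def contour_integral_linepath_eq
      using set_borel_integral_eq_integral(2)[OF si] by (simp add: l_def)
    finally show ?thesis by (simp add: f0_def)
  qed
  have outer: "(LINT y|lebesgue. h s y) = indicat_real {0..1} s *\<^sub>R ((LINT y:S|lebesgue. e (l s) y * f y) * (b - a))" for s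
  proof -
    have "(LINT y|lebesgue. h s y) = (LINT y|lebesgue. (i s * (b - a)) * (indicat_real S y *\<^sub>R (e (l s) y * f y)))"
      by (rule Bochner_Integration.integral_cong) (auto simp: h_def f0_def mult_ac)
    also have "\<dots> = (i s * (b - a)) * (LINT y:S|lebesgue. e (l s) y * f y)"
      by (simp only: set_lebesgue_integral_def integral_mult_right_zero)
    finally show ?thesis by (simp add: i_def scaleR_conv_of_real mult_ac)
  qed
  have F: "(LINT y|lebesgue. LINT s|lborel. h s y) = (LINT s|lborel. LINT y|lebesgue. h s y)"
    by (rule Fubini_integral[OF H])
  show "set_integrable lebesgue S (\<lambda>y. contour_integral (linepath a b) (\<lambda>k. e k y) * f y)"
    using integrable_snd[OF H] unfolding inner set_integrable_def l_def .
  have "((\<lambda>s. LINT y|lebesgue. h s y) has_integral (LINT s|lborel. LINT y|lebesgue. h s y)) UNIV"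
    using integrable_fst[OF H] by (rule has_integral_integral_lborel)
  then have "((\<lambda>s. indicat_real {0..1} s *\<^sub>R ((LINT y:S|lebesgue. e (l s) y * f y) * (b - a)))
      has_integral (LINT y|lebesgue. LINT s|lborel. h s y)) UNIV"
    unfolding F unfolding outer .
  also have "(\<lambda>s. indicat_real {0..1} s *\<^sub>R ((LINT y:S|lebesgue. e (l s) y * f y) * (b - a)))
     = (\<lambda>s. if s \<in> {0..1} then (LINT y:S|lebesgue. e (l s) y * f y) * (b - a) else 0)"
    by (auto simp: fun_eq_iff)
  finally have "((\<lambda>s. (LINT y:S|lebesgue. e (l s) y * f y) * (b - a))
      has_integral (LINT y|lebesgue. LINT s|lborel. h s y)) {0..1}"
    by (simp only: has_integral_restrict_UNIV)
  then show "((\<lambda>k. LINT y:S|lebesgue. e k y * f y) has_contour_integral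
      (LINT y:S|lebesgue. contour_integral (linepath a b) (\<lambda>k. e k y) * f y)) (linepath a b)"
    unfolding has_contour_integral_linepath inner set_lebesgue_integral_def l_def .
qed

lemma dominated_kernel_limit:
  fixes f :: "real \<Rightarrow> complex" and c :: "real \<Rightarrow> real \<Rightarrow> complex"
  assumes f: "set_integrable lebesgue S f"
    and meas: "\<And>r. r \<ge> 1 \<Longrightarrow> set_integrable lebesgue S (\<lambda>y. c r y * f y)"
    and bound: "\<And>r y. r \<ge> 1 \<Longrightarrow> y \<in> S \<Longrightarrow> norm (c r y) \<le> B"
    and lim: "\<And>y. y \<in> S \<Longrightarrow> ((\<lambda>r. c r y) \<longlongrightarrow> d y) at_top"
  shows dominated_kernel_integrable: "set_integrable lebesgue S (\<lambda>y. d y * f y)"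
    and dominated_kernel_tendsto:
      "((\<lambda>r. LINT y:S|lebesgue. c r y * f y) \<longlongrightarrow> (LINT y:S|lebesgue. d y * f y)) at_top"
proof -
  define h where "h = (\<lambda>r y. indicat_real S y *\<^sub>R (c (max 1 r) y * f y))"
  define h0 where "h0 = (\<lambda>y. indicat_real S y *\<^sub>R (d y * f y))"
  define w where "w = (\<lambda>y. norm (\<bar>B\<bar> *\<^sub>R (indicat_real S y *\<^sub>R f y)))"
  have hm: "h r \<in> borel_measurable lebesgue" for r
    using meas[of "max 1 r"] by (auto simp: h_def set_integrable_def)
  have hl: "((\<lambda>r. h r y) \<longlongrightarrow> h0 y) at_top" for y
  proof (cases "y \<in> S")
    case True
    have "((\<lambda>r. c r y * f y) \<longlongrightarrow> d y * f y) at_top" by (intro tendsto_intros lim True)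
    then have "((\<lambda>r. c (max 1 r) y * f y) \<longlongrightarrow> d y * f y) at_top"
      by (rule Lim_transform_eventually)
         (use eventually_ge_at_top[of 1] in \<open>eventually_elim, simp add: max_def\<close>)
    then show ?thesis using True by (simp add: h_def h0_def)
  qed (simp add: h_def h0_def)
  have hm0: "h0 \<in> borel_measurable lebesgue"
  proof (rule borel_measurable_LIMSEQ_metric)
    show "h (real n) \<in> borel_measurable lebesgue" for n by (rule hm)
    show "(\<lambda>n. h (real n) y) \<longlonglongrightarrow> h0 y" for y
      using filterlim_compose[OF hl filterlim_real_sequentially] .
  qed
  have w: "integrable lebesgue w"
    unfolding w_def using f by (intro integrable_norm integrable_scaleR_right) (auto simp: set_integrable_def)
  have hw: "norm (h r y) \<le> w y" for r y
    using bound[of "max 1 r" y]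
    by (auto simp: h_def w_def norm_mult indicator_def intro!: mult_right_mono)
  have hw0: "norm (h0 y) \<le> w y" for y
    by (rule tendsto_upperbound[OF tendsto_norm[OF hl[of y]]]) (use hw in auto)
  show "set_integrable lebesgue S (\<lambda>y. d y * f y)"
    unfolding set_integrable_def h0_def[symmetric]
    by (rule Bochner_Integration.integrable_bound[OF w hm0])
       (auto intro!: AE_I2 order_trans[OF hw0] simp: w_def)
  have "((\<lambda>r. LINT y|lebesgue. h r y) \<longlongrightarrow> (LINT y|lebesgue. h0 y)) at_top"
    by (rule integral_dominated_convergence_at_top[OF hm0 hm w]) (use hl hw in auto)
  then have "((\<lambda>r. LINT y|lebesgue. h r y) \<longlongrightarrow> (LINT y:S|lebesgue. d y * f y)) at_top"
    by (simp add: h0_def set_lebesgue_integral_def)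
  then show "((\<lambda>r. LINT y:S|lebesgue. c r y * f y) \<longlongrightarrow> (LINT y:S|lebesgue. d y * f y)) at_top"
    by (rule Lim_transform_eventually)
       (use eventually_ge_at_top[of 1] in \<open>eventually_elim, simp add: max_def h_def set_lebesgue_integral_def\<close>)
qed

text \<open>
  Since \<open>f\<close> is only absolutely continuous, the product rule is replaced by exchanging the order of
  integration over the triangle \<open>s < y\<close>. Here \<open>P s\<close> is the integral of \<open>n\<close> from \<open>s\<close> to
  \<open>b\<close>.
\<close>

lemma ac_integration_by_parts:
  fixes n g P :: "real \<Rightarrow> complex"
  assumes n: "set_integrable lebesgue {a<..<b} n" and g: "set_integrable lebesgue {a<..<b} g"
    and f: "AE y in lebesgue. a < y \<and> y < b \<longrightarrow> f y = c + (LINT s:{a<..<y}|lebesgue. g s)"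
    and P: "\<And>s. a < s \<Longrightarrow> s < b \<Longrightarrow> (LINT y:{s<..<b}|lebesgue. n y) = P s"
    and Pa: "(LINT y:{a<..<b}|lebesgue. n y) = P a"
    and nf: "set_borel_measurable lebesgue {a<..<b} f"
  shows "(LINT y:{a<..<b}|lebesgue. n y * f y) = c * P a + (LINT s:{a<..<b}|lebesgue. P s * g s)"
    and "set_integrable lebesgue {a<..<b} (\<lambda>s. P s * g s)"
proof -
  interpret pair_sigma_finite "lebesgue :: real measure" "lebesgue :: real measure" by (rule pair_lebesgue_lebesgue)
  define S where "S = {a<..<b}"
  define n0 where "n0 = (\<lambda>y. indicat_real S y *\<^sub>R n y)"
  define g0 where "g0 = (\<lambda>y. indicat_real S y *\<^sub>R g y)"
  have n0: "integrable lebesgue n0" and g0: "integrable lebesgue g0"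
    using n g by (simp_all add: n0_def g0_def S_def set_integrable_def)
  define h where "h = (\<lambda>y s. indicat_real {p. snd p < fst p} (y, s) *\<^sub>R (n0 y * g0 s))"
  have T: "integrable (lebesgue \<Otimes>\<^sub>M lebesgue) (\<lambda>(y, s). n0 y * g0 s)"
    by (rule integrable_tensor[OF n0 g0])
  have "{p::real \<times> real. snd p < fst p} \<in> sets borel"
    by (intro borel_open open_Collect_less continuous_intros)
  then have D: "{p::real \<times> real. snd p < fst p} \<in> sets (lebesgue \<Otimes>\<^sub>M lebesgue)"
    using measurable_sets[OF id_pair_borel[of lebesgue lebesgue]]
    by (fastforce simp: space_pair_measure intro: measurable_completion)
  have H: "integrable (lebesgue \<Otimes>\<^sub>M lebesgue) (case_prod h)"
    using integrable_mult_indicator[OF D T] by (simp add: h_def case_prod_unfold)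
  have in1: "(LINT s|lebesgue. h y s) = n0 y * (LINT s:{a<..<y}|lebesgue. g s)" if "y < b" for y
  proof -
    have "(LINT s|lebesgue. h y s) = (LINT s|lebesgue. n0 y * (indicat_real {a<..<y} s *\<^sub>R g s))"
      using that by (intro Bochner_Integration.integral_cong) (auto simp: h_def g0_def S_def indicator_def)
    then show ?thesis by (simp only: set_lebesgue_integral_def integral_mult_right_zero)
  qed
  have in2: "(LINT y|lebesgue. h y s) = indicat_real S s *\<^sub>R (P s * g s)" for s
  proof -
    have "(LINT y|lebesgue. h y s) = (LINT y|lebesgue. (indicat_real {s<..<b} y *\<^sub>R n y) * g0 s)"
      by (intro Bochner_Integration.integral_cong) (auto simp: h_def g0_def n0_def S_def indicator_def)
    also have "\<dots> = (LINT y:{s<..<b}|lebesgue. n y) * g0 s"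
      by (simp only: set_lebesgue_integral_def integral_mult_left_zero)
    finally show ?thesis using P[of s] by (auto simp: g0_def S_def indicator_def)
  qed
  have F: "(LINT s|lebesgue. LINT y|lebesgue. h y s) = (LINT y|lebesgue. LINT s|lebesgue. h y s)"
    by (rule Fubini_integral[OF H])
  show "set_integrable lebesgue {a<..<b} (\<lambda>s. P s * g s)"
    using integrable_snd[OF H] unfolding in2 set_integrable_def S_def .
  have I: "integrable lebesgue (\<lambda>y. LINT s|lebesgue. h y s)"
    using integrable_fst[OF H] .
  have "(LINT y:{a<..<b}|lebesgue. n y * f y) = (LINT y|lebesgue. c * n0 y + (LINT s|lebesgue. h y s))"
    unfolding set_lebesgue_integral_def
  proof (rule Bochner_Integration.integral_cong_AE)
    have nb: "(\<lambda>y. n0 y * (indicat_real S y *\<^sub>R f y)) \<in> borel_measurable lebesgue"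
      using n0 nf by (intro borel_measurable_times) (auto simp: S_def set_borel_measurable_def)
    have "(\<lambda>y. indicat_real {a<..<b} y *\<^sub>R (n y * f y)) = (\<lambda>y. n0 y * (indicat_real S y *\<^sub>R f y))"
      by (auto simp: n0_def S_def indicator_def)
    with nb show "(\<lambda>y. indicat_real {a<..<b} y *\<^sub>R (n y * f y)) \<in> borel_measurable lebesgue" by simp
    show "(\<lambda>y. c * n0 y + (LINT s|lebesgue. h y s)) \<in> borel_measurable lebesgue"
      using n0 I by (intro borel_measurable_add borel_measurable_times) auto
    show "AE y in lebesgue. indicat_real {a<..<b} y *\<^sub>R (n y * f y) = c * n0 y + (LINT s|lebesgue. h y s)"
      using f
    proof eventually_elim
      case (elim y)
      show ?case
      proof (cases "y \<in> S")
        case True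
        then show ?thesis using elim in1[of y] by (simp add: S_def n0_def algebra_simps)
      next
        case False
        then have "h y s = 0" for s by (simp add: h_def n0_def)
        then show ?thesis using False by (simp add: n0_def S_def)
      qed
    qed
  qed
  also have "\<dots> = c * (LINT y|lebesgue. n0 y) + (LINT y|lebesgue. LINT s|lebesgue. h y s)"
    using n0 I by simp
  also have "(LINT y|lebesgue. n0 y) = P a" using Pa by (simp add: n0_def S_def set_lebesgue_integral_def)
  also have "(LINT y|lebesgue. LINT s|lebesgue. h y s) = (LINT s:{a<..<b}|lebesgue. P s * g s)"
    unfolding F[symmetric] in2 set_lebesgue_integral_def S_def ..
  finally show "(LINT y:{a<..<b}|lebesgue. n y * f y) = c * P a + (LINT s:{a<..<b}|lebesgue. P s * g s)" .
qed

text \<open>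
  Instead of the Cauchy--Schwarz inequality: \<open>2 |g| \<le> d |g|^2 + 1/d\<close>, with \<open>d\<close> the square root
  of the length.
\<close>

lemma L2_local_L1:
  assumes g: "L2_on S g" and sub: "{a<..<y} \<subseteq> S" and ay: "a < y"
  shows L2_imp_set_integrable: "set_integrable lebesgue {a<..<y} g"
    and L2_integral_norm_le:
      "(LINT s:{a<..<y}|lebesgue. norm (g s)) \<le> sqrt (y - a) * (L2_normsq S g + 1) / 2"
proof -
  define d where "d = sqrt (y - a)"
  have d: "d > 0" "d\<^sup>2 = y - a" using ay by (simp_all add: d_def)
  have m: "set_borel_measurable lebesgue {a<..<y} g"
  proof -
    have "(\<lambda>x. indicat_real {a<..<y} x *\<^sub>R (indicat_real S x *\<^sub>R g x)) \<in> borel_measurable lebesgue"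
    proof (rule borel_measurable_scaleR)
      show "(\<lambda>x. indicat_real {a<..<y} x) \<in> borel_measurable lebesgue"
        by (rule borel_measurable_indicator) simp
    qed (use g in \<open>simp add: L2_on_def set_borel_measurable_def\<close>)
    moreover have "(\<lambda>x. indicat_real {a<..<y} x *\<^sub>R (indicat_real S x *\<^sub>R g x)) = (\<lambda>x. indicat_real {a<..<y} x *\<^sub>R g x)"
      using sub by (auto simp: indicator_def fun_eq_iff)
    ultimately show ?thesis by (simp add: set_borel_measurable_def)
  qed
  have iS: "integrable lebesgue (\<lambda>x. indicat_real S x *\<^sub>R (cmod (g x))\<^sup>2)"
    using g by (simp add: L2_on_def set_integrable_def)
  have ii: "integrable lebesgue (indicat_real {a<..<y})"
    by (rule integrable_real_indicator) (use ay in auto)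
  define w where "w = (\<lambda>x. (d / 2) * (indicat_real S x *\<^sub>R (cmod (g x))\<^sup>2) + (1 / (2 * d)) * indicat_real {a<..<y} x)"
  have w: "integrable lebesgue w"
    unfolding w_def by (intro Bochner_Integration.integrable_add integrable_mult_right iS ii)
  have bound: "norm (indicat_real {a<..<y} x *\<^sub>R g x) \<le> w x" for x
  proof (cases "x \<in> {a<..<y}")
    case True
    have "0 \<le> (d * cmod (g x) - 1)\<^sup>2" by simp
    then have "2 * d * cmod (g x) \<le> d\<^sup>2 * (cmod (g x))\<^sup>2 + 1"
      by (simp add: power2_eq_square algebra_simps)
    then have "cmod (g x) \<le> (d / 2) * (cmod (g x))\<^sup>2 + 1 / (2 * d)"
      using d(1) by (simp add: field_simps power2_eq_square)
    then show ?thesis using True sub by (auto simp: w_def)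
  next
    case False then show ?thesis using d by (simp add: w_def)
  qed
  have wn: "w x \<ge> 0" for x using bound[of x] norm_ge_zero order_trans by blast
  show si: "set_integrable lebesgue {a<..<y} g"
    unfolding set_integrable_def
    by (rule Bochner_Integration.integrable_bound[OF w m[unfolded set_borel_measurable_def]])
       (use bound wn in \<open>auto intro!: AE_I2\<close>)
  have "(LINT s:{a<..<y}|lebesgue. norm (g s)) \<le> (LINT x|lebesgue. w x)"
    unfolding set_lebesgue_integral_def
  proof (rule integral_mono)
    show "integrable lebesgue (\<lambda>x. indicat_real {a<..<y} x *\<^sub>R cmod (g x))"
      using integrable_norm[OF si[unfolded set_integrable_def]] by simp
  qed (use w bound in auto)
  also have "\<dots> = (d / 2) * L2_normsq S g + (1 / (2 * d)) * (y - a)"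
    unfolding w_def L2_normsq_def set_lebesgue_integral_def
    using iS ii ay by (simp add: integral_completion)
  also have "(1 / (2 * d)) * (y - a) = d / 2" using d by (simp add: field_simps power2_eq_square)
  finally show "(LINT s:{a<..<y}|lebesgue. norm (g s)) \<le> sqrt (y - a) * (L2_normsq S g + 1) / 2"
    by (simp add: d_def algebra_simps)
qed

lemma norm_set_integral_le:
  fixes f :: "real \<Rightarrow> complex"
  assumes "set_integrable M A f"
  shows "norm (LINT x:A|M. f x) \<le> (LINT x:A|M. norm (f x))"
  using integral_norm_bound[of M "\<lambda>x. indicator A x *\<^sub>R f x"] by (simp add: set_lebesgue_integral_def)

section \<open>Sobolev functions on an interval\<close>

text \<open>
  The Borel sets over which the integral vanishes form a Dynkin system containing the half lines, and every
  Lebesgue set differs from a Borel set by a null set.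
\<close>

lemma AE_zero_of_interval_integrals:
  fixes k :: "real \<Rightarrow> complex"
  assumes k: "integrable lebesgue k" and zero: "\<And>x. (LINT y:{..x}|lebesgue. k y) = 0"
    and total: "(LINT y|lebesgue. k y) = 0"
  shows "AE y in lebesgue. k y = 0"
proof (rule sigma_finite_measure.density_zero[OF sigma_finite_lebesgue k])
  have si: "set_integrable lebesgue A k" if "A \<in> sets lebesgue" for A
    unfolding set_integrable_def by (rule integrable_mult_indicator[OF that k])
  have B: "(LINT y:A|lebesgue. k y) = 0" if "A \<in> sets borel" for A
  proof -
    have "Int_stable (range (\<lambda>a. {..a::real}))" by (auto simp: Int_stable_def)
    moreover have "range (\<lambda>a. {..a::real}) \<subseteq> Pow UNIV" by simp
    moreover have "A \<in> sigma_sets UNIV (range (\<lambda>a. {..a::real}))"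
      using that unfolding borel_eq_atMost by simp
    ultimately show ?thesis
    proof (induct rule: sigma_sets_induct_disjoint)
      case (basic A) then show ?case using zero by auto
    next
      case empty show ?case by (simp add: set_lebesgue_integral_def)
    next
      case (compl A)
      then have A: "A \<in> sets lebesgue"
      proof -
        have "A \<in> sets borel" using compl(1) unfolding borel_eq_atMost by simp
        then show ?thesis by auto
      qed
      have "(LINT y:UNIV - A|lebesgue. k y) = (LINT y|lebesgue. k y - indicat_real A y *\<^sub>R k y)"
        unfolding set_lebesgue_integral_def
        by (rule Bochner_Integration.integral_cong) (auto simp: indicator_def)
      also have "\<dots> = 0"
        using compl(2) si[OF A] k total by (simp add: set_lebesgue_integral_def set_integrable_def)
      finally show ?case .
    next
      case (union A)
      have A: "A i \<in> sets lebesgue" for i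
      proof -
        have "A i \<in> sigma_sets UNIV (range (\<lambda>a. {..a::real}))" using union by auto
        then have "A i \<in> sets borel" unfolding borel_eq_atMost by simp
        then show ?thesis by auto
      qed
      have "(LINT y:(\<Union>i. A i)|lebesgue. k y) = (\<Sum>i. LINT y:A i|lebesgue. k y)"
        using union A by (intro lebesgue_integral_countable_add si) (auto simp: disjoint_family_on_def)
      then show ?case using union by simp
    qed
  qed
  fix A :: "real set" assume A: "A \<in> sets lebesgue"
  define A' where "A' = main_part lborel A"
  have A': "A' \<in> sets borel" using main_part_sets[OF A] by (simp add: A'_def)
  obtain N where N: "N \<in> null_sets lborel" "null_part lborel A \<subseteq> N" using null_part[OF A] by blast
  have NL: "N \<in> null_sets lebesgue" using N(1) by (rule null_sets_completionI)
  have AA: "A = A' \<union> null_part lborel A" using main_part_null_part_Un[OF A] by (simp add: A'_def)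
  have "(LINT y:A|lebesgue. k y) = (LINT y:A'|lebesgue. k y)"
    unfolding set_lebesgue_integral_def
  proof (rule Bochner_Integration.integral_cong_AE)
    show "(\<lambda>y. indicat_real A y *\<^sub>R k y) \<in> borel_measurable lebesgue"
      "(\<lambda>y. indicat_real A' y *\<^sub>R k y) \<in> borel_measurable lebesgue"
      using si[OF A] si[of A'] A' by (auto simp: set_integrable_def)
    show "AE y in lebesgue. indicat_real A y *\<^sub>R k y = indicat_real A' y *\<^sub>R k y"
      using AE_not_in[OF NL]
    proof eventually_elim
      case (elim y)
      then have "y \<in> A \<longleftrightarrow> y \<in> A'" using AA N(2) by blast
      then show ?case by (simp add: indicator_def)
    qed
  qed
  then show "(LINT y:A|lebesgue. k y) = 0" using B[OF A'] by simp
qed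

lemma continuous_antiderivative:
  fixes \<psi> :: "real \<Rightarrow> real"
  assumes "continuous_on UNIV \<psi>"
  obtains \<phi> where "\<And>x. (\<phi> has_real_derivative \<psi> x) (at x)"
proof -
  have "\<exists>F. \<forall>x::real. -\<infinity> < ereal x \<longrightarrow> ereal x < \<infinity> \<longrightarrow> (F has_vector_derivative \<psi> x) (at x)"
    by (rule einterval_antiderivative) (use assms in \<open>auto simp: continuous_on_eq_continuous_at\<close>)
  then show thesis using that by (auto simp: has_real_derivative_iff_has_vector_derivative)
qed

text \<open>
  Continuous approximations of the indicator function of an interval; differences of suitable multiples of two
  of them are derivatives of test functions. The placement of the slopes makes the integral exactly \<open>v - u\<close>, for every \<open>\<epsilon>\<close>.
\<close>

definition trapezoid :: "real \<Rightarrow> real \<Rightarrow> real \<Rightarrow> real \<Rightarrow> real" where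
  "trapezoid u v \<epsilon> y = (max 0 (min \<epsilon> (y - u)) - max 0 (min \<epsilon> (y - v))) / \<epsilon>"

lemma trapezoid_bounds:
  assumes "u \<le> v" "\<epsilon> > 0"
  shows "0 \<le> trapezoid u v \<epsilon> y" "trapezoid u v \<epsilon> y \<le> 1"
  using assms by (auto simp: trapezoid_def field_simps max_def min_def)

lemma trapezoid_outside:
  assumes "u \<le> v" "\<epsilon> > 0" "y \<le> u \<or> v + \<epsilon> \<le> y"
  shows "trapezoid u v \<epsilon> y = 0"
  using assms by (auto simp: trapezoid_def max_def min_def)

lemma continuous_on_trapezoid: "continuous_on A (trapezoid u v \<epsilon>)"
  unfolding trapezoid_def divide_inverse by (intro continuous_intros)

lemma trapezoid_limit:
  assumes "u < v"
  shows "((\<lambda>r. trapezoid u v (1 / r) y) \<longlongrightarrow> indicat_real {u<..v} y) at_top"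
proof (rule tendsto_eventually)
  show "\<forall>\<^sub>F r in at_top. trapezoid u v (1 / r) y = indicat_real {u<..v} y"
  proof -
    consider "y \<le> u" | "u < y" "y \<le> v" | "v < y" by linarith
    then show ?thesis
    proof cases
      case 1
      show ?thesis using eventually_gt_at_top[of 0]
        by eventually_elim (use 1 assms in \<open>auto simp: trapezoid_outside\<close>)
    next
      case 2
      show ?thesis using eventually_gt_at_top[of "1 / (y - u)"] eventually_gt_at_top[of 0]
      proof eventually_elim
        case (elim r)
        then have "1 / r < y - u" using 2 by (simp add: field_simps)
        then show ?case using elim 2 by (simp add: trapezoid_def)
      qed
    next
      case 3
      show ?thesis using eventually_gt_at_top[of "1 / (y - v)"] eventually_gt_at_top[of 0]
      proof eventually_elim
        case (elim r)
        then have "1 / r < y - v" using 3 by (simp add: field_simps)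
        then have "trapezoid u v (1 / r) y = 0" using elim assms by (intro trapezoid_outside) auto
        then show ?case using 3 by simp
      qed
    qed
  qed
qed

text \<open>
  The slopes are differences of translates of one ramp, so the primitive is a difference of translates of the
  primitive \<open>G\<close> of the ramp, which is affine beyond \<open>\<epsilon>\<close>.
\<close>

lemma trapezoid_integral:
  assumes "u \<le> v" "\<epsilon> > 0" "m \<le> u" "v + \<epsilon> \<le> n"
    and \<phi>: "\<And>x. (\<phi> has_real_derivative trapezoid u v \<epsilon> x) (at x)"
  shows "\<phi> n - \<phi> m = v - u"
proof -
  define R where "R = (\<lambda>s::real. if s \<le> 0 then 0 else if s \<le> \<epsilon> then s\<^sup>2 / 2 else \<epsilon> * s - \<epsilon>\<^sup>2 / 2)"
  obtain G where G: "\<And>x. (G has_real_derivative max 0 (min \<epsilon> x)) (at x)"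
    by (rule continuous_antiderivative[of "\<lambda>x. max 0 (min \<epsilon> x)"]) (auto intro!: continuous_intros)
  have c1: "G x = G 0" if "x \<le> 0" for x
  proof (cases "x = 0")
    case False
    then have "\<exists>z>x. z < 0 \<and> G 0 - G x = (0 - x) * max 0 (min \<epsilon> z)"
      using that by (intro MVT2 G) auto
    then show ?thesis by auto
  qed simp
  have c2: "G x = G \<epsilon> + \<epsilon> * (x - \<epsilon>)" if "x \<ge> \<epsilon>" for x
  proof (cases "x = \<epsilon>")
    case False
    then have "\<exists>z>\<epsilon>. z < x \<and> G x - G \<epsilon> = (x - \<epsilon>) * max 0 (min \<epsilon> z)"
      using that by (intro MVT2 G) auto
    then show ?thesis using assms by (auto simp: algebra_simps)
  qed simp
  define H where "H = (\<lambda>y. \<phi> y - (G (y - u) - G (y - v)) / \<epsilon>)"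
  have "(H has_real_derivative 0) (at y)" for y
  proof -
    have "((\<lambda>y. G (y - c)) has_real_derivative max 0 (min \<epsilon> (y - c))) (at y)" for c
    proof -
      have "((\<lambda>y. y - c) has_real_derivative 1) (at y)" by (auto intro!: derivative_eq_intros)
      from DERIV_chain2[OF G this] show ?thesis by simp
    qed
    then have "(H has_real_derivative (trapezoid u v \<epsilon> y - (max 0 (min \<epsilon> (y - u)) - max 0 (min \<epsilon> (y - v))) / \<epsilon>)) (at y)"
      unfolding H_def by (intro DERIV_diff DERIV_cdivide \<phi>)
    then show ?thesis by (simp add: trapezoid_def)
  qed
  then have "H n = H m" using DERIV_isconst_all by blast
  moreover have "H m = \<phi> m" using assms c1[of "m - u"] c1[of "m - v"] by (simp add: H_def)
  moreover have "G (n - u) - G (n - v) = \<epsilon> * (v - u)"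
    using assms c2[of "n - u"] c2[of "n - v"] by (simp add: algebra_simps)
  then have "H n = \<phi> n - (v - u)" using assms by (simp add: H_def)
  ultimately show ?thesis by simp
qed

lemma integral_trapezoid_limit:
  fixes h :: "real \<Rightarrow> complex"
  assumes h: "set_integrable lebesgue S h" and "{u<..v} \<subseteq> S" "u < v" "S \<in> sets lebesgue"
  shows "((\<lambda>r. LINT y:S|lebesgue. of_real (trapezoid u v (1 / r) y) * h y) \<longlongrightarrow> (LINT y:{u<..v}|lebesgue. h y)) at_top"
proof -
  have "((\<lambda>r. LINT y:S|lebesgue. of_real (trapezoid u v (1 / r) y) * h y)
     \<longlongrightarrow> (LINT y:S|lebesgue. of_real (indicat_real {u<..v} y) * h y)) at_top"
  proof (rule dominated_kernel_tendsto[OF h, where B = 1])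
    fix r :: real assume r: "r \<ge> 1"
    show "norm (complex_of_real (trapezoid u v (1 / r) y)) \<le> 1" for y
      using trapezoid_bounds[of u v "1/r" y] assms r by simp
    show "set_integrable lebesgue S (\<lambda>y. of_real (trapezoid u v (1 / r) y) * h y)"
      by (rule set_integrable_continuous_mult[OF h, where B = 1])
         (use trapezoid_bounds[of u v "1 / r"] assms r in \<open>auto intro!: continuous_intros continuous_on_trapezoid\<close>)
  next
    show "((\<lambda>r. complex_of_real (trapezoid u v (1 / r) y)) \<longlongrightarrow> of_real (indicat_real {u<..v} y)) at_top" for y
      by (intro tendsto_of_real trapezoid_limit assms)
  qed
  also have "(LINT y:S|lebesgue. of_real (indicat_real {u<..v} y) * h y) = (LINT y:{u<..v}|lebesgue. h y)"
    unfolding set_lebesgue_integral_def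
    by (rule Bochner_Integration.integral_cong) (use assms in \<open>auto simp: indicator_def\<close>)
  finally show ?thesis .
qed

lemma continuous_on_indefinite_integral:
  fixes g :: "real \<Rightarrow> complex"
  assumes g: "set_integrable lebesgue {a<..<b} g"
  shows "continuous_on {a..b} (\<lambda>y. LINT s:{a<..<y}|lebesgue. g s)"
proof -
  have "g integrable_on {a..b}"
    using set_lebesgue_integral_eq_integral(1)[OF g] by (simp add: integrable_on_open_interval_real)
  then have "continuous_on {a..b} (\<lambda>y. integral {a..y} g)" by (rule indefinite_integral_continuous_1)
  moreover have eq: "(LINT s:{a<..<y}|lebesgue. g s) = integral {a..y} g" if "y \<in> {a..b}" for y
  proof -
    have "set_integrable lebesgue {a<..<y} g"
      by (rule set_integrable_subset[OF g]) (use that in auto)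
    from set_lebesgue_integral_eq_integral(2)[OF this] show ?thesis
      by (simp add: integral_open_interval_real)
  qed
  ultimately show ?thesis by (elim continuous_on_eq) (rule eq[symmetric])
qed

text \<open>
  A continuous function \<open>\<psi>\<close> with compact support and vanishing integral is the derivative of a test
  function; testing with it shows that \<open>f\<close> minus the indefinite integral of its weak derivative has weak
  derivative \<open>0\<close>.
\<close>

lemma weak_derivative_orthogonal:
  fixes f g :: "real \<Rightarrow> complex" and \<psi> \<Phi> :: "real \<Rightarrow> real"
  assumes weak: "\<And>\<phi> \<phi>'. (\<And>x. (\<phi> has_real_derivative \<phi>' x) (at x)) \<Longrightarrow> continuous_on UNIV \<phi>' \<Longrightarrow>
        (\<exists>C. compact C \<and> C \<subseteq> S \<and> (\<forall>x. x \<notin> C \<longrightarrow> \<phi> x = 0)) \<Longrightarrow>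
        (LINT x:S|lebesgue. \<phi>' x *\<^sub>R f x) = - (LINT x:S|lebesgue. \<phi> x *\<^sub>R g x)"
    and f: "set_integrable lebesgue {a<..<b} f" and g: "set_integrable lebesgue {a<..<b} g"
    and sub: "{a<..<b} \<subseteq> S"
    and \<psi>: "continuous_on UNIV \<psi>" "\<And>x. x \<notin> {m..n} \<Longrightarrow> \<psi> x = 0" and mn: "a < m" "m \<le> n" "n < b"
    and \<Phi>: "\<And>x. (\<Phi> has_real_derivative \<psi> x) (at x)" "\<Phi> n = \<Phi> m"
  shows "(LINT y:{a<..<b}|lebesgue. of_real (\<psi> y) * (f y - (LINT s:{a<..<y}|lebesgue. g s))) = 0"
proof -
  define F where "F = (\<lambda>y. LINT s:{a<..<y}|lebesgue. g s)"
  define \<phi> where "\<phi> = (\<lambda>x. \<Phi> x - \<Phi> m)"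
  have \<phi>: "(\<phi> has_real_derivative \<psi> x) (at x)" for x
    unfolding \<phi>_def using DERIV_diff[OF \<Phi>(1) DERIV_const] by simp
  have z: "\<phi> x = 0" if "x \<notin> {m..n}" for x
  proof (cases "x < m")
    case True
    then have "\<exists>w>x. w < m \<and> \<Phi> m - \<Phi> x = (m - x) * \<psi> w" by (intro MVT2 \<Phi>(1)) auto
    then show ?thesis using \<psi>(2) by (auto simp: \<phi>_def)
  next
    case False
    then have "n < x" using that by auto
    then have "\<exists>w>n. w < x \<and> \<Phi> x - \<Phi> n = (x - n) * \<psi> w" by (intro MVT2 \<Phi>(1)) auto
    then show ?thesis using \<psi>(2) \<Phi>(2) by (auto simp: \<phi>_def)
  qed
  have restr: "(LINT x:S|lebesgue. u x *\<^sub>R w x) = (LINT x:{a<..<b}|lebesgue. of_real (u x) * w x)"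
    if "\<And>x. x \<notin> {m..n} \<Longrightarrow> u x = 0" for u :: "real \<Rightarrow> real" and w :: "real \<Rightarrow> complex"
    unfolding set_lebesgue_integral_def
  proof (rule Bochner_Integration.integral_cong)
    fix x
    show "indicat_real S x *\<^sub>R u x *\<^sub>R w x = indicat_real {a<..<b} x *\<^sub>R (of_real (u x) * w x)"
    proof (cases "x \<in> {m..n}")
      case True
      then have "x \<in> {a<..<b}" using mn by auto
      then show ?thesis using subsetD[OF sub, of x] by (simp add: scaleR_conv_of_real)
    qed (simp add: that)
  qed simp
  have W: "(LINT x:{a<..<b}|lebesgue. of_real (\<psi> x) * f x) = - (LINT x:{a<..<b}|lebesgue. of_real (\<phi> x) * g x)"
  proof -
    have "\<exists>C. compact C \<and> C \<subseteq> S \<and> (\<forall>x. x \<notin> C \<longrightarrow> \<phi> x = 0)"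
      using mn sub z by (intro exI[of _ "{m..n}"]) auto
    from weak[OF \<phi> \<psi>(1) this] have "(LINT x:S|lebesgue. \<psi> x *\<^sub>R f x) = - (LINT x:S|lebesgue. \<phi> x *\<^sub>R g x)" .
    moreover have "(LINT x:S|lebesgue. \<psi> x *\<^sub>R f x) = (LINT x:{a<..<b}|lebesgue. of_real (\<psi> x) * f x)"
      by (rule restr) (rule \<psi>(2))
    moreover have "(LINT x:S|lebesgue. \<phi> x *\<^sub>R g x) = (LINT x:{a<..<b}|lebesgue. of_real (\<phi> x) * g x)"
      by (rule restr) (rule z)
    ultimately show ?thesis by simp
  qed
  have n: "set_integrable lebesgue {s<..<b} (\<lambda>y. complex_of_real (\<psi> y))" for s
    by (intro continuous_set_integrable_lebesgue continuous_intros continuous_on_subset[OF \<psi>(1)]) auto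
  have P: "(LINT y:{s<..<b}|lebesgue. complex_of_real (\<psi> y)) = - of_real (\<phi> s)" if "s < b" for s
  proof -
    have "((\<lambda>y. complex_of_real (\<psi> y)) has_integral (of_real (\<phi> b) - of_real (\<phi> s))) {s..b}"
    proof (rule fundamental_theorem_of_calculus)
      fix x
      show "((\<lambda>y. complex_of_real (\<phi> y)) has_vector_derivative of_real (\<psi> x)) (at x within {s..b})"
        by (rule has_vector_derivative_of_real[OF has_field_derivative_at_within[OF \<phi>]])
    qed (use that in simp)
    then have "integral {s<..<b} (\<lambda>y. complex_of_real (\<psi> y)) = of_real (\<phi> b) - of_real (\<phi> s)"
      unfolding integral_open_interval_real[symmetric] by (rule integral_unique)
    then show ?thesis using set_lebesgue_integral_eq_integral(2)[OF n[of s]] z[of b] mn by simp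
  qed
  have cF: "continuous_on {a<..<b} F"
    using continuous_on_indefinite_integral[OF g] unfolding F_def by (rule continuous_on_subset) auto
  have Fm: "set_borel_measurable lebesgue {a<..<b} F"
    unfolding set_borel_measurable_def
    using borel_measurable_continuous_on_indicator[OF _ cF] by (intro lebesgue_borel_measurableI) simp
  have IBP: "(LINT y:{a<..<b}|lebesgue. of_real (\<psi> y) * F y) = 0 * - of_real (\<phi> a) + (LINT s:{a<..<b}|lebesgue. - of_real (\<phi> s) * g s)"
    and I: "set_integrable lebesgue {a<..<b} (\<lambda>s. - of_real (\<phi> s) * g s)"
    by (rule ac_integration_by_parts[OF n g _ P P Fm]; use mn in \<open>auto simp: F_def\<close>)+
  have ib: "set_integrable lebesgue {a<..<b} (\<lambda>y. of_real (\<psi> y) * w y)"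
    if w: "set_integrable lebesgue {a<..<b} w" for w :: "real \<Rightarrow> complex"
  proof -
    obtain B where B: "\<And>x. x \<in> {m..n} \<Longrightarrow> norm (\<psi> x) \<le> B"
      using compact_imp_bounded[OF compact_continuous_image[OF continuous_on_subset[OF \<psi>(1)] compact_Icc[of m n]]]
      by (force simp: bounded_iff)
    then have B': "\<bar>\<psi> x\<bar> \<le> \<bar>B\<bar>" for x using \<psi>(2)[of x] by (cases "x \<in> {m..n}") force+
    show ?thesis
      by (rule set_integrable_continuous_mult[OF w, where B = "\<bar>B\<bar>"])
         (use B' \<psi>(1) in \<open>auto intro!: continuous_intros\<close>)
  qed
  have Fi: "set_integrable lebesgue {a<..<b} F"
    unfolding F_def by (intro continuous_set_integrable_lebesgue continuous_on_indefinite_integral g)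
  have "(LINT y:{a<..<b}|lebesgue. of_real (\<psi> y) * (f y - F y))
      = (LINT y:{a<..<b}|lebesgue. of_real (\<psi> y) * f y) - (LINT y:{a<..<b}|lebesgue. of_real (\<psi> y) * F y)"
    unfolding right_diff_distrib by (rule set_integral_diff(2)[OF ib[OF f] ib[OF Fi]])
  also have "\<dots> = 0" unfolding W IBP by (simp add: set_lebesgue_integral_def)
  finally show ?thesis by (simp add: F_def)
qed

text \<open>
  The lemma of du Bois-Reymond. Two trapezoids over different intervals, scaled by the lengths of each other's
  interval, have a difference of vanishing integral; as the slopes steepen, the means of \<open>f - \<integral> g\<close> over all
  intervals turn out equal. The set \<open>S\<close> is a bounded or unbounded open interval with left end \<open>a\<close>.
\<close>

lemma H1_representation:
  fixes f :: "real \<Rightarrow> complex"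
  assumes H1: "H1_on S f" and S: "open S" "\<And>y. y \<in> S \<Longrightarrow> a < y" "\<And>y. y \<in> S \<Longrightarrow> {a<..y} \<subseteq> S" and ne: "S \<noteq> {}"
  obtains c g where "L2_on S g"
    "AE y in lebesgue. y \<in> S \<longrightarrow> f y = c + (LINT s:{a<..<y}|lebesgue. g s)"
proof -
  obtain g where f2: "L2_on S f" and g2: "L2_on S g" and weak: "\<And>\<phi> \<phi>'.
     (\<And>x. (\<phi> has_real_derivative \<phi>' x) (at x)) \<Longrightarrow> continuous_on UNIV \<phi>' \<Longrightarrow>
        (\<exists>C. compact C \<and> C \<subseteq> S \<and> (\<forall>x. x \<notin> C \<longrightarrow> \<phi> x = 0)) \<Longrightarrow>
        (LINT x:S|lebesgue. \<phi>' x *\<^sub>R f x) = - (LINT x:S|lebesgue. \<phi> x *\<^sub>R g x)"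
    using H1 unfolding H1_on_def by blast
  define F where "F = (\<lambda>y. LINT s:{a<..<y}|lebesgue. g s)"
  define h where "h = (\<lambda>y. f y - F y)"
  have subS: "{a<..<b} \<subseteq> S" if "b \<in> S" for b using S(3)[OF that] by auto
  have fi: "set_integrable lebesgue {a<..<b} f" and gi: "set_integrable lebesgue {a<..<b} g" if "b \<in> S" for b
    using L2_imp_set_integrable[OF f2 subS[OF that] S(2)[OF that]]
      L2_imp_set_integrable[OF g2 subS[OF that] S(2)[OF that]] by auto
  have hi: "set_integrable lebesgue {a<..<b} h" if "b \<in> S" for b
  proof -
    have "set_integrable lebesgue {a<..<b} F"
      unfolding F_def by (intro continuous_set_integrable_lebesgue continuous_on_indefinite_integral gi that)
    then show ?thesis unfolding h_def by (intro set_integral_diff fi that)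
  qed
  \<comment> \<open>The mean of \<open>h\<close> over \<open>{u<..v}\<close> is the mean over \<open>{p<..q}\<close>.\<close>
  have key: "of_real (q - p) * (LINT y:{u<..v}|lebesgue. h y) = of_real (v - u) * (LINT y:{p<..q}|lebesgue. h y)"
    if b: "b \<in> S" and uv: "a < u" "u < v" "v < b" and pq: "a < p" "p < q" "q < b" for b u v p q
  proof -
    let ?I = "\<lambda>u v r. LINT y:{a<..<b}|lebesgue. of_real (trapezoid u v (1 / r) y) * h y"
    have lim: "(?I u v \<longlongrightarrow> (LINT y:{u<..v}|lebesgue. h y)) at_top" if "a < u" "u < v" "v < b" for u v
      by (rule integral_trapezoid_limit[OF hi[OF b]]) (use that in auto)
    have T: "set_integrable lebesgue {a<..<b} (\<lambda>y. of_real (trapezoid u v (1 / r) y) * h y)"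
      if "a < u" "u < v" "v < b" "r > 0" for u v r
      by (rule set_integrable_continuous_mult[OF hi[OF b], where B = 1])
         (use trapezoid_bounds[of u v "1 / r"] that in \<open>auto intro!: continuous_intros continuous_on_trapezoid\<close>)
    have ev: "\<forall>\<^sub>F r in at_top. of_real (q - p) * ?I u v r - of_real (v - u) * ?I p q r = 0"
    proof -
      have "\<forall>\<^sub>F r in at_top. 1 / (b - max v q) < (r::real)" by (rule eventually_gt_at_top)
      then show ?thesis using eventually_gt_at_top[of 0]
      proof eventually_elim
        case (elim r)
        define e where "e = 1 / r"
        have e: "e > 0" "max v q + e < b"
          using elim uv pq by (auto simp: e_def field_simps)
        define \<psi> where "\<psi> = (\<lambda>y. (q - p) * trapezoid u v e y - (v - u) * trapezoid p q e y)"
        obtain \<Phi>1 where P1: "\<And>x. (\<Phi>1 has_real_derivative trapezoid u v e x) (at x)"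
          using continuous_antiderivative[OF continuous_on_trapezoid] by blast
        obtain \<Phi>2 where P2: "\<And>x. (\<Phi>2 has_real_derivative trapezoid p q e x) (at x)"
          using continuous_antiderivative[OF continuous_on_trapezoid] by blast
        define \<Phi> where "\<Phi> = (\<lambda>y. (q - p) * \<Phi>1 y - (v - u) * \<Phi>2 y)"
        define m n where "m = min u p" and "n = max v q + e"
        have I1: "\<Phi>1 n - \<Phi>1 m = v - u" and I2: "\<Phi>2 n - \<Phi>2 m = q - p"
          using trapezoid_integral[OF _ e(1) _ _ P1, of m n] trapezoid_integral[OF _ e(1) _ _ P2, of m n] uv pq e(1)
          by (auto simp: m_def n_def)
        have "(LINT y:{a<..<b}|lebesgue. of_real (\<psi> y) * (f y - (LINT s:{a<..<y}|lebesgue. g s))) = 0"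
        proof (rule weak_derivative_orthogonal[OF weak fi[OF b] gi[OF b] subS[OF b]])
          show "continuous_on UNIV \<psi>" unfolding \<psi>_def by (intro continuous_intros continuous_on_trapezoid)
          show "\<psi> x = 0" if "x \<notin> {m..n}" for x
          proof -
            have "x \<le> u \<or> v + e \<le> x" "x \<le> p \<or> q + e \<le> x"
              using that by (auto simp: m_def n_def min_def max_def split: if_splits)
            then show ?thesis
              using uv pq e(1) trapezoid_outside[of u v e x] trapezoid_outside[of p q e x]
              by (simp add: \<psi>_def)
          qed
          show "(\<Phi> has_real_derivative \<psi> x) (at x)" for x
            unfolding \<Phi>_def \<psi>_def by (rule DERIV_diff; rule DERIV_cmult; rule P1 P2)
          have "\<Phi> n - \<Phi> m = (q - p) * (\<Phi>1 n - \<Phi>1 m) - (v - u) * (\<Phi>2 n - \<Phi>2 m)"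
            by (simp add: \<Phi>_def algebra_simps)
          then show "\<Phi> n = \<Phi> m" unfolding I1 I2 by simp
        qed (use uv pq e in \<open>auto simp: m_def n_def\<close>)
        then have 0: "(LINT y:{a<..<b}|lebesgue. of_real (\<psi> y) * h y) = 0" by (simp add: h_def F_def)
        have "of_real (q - p) * ?I u v r - of_real (v - u) * ?I p q r =
           (LINT y:{a<..<b}|lebesgue. of_real (q - p) * (of_real (trapezoid u v (1 / r) y) * h y)
              - of_real (v - u) * (of_real (trapezoid p q (1 / r) y) * h y))"
          using set_integrable_mult_right[OF T[OF uv elim(2)], of "of_real (q - p)"]
            set_integrable_mult_right[OF T[OF pq elim(2)], of "of_real (v - u)"]
          by (subst set_integral_diff) auto
        also have "\<dots> = (LINT y:{a<..<b}|lebesgue. of_real (\<psi> y) * h y)"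
          by (simp add: \<psi>_def e_def algebra_simps)
        finally show ?case using 0 by simp
      qed
    qed
    have "((\<lambda>r. of_real (q - p) * ?I u v r - of_real (v - u) * ?I p q r) \<longlongrightarrow>
       of_real (q - p) * (LINT y:{u<..v}|lebesgue. h y) - of_real (v - u) * (LINT y:{p<..q}|lebesgue. h y)) at_top"
      by (intro tendsto_intros lim uv pq)
    from tendsto_unique[OF _ this tendsto_eventually[OF ev]] show ?thesis by simp
  qed
  obtain b0 where b0: "b0 \<in> S" using ne by blast
  define p q where "p = (2 * a + b0) / 3" and "q = (a + 2 * b0) / 3"
  have pq: "a < p" "p < q" "q < b0" using S(2)[OF b0] by (auto simp: p_def q_def)
  define \<kappa> where "\<kappa> = (LINT y:{p<..q}|lebesgue. h y) / of_real (q - p)"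
  have larger: "\<exists>b\<in>S. v < b \<and> q < b" if v: "v \<in> S" for v
  proof -
    obtain e where "e > 0" "\<And>x. \<bar>x - v\<bar> < e \<Longrightarrow> x \<in> S"
      using S(1) v unfolding open_real_def by (metis dist_real_def open_dist S(1))
    then have "v + e / 2 \<in> S" "v < v + e / 2" by auto
    then show ?thesis
      using b0 pq(3) by (cases "v + e / 2 \<le> b0") (force, smt (verit))
  qed
  have const: "(LINT y:{u<..v}|lebesgue. h y) = of_real (v - u) * \<kappa>" if uv: "a < u" "u < v" "v \<in> S" for u v
  proof -
    obtain b where b: "b \<in> S" "v < b" "q < b" using larger[OF uv(3)] by blast
    have "of_real (q - p) * (LINT y:{u<..v}|lebesgue. h y) = of_real (v - u) * (LINT y:{p<..q}|lebesgue. h y)"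
      by (rule key[OF b(1) uv(1,2) b(2) pq(1,2) b(3)])
    moreover have "complex_of_real (q - p) \<noteq> 0" using pq by simp
    ultimately show ?thesis unfolding \<kappa>_def by (simp add: field_simps)
  qed
  have AE1: "AE y in lebesgue. u < y \<and> y \<le> v \<longrightarrow> h y = \<kappa>" if uv: "a < u" "u < v" "v \<in> S" for u v
  proof -
    obtain b where b: "b \<in> S" "v < b" "q < b" using larger[OF uv(3)] by blast
    define k where "k = (\<lambda>y. indicat_real {u<..v} y *\<^sub>R (h y - \<kappa>))"
    have hs: "set_integrable lebesgue {u<..x} h" if "x \<le> v" for x
      by (rule set_integrable_subset[OF hi[OF b(1)]]) (use uv b that in auto)
    have ci: "set_integrable lebesgue {u<..x} (\<lambda>y. \<kappa>)" for x
      unfolding set_integrable_def by (cases "u \<le> x") auto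
    have ki: "integrable lebesgue k"
      using set_integral_diff(1)[OF hs[OF order_refl] ci] by (simp add: k_def set_integrable_def)
    have z: "(LINT y:{u<..x}|lebesgue. h y - \<kappa>) = 0" if "u < x" "x \<le> v" for x
    proof -
      have "x \<in> S" using S(3)[OF uv(3)] uv that by auto
      moreover have "(LINT y:{u<..x}|lebesgue. \<kappa>) = of_real (x - u) * \<kappa>"
        unfolding set_lebesgue_integral_def using that by (simp add: scaleR_conv_of_real)
      ultimately show ?thesis
        using const[of u x] uv that by (subst set_integral_diff[OF hs ci]) auto
    qed
    have "AE y in lebesgue. k y = 0"
    proof (rule AE_zero_of_interval_integrals[OF ki])
      have "(LINT y|lebesgue. k y) = (LINT y:{u<..v}|lebesgue. h y - \<kappa>)"
        by (simp add: k_def set_lebesgue_integral_def)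
      then show "(LINT y|lebesgue. k y) = 0" using z[of v] uv by simp
      fix x
      have "(LINT y:{..x}|lebesgue. k y) = (LINT y:{u<..min x v}|lebesgue. h y - \<kappa>)"
        unfolding set_lebesgue_integral_def k_def
        by (rule Bochner_Integration.integral_cong) (auto simp: indicator_def)
      also have "\<dots> = 0"
      proof (cases "u < x")
        case True then show ?thesis using z[of "min x v"] uv by simp
      next
        case False then show ?thesis by (simp add: set_lebesgue_integral_def)
      qed
      finally show "(LINT y:{..x}|lebesgue. k y) = 0" .
    qed
    then show ?thesis by eventually_elim (auto simp: k_def)
  qed
  \<comment> \<open>Countably many pairs of end points cover the interval and cost only a null set.\<close>
  have "AE y in lebesgue. \<forall>u v :: rat. a < of_rat u \<and> of_rat u < (of_rat v :: real) \<and> of_rat v \<in> S \<longrightarrow>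
      of_rat u < y \<and> y \<le> of_rat v \<longrightarrow> h y = \<kappa>"
    unfolding AE_all_countable using AE1 by auto
  then have "AE y in lebesgue. y \<in> S \<longrightarrow> f y = \<kappa> + (LINT s:{a<..<y}|lebesgue. g s)"
  proof eventually_elim
    case (elim y)
    show ?case
    proof
      assume y: "y \<in> S"
      obtain b where b: "b \<in> S" "y < b" using larger[OF y] by blast
      obtain v :: rat where v: "y < of_rat v" "of_rat v < b" using of_rat_dense[OF b(2)] by blast
      obtain u :: rat where u: "a < of_rat u" "of_rat u < y" using of_rat_dense[OF S(2)[OF y]] by blast
      have "of_rat v \<in> S" using S(3)[OF b(1)] v S(2)[OF y] by auto
      then have "h y = \<kappa>" using elim u v by (meson less_imp_le less_trans)
      then show "f y = \<kappa> + (LINT s:{a<..<y}|lebesgue. g s)" by (simp add: h_def F_def algebra_simps)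
    qed
  qed
  then show thesis using that g2 by blast
qed

text \<open>
  Two representatives that differ on a null set cannot have different limits, because every right neighbourhood of
  \<open>a\<close> has positive measure.
\<close>

lemma right_value_eq:
  fixes f g :: "real \<Rightarrow> complex"
  assumes g: "set_integrable lebesgue {a<..<b} g" and ab: "a < b"
    and f: "AE y in lebesgue. a < y \<and> y < b \<longrightarrow> f y = c + (LINT s:{a<..<y}|lebesgue. g s)"
  shows "right_value f a = c"
proof -
  define F where "F = (\<lambda>y. LINT s:{a<..<y}|lebesgue. g s)"
  define h where "h = (\<lambda>y. if a < y \<and> y < b then c + F y else f y)"
  have hf: "AE y in lebesgue. h y = f y" using f by eventually_elim (simp add: h_def F_def)
  have "continuous_on {a..b} F" unfolding F_def by (rule continuous_on_indefinite_integral[OF g])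
  then have "(F \<longlongrightarrow> F a) (at a within {a..b})" using ab by (auto simp: continuous_on_def)
  then have "(F \<longlongrightarrow> 0) (at_right a)"
    using ab by (simp add: F_def set_lebesgue_integral_def at_within_Icc_at_right)
  then have "((\<lambda>y. c + F y) \<longlongrightarrow> c + 0) (at_right a)" by (intro tendsto_intros)
  moreover have "\<forall>\<^sub>F y in at_right a. c + F y = h y"
    unfolding eventually_at_right_field using ab by (auto simp: h_def)
  ultimately have hl: "(h \<longlongrightarrow> c) (at_right a)" by (simp add: Lim_transform_eventually)
  have uniq: "v = c" if h': "AE y in lebesgue. h' y = f y" and l': "(h' \<longlongrightarrow> v) (at_right a)" for v h'
  proof (rule ccontr)
    assume ne: "v \<noteq> c"
    have "((\<lambda>y. h' y - h y) \<longlongrightarrow> v - c) (at_right a)" by (intro tendsto_diff l' hl)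
    then have "\<forall>\<^sub>F y in at_right a. h' y - h y \<noteq> 0" using ne by (intro tendsto_imp_eventually_ne) auto
    then obtain d where d: "d > a" "\<And>y. a < y \<Longrightarrow> y < d \<Longrightarrow> h' y - h y \<noteq> 0"
      unfolding eventually_at_right_field by auto
    have "AE y in lebesgue. y \<notin> {a<..<d}"
      using hf h' by eventually_elim (use d in force)
    then have "{a<..<d} \<in> null_sets lebesgue" by (subst AE_iff_null_sets) auto
    then show False using d(1) by (auto simp: null_sets_def)
  qed
  show ?thesis
    unfolding right_value_def by (rule the_equality) (use hf hl uniq in blast)+
qed

section \<open>Kernels on the half line\<close>

text \<open>
  Integrating \<open>d e(z - d y, t, k)\<close> over \<open>y\<close> produces the weight \<open>1/(i k)\<close>. On the
  line of height \<open>1\<close> the Gaussian bound is uniform in bounded sets of \<open>y\<close>, which justifies Fubini.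
\<close>

lemma airy_kernel_integral:
  assumes t: "t > 0" and sb: "s \<le> b"
  shows airy_kernel_set_integrable: "set_integrable lebesgue {s<..<b} (\<lambda>y. d * airy_kernel (z - d * of_real y) t)"
    and airy_kernel_primitive: "(LINT y:{s<..<b}|lebesgue. d * airy_kernel (z - d * of_real y) t)
      = airy_primitive (z - d * of_real s) t - airy_primitive (z - d * of_real b) t"
proof -
  let ?k = "\<lambda>\<xi>. Complex \<xi> 1"
  define i where "i = (\<lambda>y::real. complex_of_real (indicat_real {s..b} y))"
  have i: "integrable lborel i" unfolding i_def by (rule integrable_of_real) (use sb in simp)
  define C where "C = norm z + norm d * (\<bar>s\<bar> + \<bar>b\<bar>)"
  \<comment> \<open>The two imaginary points supply \<open>exp (C \<xi>)\<close> and \<open>exp (- C \<xi>)\<close>, hence \<open>exp (C |\<xi>|)\<close> up to a factor.\<close>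
  define G where "G = (\<lambda>\<xi>. exp C * (norm (airy_phase (Complex 0 C) t (?k \<xi>)) + norm (airy_phase (Complex 0 (- C)) t (?k \<xi>))))"
  have G: "integrable lborel G"
    unfolding G_def using t by (intro integrable_mult_right Bochner_Integration.integrable_add integrable_norm_airy_phase) auto
  have T: "integrable (lborel \<Otimes>\<^sub>M lborel) (\<lambda>(\<xi>, y). complex_of_real (G \<xi>) * i y)"
    by (rule lborel_pair.integrable_tensor[OF integrable_of_real[OF G] i])
  define h where "h = (\<lambda>\<xi> y. d * airy_phase (z - d * of_real y) t (?k \<xi>) * i y)"
  have "continuous_on UNIV (\<lambda>p. d * airy_phase (z - d * of_real (snd p)) t (?k (fst p)))"
    by (auto simp: Complex_eq intro!: continuous_intros)
  then have "(\<lambda>p::real \<times> real. d * airy_phase (z - d * of_real (snd p)) t (?k (fst p))) \<in> borel_measurable borel"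
    by (rule borel_measurable_continuous_onI)
  then have m: "(\<lambda>p::real \<times> real. d * airy_phase (z - d * of_real (snd p)) t (?k (fst p))) \<in> borel_measurable (lborel \<Otimes>\<^sub>M lborel)"
    by (simp add: lborel_prod)
  have im: "i \<in> borel_measurable lborel" using i by auto
  have H: "integrable (lborel \<Otimes>\<^sub>M lborel) (case_prod h)"
  proof (rule Bochner_Integration.integrable_bound)
    show "integrable (lborel \<Otimes>\<^sub>M lborel) (\<lambda>p. d * (case p of (\<xi>, y) \<Rightarrow> complex_of_real (G \<xi>) * i y))"
      using T by (rule integrable_mult_right)
    show "case_prod h \<in> borel_measurable (lborel \<Otimes>\<^sub>M lborel)"
      unfolding h_def case_prod_unfold
      by (intro borel_measurable_times[OF m] measurable_compose[OF measurable_snd im])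
    have "norm (h \<xi> y) \<le> norm (d * (complex_of_real (G \<xi>) * i y))" for \<xi> y
    proof (cases "y \<in> {s..b}")
      case True
      let ?z = "z - d * of_real y"
      have "norm ?z \<le> norm z + norm d * \<bar>y\<bar>"
        using norm_triangle_ineq4[of z "d * of_real y"] by (simp add: norm_mult)
      also have "\<dots> \<le> C" unfolding C_def using True by (intro add_left_mono mult_left_mono) auto
      finally have zC: "norm ?z \<le> C" .
      then have C: "\<bar>Im ?z\<bar> \<le> C" "\<bar>Re ?z\<bar> \<le> C"
        using abs_Im_le_cmod[of ?z] abs_Re_le_cmod[of ?z] by auto
      have "norm (airy_phase ?z t (?k \<xi>)) \<le> exp (C + (\<bar>\<xi>\<bar> * C + t * (1 ^ 3 - 3 * \<xi>\<^sup>2 * 1)))"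
      proof -
        have "- \<xi> * Im ?z \<le> \<bar>\<xi>\<bar> * C"
          using abs_ge_self[of "- \<xi> * Im ?z"] mult_left_mono[OF C(1), of "\<bar>\<xi>\<bar>"] by (simp add: abs_mult)
        then show ?thesis unfolding norm_airy_phase using C(2) by auto
      qed
      also have "\<dots> \<le> G \<xi>"
        unfolding G_def norm_airy_phase exp_add[of C]
        by (cases "\<xi> \<ge> 0") (simp_all add: mult_le_cancel_left_pos)
      finally have "norm (airy_phase ?z t (?k \<xi>)) \<le> G \<xi>" .
      moreover have "G \<xi> \<ge> 0" by (simp add: G_def)
      ultimately show ?thesis using True by (simp add: h_def i_def norm_mult mult_left_mono)
    qed (simp add: h_def i_def)
    then show "AE p in lborel \<Otimes>\<^sub>M lborel. norm (case_prod h p) \<le> norm (d * (case p of (\<xi>, y) \<Rightarrow> complex_of_real (G \<xi>) * i y))"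
      by auto
  qed
  have in1: "(LINT \<xi>|lborel. h \<xi> y) = indicat_real {s..b} y *\<^sub>R (2 * of_real pi * (d * airy_kernel (z - d * of_real y) t))" for y
  proof -
    have "(LINT \<xi>|lborel. h \<xi> y) = (LINT \<xi>|lborel. (d * i y) * (airy_phase (z - d * of_real y) t (?k \<xi>) * 1))"
      by (simp add: h_def mult_ac)
    also have "\<dots> = (d * i y) * line_integral (\<lambda>k. 1) 1 (z - d * of_real y) t"
      unfolding line_integral_def by (rule integral_mult_right_zero)
    finally show ?thesis by (auto simp: airy_kernel_def i_def indicator_def)
  qed
  have in2: "(LINT y|lborel. h \<xi> y) = airy_phase (z - d * of_real s) t (?k \<xi>) * (1 / (\<i> * ?k \<xi>))
      - airy_phase (z - d * of_real b) t (?k \<xi>) * (1 / (\<i> * ?k \<xi>))" for \<xi>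
  proof -
    let ?A = "\<lambda>y. - (airy_phase (z - d * of_real y) t (?k \<xi>) * (1 / (\<i> * ?k \<xi>)))"
    have k0: "?k \<xi> \<noteq> 0" by (simp add: complex_eq_iff)
    have "(LINT y|lborel. h \<xi> y) = (LINT y|lborel. indicat_real {s..b} y *\<^sub>R (d * airy_phase (z - d * of_real y) t (?k \<xi>)))"
      by (intro Bochner_Integration.integral_cong) (auto simp: h_def i_def scaleR_conv_of_real)
    also have "\<dots> = ?A b - ?A s"
    proof (rule integral_FTC_atLeastAtMost[OF sb])
      show "continuous_on {s..b} (\<lambda>y. d * airy_phase (z - d * of_real y) t (?k \<xi>))"
        by (intro continuous_intros)
      fix y
      have "((\<lambda>w. - (airy_phase (z - d * w) t (?k \<xi>) * (1 / (\<i> * ?k \<xi>)))) has_field_derivative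
          d * airy_phase (z - d * of_real y) t (?k \<xi>)) (at (of_real y))"
        unfolding airy_phase_def using k0 by (auto intro!: derivative_eq_intros)
      then show "(?A has_vector_derivative d * airy_phase (z - d * of_real y) t (?k \<xi>)) (at y within {s..b})"
        by (rule has_vector_derivative_at_within[OF has_vector_derivative_real_field])
    qed
    finally show ?thesis by simp
  qed
  have si: "set_integrable lborel {s..b} (\<lambda>y. 2 * of_real pi * (d * airy_kernel (z - d * of_real y) t))"
    using lborel_pair.integrable_snd[OF H] unfolding in1 set_integrable_def .
  then have "set_integrable lborel {s..b} (\<lambda>y. 1 / (2 * of_real pi) * (2 * of_real pi * (d * airy_kernel (z - d * of_real y) t)))"
    by (intro set_integrable_mult_right) auto
  then have si': "set_integrable lborel {s..b} (\<lambda>y. d * airy_kernel (z - d * of_real y) t)" by simp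
  then have si'': "set_integrable lborel {s<..<b} (\<lambda>y. d * airy_kernel (z - d * of_real y) t)"
    by (rule set_integrable_subset) auto
  then show "set_integrable lebesgue {s<..<b} (\<lambda>y. d * airy_kernel (z - d * of_real y) t)"
    unfolding set_integrable_def by (subst integrable_completion) auto
  have "(LINT y:{s<..<b}|lebesgue. d * airy_kernel (z - d * of_real y) t) = (LINT y:{s<..<b}|lborel. d * airy_kernel (z - d * of_real y) t)"
    unfolding set_lebesgue_integral_def by (rule integral_completion) (use si'' in \<open>auto simp: set_integrable_def\<close>)
  also have "\<dots> = (LINT y:{s..b}|lborel. d * airy_kernel (z - d * of_real y) t)"
    unfolding set_borel_integral_eq_integral(2)[OF si''] set_borel_integral_eq_integral(2)[OF si']
    by (rule integral_open_interval_real[symmetric])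
  also have "\<dots> = 1 / (2 * of_real pi) * (LINT y:{s..b}|lborel. 2 * of_real pi * (d * airy_kernel (z - d * of_real y) t))"
    by (subst set_integral_mult_right) auto
  also have "(LINT y:{s..b}|lborel. 2 * of_real pi * (d * airy_kernel (z - d * of_real y) t)) = (LINT y|lborel. LINT \<xi>|lborel. h \<xi> y)"
    unfolding in1 set_lebesgue_integral_def ..
  also have "\<dots> = (LINT \<xi>|lborel. LINT y|lborel. h \<xi> y)" by (rule lborel_pair.Fubini_integral[OF H])
  also have "\<dots> = line_integral (\<lambda>k. 1 / (\<i> * k)) 1 (z - d * of_real s) t - line_integral (\<lambda>k. 1 / (\<i> * k)) 1 (z - d * of_real b) t"
    unfolding in2 line_integral_def
    by (rule Bochner_Integration.integral_diff; rule integrable_horizontal[OF upper_weight_inverse t]; simp)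
  finally show "(LINT y:{s<..<b}|lebesgue. d * airy_kernel (z - d * of_real y) t)
      = airy_primitive (z - d * of_real s) t - airy_primitive (z - d * of_real b) t"
    by (simp add: airy_primitive_def algebra_simps)
qed

lemma phase_half_line_transform:
  "phase x t k * half_line_transform q0 (\<beta> * k) =
     (LINT y:{0<..}|lebesgue. airy_phase (of_real x - \<beta> * of_real y) t k * q0 y)"
proof -
  have "phase x t k * half_line_transform q0 (\<beta> * k) =
     (LINT y:{0<..}|lebesgue. phase x t k * (exp (- \<i> * (\<beta> * k) * of_real y) * q0 y))"
    unfolding half_line_transform_def by (rule set_integral_mult_right[symmetric])
  moreover have "phase x t k * exp (- \<i> * (\<beta> * k) * of_real y) = airy_phase (of_real x - \<beta> * of_real y) t k" for y
    unfolding phase_eq_airy_phase airy_phase_def exp_add[symmetric] by (simp add: algebra_simps)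
  ultimately show ?thesis by (simp add: mult.assoc[symmetric])
qed

text \<open>
  The limit cannot be taken before the integration over \<open>y\<close> is pulled outside, because the transform of the
  datum need not be integrable.
\<close>

lemma real_line_term:
  assumes q0: "set_integrable lebesgue {0<..} q0" and t: "t > 0"
  shows "set_integrable lebesgue {0<..} (\<lambda>y. line_integral (\<lambda>k. 1) 1 (of_real x - of_real y) t * q0 y)"
    and "((\<lambda>r. contour_integral (real_line r) (\<lambda>k. phase x t k * half_line_transform q0 k)) \<longlongrightarrow>
      (LINT y:{0<..}|lebesgue. line_integral (\<lambda>k. 1) 1 (of_real x - of_real y) t * q0 y)) at_top"
proof -
  let ?e = "\<lambda>k y. airy_phase (of_real x - of_real y) t k"
  let ?c = "\<lambda>r y. contour_integral (real_line r) (\<lambda>k. ?e k y)"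
  have bound: "norm (?e k y) \<le> 1" if "k \<in> closed_segment (- of_real r) (of_real r)" for k y r
  proof -
    have "- complex_of_real r = Complex (- r) 0" "complex_of_real r = Complex r 0"
      by (simp_all add: complex_eq_iff)
    then have "k \<in> closed_segment (Complex (- r) 0) (Complex r 0)" using that by metis
    then have "k = Complex (Re k) 0" by (simp add: closed_segment_same_Im complex_eq_iff)
    then obtain \<xi> where "k = Complex \<xi> 0" by blast
    then show ?thesis by (simp add: norm_airy_phase)
  qed
  have c: "continuous_on UNIV (\<lambda>p. ?e (fst p) (snd p))" by (intro continuous_intros)
  have si: "set_integrable lebesgue {0<..} (\<lambda>y. ?c r y * q0 y)" for r
    unfolding real_line_def by (rule linepath_fubini(2)[OF q0 c bound])
  have lim: "((\<lambda>r. ?c r y) \<longlongrightarrow> line_integral (\<lambda>k. 1) 1 (of_real x - of_real y) t) at_top" for y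
    using real_line_limit[OF t, of "x - y"] by simp
  have bd: "norm (?c r y) \<le> 2 * ((1 + 1 / (6 * t)) * pi + 1) + 2" if "r \<ge> 1" for r y
    using real_line_bound[OF t that, of "x - y"] by simp
  show "set_integrable lebesgue {0<..} (\<lambda>y. line_integral (\<lambda>k. 1) 1 (of_real x - of_real y) t * q0 y)"
    by (rule dominated_kernel_integrable[OF q0 si bd lim])
  have "((\<lambda>r. LINT y:{0<..}|lebesgue. ?c r y * q0 y) \<longlongrightarrow>
      (LINT y:{0<..}|lebesgue. line_integral (\<lambda>k. 1) 1 (of_real x - of_real y) t * q0 y)) at_top"
    by (rule dominated_kernel_tendsto[OF q0 si bd lim])
  moreover have "contour_integral (real_line r) (\<lambda>k. phase x t k * half_line_transform q0 k)
     = (LINT y:{0<..}|lebesgue. ?c r y * q0 y)" for r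
  proof -
    have "(\<lambda>k. phase x t k * half_line_transform q0 k) = (\<lambda>k. LINT y:{0<..}|lebesgue. ?e k y * q0 y)"
      using phase_half_line_transform[of x t _ q0 1] by (simp add: fun_eq_iff)
    then show ?thesis
      unfolding real_line_def
      using contour_integral_unique[OF has_contour_integral_parameter[OF q0 c bound]] by simp
  qed
  ultimately show "((\<lambda>r. contour_integral (real_line r) (\<lambda>k. phase x t k * half_line_transform q0 k)) \<longlongrightarrow>
      (LINT y:{0<..}|lebesgue. line_integral (\<lambda>k. 1) 1 (of_real x - of_real y) t * q0 y)) at_top"
    by simp
qed

text \<open>
  Exponential decay along the ray makes the bound independent of the length of the segment when \<open>\<delta>\<close> is
  proportional to it.
\<close>

lemma ray_integral_bound:
  assumes f: "f contour_integrable_on linepath 0 v" and \<delta>: "\<delta> > 0"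
    and bound: "\<And>s. 0 \<le> s \<Longrightarrow> s \<le> 1 \<Longrightarrow> norm (f (of_real s * v)) \<le> B * exp (- \<delta> * s)"
  shows "norm (contour_integral (linepath 0 v) f) \<le> B * norm v / \<delta>"
proof -
  have B: "B \<ge> 0" using bound[of 0] by (simp add: order_trans[OF norm_ge_zero])
  have I: "((\<lambda>s. B * norm v * exp (- \<delta> * s)) has_integral
      (- (B * norm v / \<delta>) * exp (- \<delta> * 1) - - (B * norm v / \<delta>) * exp (- \<delta> * 0))) {0..1}"
  proof (rule fundamental_theorem_of_calculus)
    fix s
    have "((\<lambda>s. - (B * norm v / \<delta>) * exp (- \<delta> * s)) has_real_derivative B * norm v * exp (- \<delta> * s)) (at s within {0..1})"
      using \<delta> by (auto intro!: derivative_eq_intros)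
    then show "((\<lambda>s. - (B * norm v / \<delta>) * exp (- \<delta> * s)) has_vector_derivative B * norm v * exp (- \<delta> * s)) (at s within {0..1})"
      by (simp only: has_real_derivative_iff_has_vector_derivative)
  qed simp
  have lp: "linepath 0 v s = of_real s * v" for s by (simp add: linepath_def scaleR_conv_of_real)
  have "norm (integral {0..1} (\<lambda>s. f (linepath 0 v s) * (v - 0))) \<le> integral {0..1} (\<lambda>s. B * norm v * exp (- \<delta> * s))"
  proof (rule Henstock_Kurzweil_Integration.integral_norm_bound_integral)
    show "(\<lambda>s. f (linepath 0 v s) * (v - 0)) integrable_on {0..1}"
      using f unfolding contour_integrable_on_def has_contour_integral_linepath by (auto simp: integrable_on_def)
    show "(\<lambda>s. B * norm v * exp (- \<delta> * s)) integrable_on {0..1}" using I by (auto simp: integrable_on_def)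
    show "norm (f (linepath 0 v s) * (v - 0)) \<le> B * norm v * exp (- \<delta> * s)" if "s \<in> {0..1}" for s
    proof -
      have "norm (f (linepath 0 v s)) \<le> B * exp (- \<delta> * s)" unfolding lp using bound that by simp
      from mult_right_mono[OF this norm_ge_zero[of v]] show ?thesis by (simp add: norm_mult mult_ac)
    qed
  qed
  also have "\<dots> \<le> B * norm v / \<delta>" unfolding integral_unique[OF I] using B \<delta> by simp
  finally show ?thesis by (simp only: contour_integral_linepath_eq)
qed

text \<open>
  On the rays \<open>i k^3\<close> is imaginary, and the growth of \<open>exp (- i \<alpha> k y)\<close> is compensated by the
  condition on \<open>z\<close>, leaving the decay of \<open>exp (i k x)\<close>.
\<close>

lemma norm_airy_phase_ray:
  assumes "\<rho> \<ge> 0" "Re z = x + \<bar>Im z\<bar> / sqrt 3" and k: "k = of_real \<rho> * cis (2 * pi / 3) \<or> k = of_real \<rho> * cis (pi / 3)"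
  shows "norm (airy_phase z t k) \<le> exp (- (sqrt 3 / 2 * x) * \<rho>)"
proof -
  obtain \<xi> where xi: "k = Complex \<xi> (sqrt 3 / 2 * \<rho>)" "\<bar>\<xi>\<bar> = \<rho> / 2"
    using k assms(1) unfolding ray_points by fastforce
  have xi2: "\<xi>\<^sup>2 = (\<rho> / 2)\<^sup>2" using xi(2) by (metis power2_abs)
  have cub: "(sqrt 3 / 2 * \<rho>) ^ 3 - 3 * \<xi>\<^sup>2 * (sqrt 3 / 2 * \<rho>) = 0"
  proof -
    have "(sqrt 3 / 2 * \<rho>) ^ 3 = (sqrt 3 * sqrt 3) * (\<rho> / 2)\<^sup>2 * (sqrt 3 / 2 * \<rho>)"
      by (simp add: power3_eq_cube power2_eq_square)
    then show ?thesis by (simp add: xi2)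
  qed
  have 1: "- \<xi> * Im z \<le> \<rho> / 2 * \<bar>Im z\<bar>" using abs_ge_self[of "- \<xi> * Im z"] xi(2) by (simp add: abs_mult)
  have 2: "sqrt 3 / 2 * \<rho> * Re z = sqrt 3 / 2 * x * \<rho> + \<rho> / 2 * \<bar>Im z\<bar>"
    unfolding assms(2) by (simp add: algebra_simps)
  have "- \<xi> * Im z - sqrt 3 / 2 * \<rho> * Re z + t * ((sqrt 3 / 2 * \<rho>) ^ 3 - 3 * \<xi>\<^sup>2 * (sqrt 3 / 2 * \<rho>))
     \<le> - (sqrt 3 / 2 * x) * \<rho>" unfolding cub 2 mult_minus_left mult_zero_right add_0_right using 1 by linarith
  then show ?thesis unfolding xi(1) norm_airy_phase by simp
qed

lemma bdry_D_fubini: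
  fixes f :: "real \<Rightarrow> complex" and e :: "complex \<Rightarrow> real \<Rightarrow> complex"
  assumes f: "set_integrable lebesgue S f" and cont: "continuous_on UNIV (\<lambda>p. e (fst p) (snd p))"
    and c: "c > 0"
    and bound: "\<And>\<rho> k y. y \<in> S \<Longrightarrow> \<rho> \<ge> 0 \<Longrightarrow> k = of_real \<rho> * cis (2 * pi / 3) \<or> k = of_real \<rho> * cis (pi / 3) \<Longrightarrow>
       norm (e k y) \<le> B * exp (- c * \<rho>)"
    and r: "r > 0"
  shows bdry_D_has_contour_integral: "((\<lambda>k. LINT y:S|lebesgue. e k y * f y) has_contour_integral
      (LINT y:S|lebesgue. contour_integral (bdry_D r) (\<lambda>k. e k y) * f y)) (bdry_D r)"
    and bdry_D_set_integrable: "set_integrable lebesgue S (\<lambda>y. contour_integral (bdry_D r) (\<lambda>k. e k y) * f y)"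
    and bdry_D_bound: "\<And>y. y \<in> S \<Longrightarrow> norm (contour_integral (bdry_D r) (\<lambda>k. e k y)) \<le> 2 * B / c"
proof -
  let ?v = "of_real r * cis (2 * pi / 3)" and ?w = "of_real r * cis (pi / 3)"
  have ray: "norm (e (of_real s * u) y) \<le> B * exp (- (c * r) * s)"
    if "y \<in> S" "0 \<le> s" "u = ?v \<or> u = ?w" for s u y
    using bound[OF that(1), of "s * r" "of_real s * u"] that r by (auto simp: mult_ac)
  have seg: "norm (e k y) \<le> B" if y: "y \<in> S" and u: "u = ?v \<or> u = ?w" and k: "k \<in> closed_segment 0 u" for k u y
  proof -
    obtain s where s: "0 \<le> s" "s \<le> 1" "k = of_real s * u"
      using k by (auto simp: closed_segment_def scaleR_conv_of_real)
    have B: "B \<ge> 0" using ray[OF y order_refl u] by (simp add: order_trans[OF norm_ge_zero])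
    have "norm (e k y) \<le> B * exp (- (c * r) * s)" unfolding s(3) by (rule ray[OF y s(1) u])
    also have "\<dots> \<le> B * 1" using B c r s(1) by (intro mult_left_mono) auto
    finally show ?thesis by simp
  qed
  have ec: "continuous_on A (\<lambda>k. e k y)" for A y
    using continuous_on_compose2[OF cont continuous_on_Pair[OF continuous_on_id continuous_on_const]] by simp
  have ci: "(\<lambda>k. e k y) contour_integrable_on linepath a b" for a b y
    by (rule contour_integrable_continuous_linepath[OF ec])
  have joined: "contour_integral (bdry_D r) (\<lambda>k. e k y) =
     contour_integral (linepath ?v 0) (\<lambda>k. e k y) + contour_integral (linepath 0 ?w) (\<lambda>k. e k y)" for y
    unfolding bdry_D_def by (rule contour_integral_join) (auto intro: ci)
  have seg': "norm (e k y) \<le> B" if "k \<in> closed_segment ?v 0" "y \<in> S" for k y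
    using seg[OF that(2) disjI1[OF refl]] that(1) by (simp add: closed_segment_commute)
  have seg'': "norm (e k y) \<le> B" if "k \<in> closed_segment 0 ?w" "y \<in> S" for k y
    using seg[OF that(2) disjI2[OF refl]] that(1) by simp
  note F1 = linepath_fubini[OF f cont seg'] and F2 = linepath_fubini[OF f cont seg'']
  show "set_integrable lebesgue S (\<lambda>y. contour_integral (bdry_D r) (\<lambda>k. e k y) * f y)"
    unfolding joined distrib_right by (rule set_integral_add(1)[OF F1(2) F2(2)])
  have "(LINT y:S|lebesgue. contour_integral (bdry_D r) (\<lambda>k. e k y) * f y) =
     (LINT y:S|lebesgue. contour_integral (linepath ?v 0) (\<lambda>k. e k y) * f y)
     + (LINT y:S|lebesgue. contour_integral (linepath 0 ?w) (\<lambda>k. e k y) * f y)"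
    unfolding joined distrib_right by (rule set_integral_add(2)[OF F1(2) F2(2)])
  then show "((\<lambda>k. LINT y:S|lebesgue. e k y * f y) has_contour_integral
      (LINT y:S|lebesgue. contour_integral (bdry_D r) (\<lambda>k. e k y) * f y)) (bdry_D r)"
    unfolding bdry_D_def using has_contour_integral_join[OF F1(1) F2(1)] by simp
  fix y assume y: "y \<in> S"
  have nr: "norm ?v = r" "norm ?w = r" using r by (simp_all add: norm_mult)
  have "norm (contour_integral (linepath 0 ?v) (\<lambda>k. e k y)) \<le> B * norm ?v / (c * r)"
    by (rule ray_integral_bound[OF ci]) (use c r ray[OF y] in auto)
  moreover have "norm (contour_integral (linepath 0 ?w) (\<lambda>k. e k y)) \<le> B * norm ?w / (c * r)"
    by (rule ray_integral_bound[OF ci]) (use c r ray[OF y] in auto)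
  moreover have "contour_integral (linepath ?v 0) (\<lambda>k. e k y) = - contour_integral (linepath 0 ?v) (\<lambda>k. e k y)"
    using contour_integral_reverse_linepath[OF ec, of 0 ?v] by simp
  ultimately show "norm (contour_integral (bdry_D r) (\<lambda>k. e k y)) \<le> 2 * B / c"
    unfolding joined using norm_triangle_ineq[of "contour_integral (linepath ?v 0) (\<lambda>k. e k y)" "contour_integral (linepath 0 ?w) (\<lambda>k. e k y)"] r c nr
    by simp
qed

text \<open>
  For \<open>\<beta>\<close> one of \<open>\<alpha>\<close>, \<open>\<alpha>^2\<close> the point \<open>x - \<beta> y\<close> satisfies the sector
  condition with margin \<open>x\<close>, which gives both absolute convergence on the rays and the limit kernel.
\<close>

lemma ray_term:
  assumes q0: "set_integrable lebesgue {0<..} q0" and t: "t > 0" and x: "x > 0"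
    and \<beta>: "Re \<beta> = - 1 / 2" "\<bar>Im \<beta>\<bar> = sqrt 3 / 2"
  shows "set_integrable lebesgue {0<..} (\<lambda>y. line_integral (\<lambda>k. 1) 1 (of_real x - \<beta> * of_real y) t * q0 y)"
    and "((\<lambda>r. contour_integral (bdry_D r) (\<lambda>k. phase x t k * half_line_transform q0 (\<beta> * k))) \<longlongrightarrow>
      (LINT y:{0<..}|lebesgue. line_integral (\<lambda>k. 1) 1 (of_real x - \<beta> * of_real y) t * q0 y)) at_top"
    and "r > 0 \<Longrightarrow> (\<lambda>k. phase x t k * half_line_transform q0 (\<beta> * k)) contour_integrable_on bdry_D r"
proof -
  let ?z = "\<lambda>y. of_real x - \<beta> * of_real y :: complex"
  let ?e = "\<lambda>k y. airy_phase (?z y) t k"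
  let ?c = "\<lambda>r y. contour_integral (bdry_D r) (\<lambda>k. ?e k y)"
  have z: "Re (?z y) = x + \<bar>Im (?z y)\<bar> / sqrt 3" if "y \<in> {0<..}" for y
  proof -
    have 1: "\<bar>Im (?z y)\<bar> = sqrt 3 / 2 * y" using that \<beta>(2) by (simp add: abs_mult)
    have 2: "Re (?z y) = x + y / 2" using \<beta>(1) by simp
    show ?thesis unfolding 1 2 by simp
  qed
  have cont: "continuous_on UNIV (\<lambda>p. ?e (fst p) (snd p))" by (intro continuous_intros)
  have c: "sqrt 3 / 2 * x > 0" using x by simp
  have bound: "norm (?e k y) \<le> 1 * exp (- (sqrt 3 / 2 * x) * \<rho>)"
    if "y \<in> {0<..}" "\<rho> \<ge> 0" "k = of_real \<rho> * cis (2 * pi / 3) \<or> k = of_real \<rho> * cis (pi / 3)" for y k \<rho>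
    using norm_airy_phase_ray[OF that(2) z[OF that(1)] that(3)] by simp
  note fub = bdry_D_fubini[OF q0 cont c bound]
  have hci: "((\<lambda>k. LINT y:{0<..}|lebesgue. ?e k y * q0 y) has_contour_integral
      (LINT y:{0<..}|lebesgue. ?c r y * q0 y)) (bdry_D r)" if "r > 0" for r
    by (rule bdry_D_has_contour_integral[OF q0 cont c _ that]) (rule bound)
  have eq: "(\<lambda>k. phase x t k * half_line_transform q0 (\<beta> * k)) = (\<lambda>k. LINT y:{0<..}|lebesgue. ?e k y * q0 y)"
    using phase_half_line_transform[of x t _ q0 \<beta>] by (simp add: fun_eq_iff)
  have lim: "((\<lambda>r. ?c r y) \<longlongrightarrow> line_integral (\<lambda>k. 1) 1 (?z y) t) at_top" if "y \<in> {0<..}" for y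
    by (rule bdry_D_limit[OF t x z[OF that]])
  have si: "set_integrable lebesgue {0<..} (\<lambda>y. ?c r y * q0 y)" if "r \<ge> 1" for r
    by (rule fub(2)) (use that in auto)
  have bd: "norm (?c r y) \<le> 2 * 1 / (sqrt 3 / 2 * x)" if "r \<ge> 1" "y \<in> {0<..}" for r y
    by (rule fub(3)) (use that in auto)
  show "set_integrable lebesgue {0<..} (\<lambda>y. line_integral (\<lambda>k. 1) 1 (?z y) t * q0 y)"
    by (rule dominated_kernel_integrable[OF q0 si bd lim])
  have L: "((\<lambda>r. LINT y:{0<..}|lebesgue. ?c r y * q0 y) \<longlongrightarrow>
      (LINT y:{0<..}|lebesgue. line_integral (\<lambda>k. 1) 1 (?z y) t * q0 y)) at_top"
    by (rule dominated_kernel_tendsto[OF q0 si bd lim])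
  have ev: "\<forall>\<^sub>F r in at_top. (LINT y:{0<..}|lebesgue. ?c r y * q0 y) =
      contour_integral (bdry_D r) (\<lambda>k. phase x t k * half_line_transform q0 (\<beta> * k))"
    using eventually_gt_at_top[of 0] unfolding eq
    by eventually_elim (rule contour_integral_unique[symmetric, OF hci])
  show "((\<lambda>r. contour_integral (bdry_D r) (\<lambda>k. phase x t k * half_line_transform q0 (\<beta> * k))) \<longlongrightarrow>
      (LINT y:{0<..}|lebesgue. line_integral (\<lambda>k. 1) 1 (?z y) t * q0 y)) at_top"
    by (rule Lim_transform_eventually[OF L ev])
  show "(\<lambda>k. phase x t k * half_line_transform q0 (\<beta> * k)) contour_integrable_on bdry_D r" if "r > 0"
    unfolding eq contour_integrable_on_def using hci[OF that] by blast
qed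

section \<open>Size of the half-line primitive\<close>

text \<open>
  The solution kernel of the problem on the half line with vanishing boundary datum; the two complex points are the
  reflections that cancel the boundary values.
\<close>

definition half_line_kernel :: "real \<Rightarrow> real \<Rightarrow> real \<Rightarrow> complex" where
  "half_line_kernel x t y = airy_kernel (of_real x - of_real y) t
     + \<alpha> * airy_kernel (of_real x - \<alpha> * of_real y) t + \<alpha>\<^sup>2 * airy_kernel (of_real x - \<alpha>\<^sup>2 * of_real y) t"

text \<open>
  The constant \<open>1\<close> makes the function vanish as \<open>a\<close> tends to infinity.
\<close>

definition half_line_primitive :: "real \<Rightarrow> real \<Rightarrow> real \<Rightarrow> complex" where
  "half_line_primitive x t a = 1 + airy_primitive (of_real x - of_real a) t
     + airy_primitive (of_real x - \<alpha> * of_real a) t + airy_primitive (of_real x - \<alpha>\<^sup>2 * of_real a) t"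

lemma half_line_kernel_integral:
  assumes t: "t > 0" and sb: "s \<le> b"
  shows "set_integrable lebesgue {s<..<b} (half_line_kernel x t)"
    and "(LINT y:{s<..<b}|lebesgue. half_line_kernel x t y) = half_line_primitive x t s - half_line_primitive x t b"
proof -
  note I = airy_kernel_set_integrable[OF t sb] and P = airy_kernel_primitive[OF t sb]
  have I1: "set_integrable lebesgue {s<..<b} (\<lambda>y. airy_kernel (of_real x - of_real y) t)"
    using I[of 1 "of_real x"] by simp
  have P1: "(LINT y:{s<..<b}|lebesgue. airy_kernel (of_real x - of_real y) t) =
     airy_primitive (of_real x - of_real s) t - airy_primitive (of_real x - of_real b) t"
    using P[of 1 "of_real x"] by simp
  note A = set_integral_add[OF I1 I[of \<alpha> "of_real x"]]
  note B = set_integral_add[OF A(1) I[of "\<alpha>\<^sup>2" "of_real x"]]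
  show "set_integrable lebesgue {s<..<b} (half_line_kernel x t)"
    using B(1) by (simp add: half_line_kernel_def[abs_def])
  have "(LINT y:{s<..<b}|lebesgue. half_line_kernel x t y) =
    (airy_primitive (of_real x - of_real s) t - airy_primitive (of_real x - of_real b) t)
    + (airy_primitive (of_real x - \<alpha> * of_real s) t - airy_primitive (of_real x - \<alpha> * of_real b) t)
    + (airy_primitive (of_real x - \<alpha>\<^sup>2 * of_real s) t - airy_primitive (of_real x - \<alpha>\<^sup>2 * of_real b) t)"
    unfolding half_line_kernel_def B(2) A(2) P1 P ..
  then show "(LINT y:{s<..<b}|lebesgue. half_line_kernel x t y) = half_line_primitive x t s - half_line_primitive x t b"
    by (simp add: half_line_primitive_def)
qed

lemma half_line_primitive_0: "half_line_primitive x t 0 = 1 + 3 * airy_primitive (of_real x) t"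
  by (simp add: half_line_primitive_def)

lemma sector_points:
  "Re (of_real x - \<alpha> * of_real a) = x + a / 2" "\<bar>Im (of_real x - \<alpha> * of_real a)\<bar> = sqrt 3 / 2 * \<bar>a\<bar>"
  "Re (of_real x - \<alpha>\<^sup>2 * of_real a) = x + a / 2" "\<bar>Im (of_real x - \<alpha>\<^sup>2 * of_real a)\<bar> = sqrt 3 / 2 * \<bar>a\<bar>"
proof -
  show "Re (of_real x - \<alpha> * of_real a) = x + a / 2" "\<bar>Im (of_real x - \<alpha> * of_real a)\<bar> = sqrt 3 / 2 * \<bar>a\<bar>"
    unfolding alpha_eq(1) by (simp_all add: abs_mult)
  show "Re (of_real x - \<alpha>\<^sup>2 * of_real a) = x + a / 2" "\<bar>Im (of_real x - \<alpha>\<^sup>2 * of_real a)\<bar> = sqrt 3 / 2 * \<bar>a\<bar>"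
    unfolding alpha_eq(2) by (simp_all add: abs_mult)
qed

lemma airy_primitive_sector_decay:
  assumes t: "t > 0" and r: "\<rho> > 0" "\<rho> / 2 \<le> Re z" "\<bar>Im z\<bar> \<le> sqrt 3 * Re z"
  shows "norm (airy_primitive z t) \<le> 2 * (t powr (1/4) * \<rho> powr (-3/4))"
proof -
  have "norm (airy_primitive z t) \<le> t powr (1/4) * Re z powr (-3/4)"
    by (rule norm_airy_primitive_le[OF t]) (use r in auto)
  also have "\<dots> \<le> t powr (1/4) * (\<rho> / 2) powr (-3/4)"
    using r by (intro mult_left_mono powr_mono2') auto
  also have "(\<rho> / 2) powr (-3/4) = 2 powr (3/4) * \<rho> powr (-3/4)"
    using r by (simp add: powr_divide powr_minus field_simps)
  also have "t powr (1/4) * (2 powr (3/4) * \<rho> powr (-3/4)) = 2 powr (3/4) * (t powr (1/4) * \<rho> powr (-3/4))" by simp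
  also have "\<dots> \<le> 2 powr 1 * (t powr (1/4) * \<rho> powr (-3/4))"
    by (intro mult_right_mono powr_mono) auto
  finally show ?thesis by simp
qed

text \<open>
  Beyond \<open>x\<close> the connection formula absorbs the constant and leaves four points of the sector in which the
  primitive decays.
\<close>

lemma half_line_primitive_beyond:
  assumes t: "t > 0"
  shows "half_line_primitive x t a = - airy_primitive (- (\<alpha> * of_real (a - x))) t - airy_primitive (- (\<alpha>\<^sup>2 * of_real (a - x))) t
     + airy_primitive (of_real x - \<alpha> * of_real a) t + airy_primitive (of_real x - \<alpha>\<^sup>2 * of_real a) t"
proof -
  have "airy_primitive (of_real x - of_real a) t + airy_primitive (\<alpha> * (of_real x - of_real a)) t
     + airy_primitive (\<alpha>\<^sup>2 * (of_real x - of_real a)) t = -1"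
    by (rule airy_primitive_connection[OF t])
  moreover have "c * (of_real x - of_real a) = - (c * of_real (a - x))" for c :: complex
    by (simp add: algebra_simps)
  ultimately show ?thesis
    unfolding half_line_primitive_def by (simp add: algebra_simps add_eq_0_iff)
qed

lemma half_line_primitive_bounds:
  assumes t: "t > 0" and x: "x > 0" and a: "a \<ge> 0"
  shows half_line_primitive_le_4: "norm (half_line_primitive x t a) \<le> 4"
    and half_line_primitive_decay: "a > x \<Longrightarrow> norm (half_line_primitive x t a) \<le> 8 * (t powr (1/4) * (a - x) powr (-3/4))"
proof -
  let ?z1 = "complex_of_real x - \<alpha> * of_real a" and ?z2 = "complex_of_real x - \<alpha>\<^sup>2 * of_real a"
  have s: "sqrt 3 / 2 * a \<le> sqrt 3 * (x + a / 2)" using x a by (simp add: algebra_simps)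
  have z1: "norm (airy_primitive ?z1 t) \<le> 1" and z2: "norm (airy_primitive ?z2 t) \<le> 1"
    by (rule norm_airy_primitive_le_1[OF t]; unfold sector_points; use s x a in simp)+
  let ?w1 = "- (\<alpha> * complex_of_real (a - x))" and ?w2 = "- (\<alpha>\<^sup>2 * complex_of_real (a - x))"
  have w: "Re ?w1 = (a - x) / 2" "\<bar>Im ?w1\<bar> = sqrt 3 / 2 * \<bar>a - x\<bar>"
    "Re ?w2 = (a - x) / 2" "\<bar>Im ?w2\<bar> = sqrt 3 / 2 * \<bar>a - x\<bar>"
    using sector_points[of 0 "a - x"] by simp_all
  have tri: "norm (- p - q + u + v) \<le> norm p + norm q + norm u + norm v" for p q u v :: complex
    using norm_triangle_ineq[of "- p - q + u" v] norm_triangle_ineq[of "- p - q" u] norm_triangle_ineq4[of "- p" q]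
    by simp
  show "norm (half_line_primitive x t a) \<le> 4"
  proof (cases "a \<le> x")
    case True
    have "norm (airy_primitive (of_real x - of_real a) t) \<le> 1"
      by (rule norm_airy_primitive_le_1[OF t]) (use True in auto)
    then show ?thesis
      unfolding half_line_primitive_def using z1 z2
        norm_triangle_ineq[of "1 + airy_primitive (of_real x - of_real a) t + airy_primitive ?z1 t" "airy_primitive ?z2 t"]
        norm_triangle_ineq[of "1 + airy_primitive (of_real x - of_real a) t" "airy_primitive ?z1 t"]
        norm_triangle_ineq[of 1 "airy_primitive (of_real x - of_real a) t"]
      by simp
  next
    case False
    have w1: "norm (airy_primitive ?w1 t) \<le> 1" and w2: "norm (airy_primitive ?w2 t) \<le> 1"
      by (rule norm_airy_primitive_le_1[OF t]; unfold w; use False in simp)+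
    show ?thesis
      unfolding half_line_primitive_beyond[OF t]
      using tri[of "airy_primitive ?w1 t" "airy_primitive ?w2 t" "airy_primitive ?z1 t" "airy_primitive ?z2 t"] z1 z2 w1 w2
      by linarith
  qed
  show "norm (half_line_primitive x t a) \<le> 8 * (t powr (1/4) * (a - x) powr (-3/4))" if ax: "a > x"
  proof -
    let ?B = "2 * (t powr (1/4) * (a - x) powr (-3/4))"
    have p: "a - x > 0" using ax by simp
    have "norm (airy_primitive ?w1 t) \<le> ?B" "norm (airy_primitive ?w2 t) \<le> ?B"
      by (rule airy_primitive_sector_decay[OF t p]; unfold w; use ax in simp)+
    moreover have "norm (airy_primitive ?z1 t) \<le> ?B" "norm (airy_primitive ?z2 t) \<le> ?B"
      by (rule airy_primitive_sector_decay[OF t p]; unfold sector_points; use s x a ax in simp)+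
    ultimately show ?thesis
      unfolding half_line_primitive_beyond[OF t]
      using tri[of "airy_primitive ?w1 t" "airy_primitive ?w2 t" "airy_primitive ?z1 t" "airy_primitive ?z2 t"]
      by linarith
  qed
qed

text \<open>
  An integrable majorant of the squared modulus of the half-line primitive, with integral of order
  \<open>x + t^(1/3)\<close>.
\<close>

definition square_bound :: "real \<Rightarrow> real \<Rightarrow> real \<Rightarrow> real" where
  "square_bound x t s = (if s \<le> 0 then 0 else if s < 2 * x + t powr (1/3) then 16 else 256 * t powr (1/2) * s powr (-3/2))"

lemma half_line_primitive_square:
  assumes t: "t > 0" and x: "x > 0" and s: "s > 0"
  shows "(norm (half_line_primitive x t s))\<^sup>2 \<le> square_bound x t s"
proof (cases "s < 2 * x + t powr (1/3)")
  case True
  have "(norm (half_line_primitive x t s))\<^sup>2 \<le> 4\<^sup>2"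
    by (intro power_mono half_line_primitive_le_4) (use assms in auto)
  then show ?thesis using True s by (simp add: square_bound_def)
next
  case False
  then have s2: "s / 2 \<le> s - x" "s > x" using t x by (smt (verit) powr_gt_zero field_sum_of_halves)+
  have "norm (half_line_primitive x t s) \<le> 8 * (t powr (1/4) * (s - x) powr (-3/4))"
    using half_line_primitive_decay[OF t x, of s] s s2 by simp
  also have "(s - x) powr (-3/4) \<le> (s / 2) powr (-3/4)" using s s2 by (intro powr_mono2') auto
  also have "(s / 2) powr (-3/4) = 2 powr (3/4) * s powr (-3/4)"
    using s by (simp add: powr_divide powr_minus field_simps)
  also have "2 powr (3/4) * s powr (-3/4) \<le> 2 powr 1 * s powr (-3/4)"
    by (intro mult_right_mono powr_mono) auto
  finally have "norm (half_line_primitive x t s) \<le> 16 * (t powr (1/4) * s powr (-3/4))"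
    by (simp add: mult_left_mono)
  then have "(norm (half_line_primitive x t s))\<^sup>2 \<le> (16 * (t powr (1/4) * s powr (-3/4)))\<^sup>2"
    by (intro power_mono) auto
  also have "\<dots> = 256 * (t powr (1/4) * t powr (1/4)) * (s powr (-3/4) * s powr (-3/4))"
    by (simp add: power2_eq_square mult_ac)
  also have "\<dots> = 256 * t powr (1/2) * s powr (-3/2)"
    by (simp only: powr_add[symmetric]) simp
  finally show ?thesis using False s by (simp add: square_bound_def)
qed

lemma square_bound_nonneg: "square_bound x t s \<ge> 0"
  by (simp add: square_bound_def)

lemma square_bound_integral:
  assumes t: "t > 0" and x: "x > 0"
  shows "integrable lebesgue (square_bound x t)"
    and "(LINT s|lebesgue. square_bound x t s) \<le> 528 * (x + t powr (1/3))"
proof -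
  define \<tau> where "\<tau> = t powr (1/3)"
  define c where "c = 2 * x + \<tau>"
  have tau: "\<tau> > 0" using t by (simp add: \<tau>_def)
  have c: "c > 0" using x tau by (simp add: c_def)
  define K where "K = 256 * t powr (1/2)"
  have H: "((\<lambda>s. K * s powr (-3/2)) has_integral K * (- (c powr (-3/2 + 1)) / (-3/2 + 1))) {c..}"
    by (intro has_integral_mult_right has_integral_powr_to_inf) (use c in auto)
  have si: "set_integrable lebesgue {c..} (\<lambda>s. K * s powr (-3/2))"
    by (rule nonnegative_absolutely_integrable_1) (use H in \<open>auto simp: K_def\<close>)
  have i0: "integrable lebesgue (\<lambda>s. 16 * indicat_real {0<..<c} s)"
    by (intro integrable_mult_right integrable_real_indicator) (use c in auto)
  have eq: "square_bound x t = (\<lambda>s. 16 * indicat_real {0<..<c} s + indicat_real {c..} s *\<^sub>R (K * s powr (-3/2)))"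
    using c by (auto simp: fun_eq_iff square_bound_def c_def \<tau>_def K_def indicator_def)
  show "integrable lebesgue (square_bound x t)"
    unfolding eq using i0 si unfolding set_integrable_def by (rule Bochner_Integration.integrable_add)
  have "(LINT s|lebesgue. square_bound x t s) = 16 * c + (LINT s:{c..}|lebesgue. K * s powr (-3/2))"
    unfolding eq set_lebesgue_integral_def
    by (subst Bochner_Integration.integral_add[OF i0 si[unfolded set_integrable_def]]) (use c in auto)
  also have "(LINT s:{c..}|lebesgue. K * s powr (-3/2)) = K * (- (c powr (-3/2 + 1)) / (-3/2 + 1))"
    unfolding set_lebesgue_integral_eq_integral(2)[OF si] by (rule integral_unique[OF H])
  also have "K * (- (c powr (-3/2 + 1)) / (-3/2 + 1)) = 512 * (t powr (1/2) * c powr (-1/2))"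
    by (simp add: K_def)
  also have "t powr (1/2) * c powr (-1/2) \<le> t powr (1/2) * \<tau> powr (-1/2)"
    using tau x by (intro mult_left_mono powr_mono2') (auto simp: c_def)
  also have "t powr (1/2) * \<tau> powr (-1/2) = \<tau>"
    unfolding \<tau>_def powr_powr using t by (simp add: powr_add[symmetric])
  finally show "(LINT s|lebesgue. square_bound x t s) \<le> 528 * (x + t powr (1/3))"
    using x by (simp add: c_def \<tau>_def)
qed

text \<open>
  Again \<open>2 |M g| \<le> d |g|^2 + |M|^2/d\<close>, with \<open>d^2\<close> of the order of the integral of
  \<open>|M|^2\<close>, in place of the Cauchy--Schwarz inequality.
\<close>

lemma weighted_L2_estimate:
  assumes t: "t > 0" and x: "x > 0" and p: "p \<ge> 0" and g: "L2_on S g" and sub: "{p<..<b} \<subseteq> S"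
    and si: "set_integrable lebesgue {p<..<b} (\<lambda>s. half_line_primitive x t s * g s)"
  shows "norm (LINT s:{p<..<b}|lebesgue. half_line_primitive x t s * g s)
     \<le> sqrt (x + t powr (1/3)) * (L2_normsq S g + 528) / 2"
proof -
  let ?M = "half_line_primitive x t"
  define d where "d = sqrt (x + t powr (1/3))"
  have d: "d > 0" "d\<^sup>2 = x + t powr (1/3)" using t x by (auto simp: d_def add_pos_nonneg)
  have iS: "integrable lebesgue (\<lambda>s. indicat_real S s *\<^sub>R (cmod (g s))\<^sup>2)"
    using g by (simp add: L2_on_def set_integrable_def)
  define w where "w = (\<lambda>s. (d / 2) * (indicat_real S s *\<^sub>R (cmod (g s))\<^sup>2) + (1 / (2 * d)) * square_bound x t s)"
  have w: "integrable lebesgue w"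
    unfolding w_def by (intro Bochner_Integration.integrable_add integrable_mult_right iS square_bound_integral t x)
  have "norm (LINT s:{p<..<b}|lebesgue. ?M s * g s) \<le> (LINT s|lebesgue. w s)"
    unfolding set_lebesgue_integral_def
  proof (rule Bochner_Integration.integral_norm_bound_integral[OF si[unfolded set_integrable_def] w])
    fix s
    show "norm (indicat_real {p<..<b} s *\<^sub>R (?M s * g s)) \<le> w s"
    proof (cases "s \<in> {p<..<b}")
      case True
      have "0 \<le> (d * cmod (g s) - cmod (?M s))\<^sup>2" by simp
      then have "2 * d * (cmod (?M s) * cmod (g s)) \<le> d\<^sup>2 * (cmod (g s))\<^sup>2 + (cmod (?M s))\<^sup>2"
        by (simp add: power2_eq_square algebra_simps)
      also have "(cmod (?M s))\<^sup>2 \<le> square_bound x t s"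
        by (rule half_line_primitive_square[OF t x]) (use True p in auto)
      finally have "cmod (?M s) * cmod (g s) \<le> (d / 2) * (cmod (g s))\<^sup>2 + (1 / (2 * d)) * square_bound x t s"
        using d(1) by (simp add: field_simps power2_eq_square)
      then show ?thesis using True subsetD[OF sub True] by (simp add: w_def norm_mult)
    next
      case False
      then show ?thesis using d(1) square_bound_nonneg[of x t s] by (simp add: w_def)
    qed
  qed
  also have "\<dots> = (d / 2) * L2_normsq S g + (1 / (2 * d)) * (LINT s|lebesgue. square_bound x t s)"
    unfolding w_def L2_normsq_def set_lebesgue_integral_def
    unfolding Bochner_Integration.integral_add[OF integrable_mult_right[OF iS]
      integrable_mult_right[OF square_bound_integral(1)[OF t x]]] integral_mult_right_zero ..
  also have "\<dots> \<le> (d / 2) * L2_normsq S g + (1 / (2 * d)) * (528 * d\<^sup>2)"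
    unfolding d(2) using square_bound_integral(2)[OF t x] d(1)
    by (intro add_left_mono mult_left_mono) auto
  also have "\<dots> = d * (L2_normsq S g + 528) / 2" using d(1) by (simp add: field_simps power2_eq_square)
  finally show ?thesis by (simp add: d_def)
qed

text \<open>
  The right end point contributes the value of the primitive there times the one-sided limit of \<open>f\<close>, which
  is bounded in terms of \<open>c\<close> and \<open>g\<close>.
\<close>

lemma bounded_piece_estimate:
  assumes t: "t > 0" and x: "x > 0" and p: "0 \<le> p" "p < b" and g: "L2_on S g" and sub: "{p<..<b} \<subseteq> S"
    and f: "AE y in lebesgue. p < y \<and> y < b \<longrightarrow> f y = c + (LINT s:{p<..<y}|lebesgue. g s)"
    and fm: "set_borel_measurable lebesgue {p<..<b} f"
  shows "norm ((LINT y:{p<..<b}|lebesgue. half_line_kernel x t y * f y) - c * half_line_primitive x t p) \<le>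
     norm (half_line_primitive x t b) * (norm c + sqrt (b - p) * (L2_normsq S g + 1) / 2)
     + sqrt (x + t powr (1/3)) * (L2_normsq S g + 528) / 2"
proof -
  let ?M = "half_line_primitive x t"
  have gi: "set_integrable lebesgue {p<..<b} g" by (rule L2_imp_set_integrable[OF g sub p(2)])
  have I: "(LINT y:{p<..<b}|lebesgue. half_line_kernel x t y * f y)
      = c * (?M p - ?M b) + (LINT s:{p<..<b}|lebesgue. (?M s - ?M b) * g s)"
    and J: "set_integrable lebesgue {p<..<b} (\<lambda>s. (?M s - ?M b) * g s)"
    by (rule ac_integration_by_parts[OF half_line_kernel_integral(1)[OF t] gi f half_line_kernel_integral(2)[OF t]
          half_line_kernel_integral(2)[OF t] fm]; use p in simp)+
  have cg: "set_integrable lebesgue {p<..<b} (\<lambda>s. ?M b * g s)" using gi by (intro set_integrable_mult_right) auto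
  have Mg: "set_integrable lebesgue {p<..<b} (\<lambda>s. ?M s * g s)"
    using set_integral_add(1)[OF J cg] by (simp add: algebra_simps)
  have "(LINT s:{p<..<b}|lebesgue. (?M s - ?M b) * g s) =
     (LINT s:{p<..<b}|lebesgue. ?M s * g s) - ?M b * (LINT s:{p<..<b}|lebesgue. g s)"
    unfolding left_diff_distrib set_integral_diff(2)[OF Mg cg] by simp
  then have "(LINT y:{p<..<b}|lebesgue. half_line_kernel x t y * f y) - c * ?M p =
     (LINT s:{p<..<b}|lebesgue. ?M s * g s) - ?M b * (c + (LINT s:{p<..<b}|lebesgue. g s))"
    unfolding I by (simp add: algebra_simps)
  also have "norm \<dots> \<le> norm (LINT s:{p<..<b}|lebesgue. ?M s * g s)
     + norm (?M b) * norm (c + (LINT s:{p<..<b}|lebesgue. g s))"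
    by (rule order_trans[OF norm_triangle_ineq4]) (simp add: norm_mult)
  also have "norm (c + (LINT s:{p<..<b}|lebesgue. g s)) \<le> norm c + sqrt (b - p) * (L2_normsq S g + 1) / 2"
    using norm_triangle_ineq[of c "LINT s:{p<..<b}|lebesgue. g s"] norm_set_integral_le[OF gi]
      L2_integral_norm_le[OF g sub p(2)] by linarith
  also have "norm (LINT s:{p<..<b}|lebesgue. ?M s * g s) \<le> sqrt (x + t powr (1/3)) * (L2_normsq S g + 528) / 2"
    by (rule weighted_L2_estimate[OF t x p(1) g sub Mg])
  finally show ?thesis by (simp add: mult_left_mono)
qed

lemma tendsto_set_integral_lessThan:
  fixes h :: "real \<Rightarrow> complex"
  assumes h: "set_integrable lebesgue {p<..} h"
  shows "((\<lambda>b. LINT y:{p<..<b}|lebesgue. h y) \<longlongrightarrow> (LINT y:{p<..}|lebesgue. h y)) at_top"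
  unfolding set_lebesgue_integral_def
proof (rule integral_dominated_convergence_at_top[where w = "\<lambda>y. norm (indicat_real {p<..} y *\<^sub>R h y)"])
  let ?h = "\<lambda>y. indicat_real {p<..} y *\<^sub>R h y"
  show hm: "?h \<in> borel_measurable lebesgue" using h by (auto simp: set_integrable_def)
  have "(\<lambda>y. indicat_real {p<..<b} y *\<^sub>R h y) = (\<lambda>y. indicat_real {..<b} y *\<^sub>R ?h y)" for b
    by (auto simp: fun_eq_iff indicator_def)
  moreover have "(\<lambda>y. indicat_real {..<b} y *\<^sub>R ?h y) \<in> borel_measurable lebesgue" for b
    by (rule borel_measurable_scaleR[OF borel_measurable_indicator hm]) simp
  ultimately show "(\<lambda>y. indicat_real {p<..<b} y *\<^sub>R h y) \<in> borel_measurable lebesgue" for b by simp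
  show "integrable lebesgue (\<lambda>y. norm (?h y))" by (rule integrable_norm[OF h[unfolded set_integrable_def]])
  have "((\<lambda>b. indicat_real {p<..<b} y *\<^sub>R h y) \<longlongrightarrow> ?h y) at_top" for y
    by (rule tendsto_eventually) (use eventually_gt_at_top[of y] in \<open>eventually_elim, auto simp: indicator_def\<close>)
  then show "AE y in lebesgue. ((\<lambda>b. indicat_real {p<..<b} y *\<^sub>R h y) \<longlongrightarrow> ?h y) at_top" by simp
  show "\<forall>\<^sub>F b in at_top. AE y in lebesgue. norm (indicat_real {p<..<b} y *\<^sub>R h y) \<le> norm (?h y)"
    by (intro always_eventually allI AE_I2) (auto simp: indicator_def)
qed

text \<open>
  As the right end tends to infinity, \<open>f\<close> may a priori grow like the square root, which the decay of order
  \<open>3/4\<close> of the primitive outweighs.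
\<close>

lemma unbounded_piece_estimate:
  assumes t: "t > 0" and x: "x > 0" and p: "0 \<le> p" and g: "L2_on {p<..} g"
    and f: "AE y in lebesgue. p < y \<longrightarrow> f y = c + (LINT s:{p<..<y}|lebesgue. g s)"
    and fm: "set_borel_measurable lebesgue {p<..} f"
    and si: "set_integrable lebesgue {p<..} (\<lambda>y. half_line_kernel x t y * f y)"
  shows "norm ((LINT y:{p<..}|lebesgue. half_line_kernel x t y * f y) - c * half_line_primitive x t p) \<le>
     sqrt (x + t powr (1/3)) * (L2_normsq {p<..} g + 528) / 2"
proof -
  let ?G = "L2_normsq {p<..} g"
  define R where "R = sqrt (x + t powr (1/3)) * (?G + 528) / 2"
  define B where "B = (\<lambda>b. 8 * (t powr (1/4) * (b - x) powr (-3/4)) * (norm c + sqrt (b - p) * (?G + 1) / 2) + R)"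
  have G: "?G \<ge> 0" unfolding L2_normsq_def set_lebesgue_integral_def by (rule Bochner_Integration.integral_nonneg) auto
  have lim1: "((\<lambda>b. norm ((LINT y:{p<..<b}|lebesgue. half_line_kernel x t y * f y) - c * half_line_primitive x t p))
     \<longlongrightarrow> norm ((LINT y:{p<..}|lebesgue. half_line_kernel x t y * f y) - c * half_line_primitive x t p)) at_top"
    by (intro tendsto_intros tendsto_set_integral_lessThan si)
  have l1: "((\<lambda>b. (b - x) powr (-3/4)) \<longlongrightarrow> 0) at_top" by real_asymp
  have l2: "((\<lambda>b. (b - x) powr (-3/4) * sqrt (b - p)) \<longlongrightarrow> 0) at_top" by real_asymp
  have "((\<lambda>b. (b - x) powr (-3/4) * norm c + (b - x) powr (-3/4) * sqrt (b - p) * ((?G + 1) / 2)) \<longlongrightarrow> 0 * norm c + 0 * ((?G + 1) / 2)) at_top"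
    by (intro tendsto_intros l1 l2)
  then have "((\<lambda>b. (b - x) powr (-3/4) * (norm c + sqrt (b - p) * (?G + 1) / 2)) \<longlongrightarrow> 0) at_top"
    by (simp add: algebra_simps add_divide_distrib)
  then have "((\<lambda>b. 8 * t powr (1/4) * ((b - x) powr (-3/4) * (norm c + sqrt (b - p) * (?G + 1) / 2)) + R) \<longlongrightarrow> 8 * t powr (1/4) * 0 + R) at_top"
    by (intro tendsto_intros)
  then have lim2: "(B \<longlongrightarrow> R) at_top" by (simp add: B_def mult_ac)
  have "\<forall>\<^sub>F b in at_top. norm ((LINT y:{p<..<b}|lebesgue. half_line_kernel x t y * f y) - c * half_line_primitive x t p) \<le> B b"
    using eventually_gt_at_top[of p] eventually_gt_at_top[of x]
  proof eventually_elim
    case (elim b)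
    have fb: "AE y in lebesgue. p < y \<and> y < b \<longrightarrow> f y = c + (LINT s:{p<..<y}|lebesgue. g s)"
      using f by eventually_elim auto
    have fmb: "set_borel_measurable lebesgue {p<..<b} f"
    proof -
      have "(\<lambda>y. indicat_real {..<b} y *\<^sub>R (indicat_real {p<..} y *\<^sub>R f y)) \<in> borel_measurable lebesgue"
        by (rule borel_measurable_scaleR[OF borel_measurable_indicator]) (use fm in \<open>auto simp: set_borel_measurable_def\<close>)
      moreover have "(\<lambda>y. indicat_real {..<b} y *\<^sub>R (indicat_real {p<..} y *\<^sub>R f y)) = (\<lambda>y. indicat_real {p<..<b} y *\<^sub>R f y)"
        by (auto simp: fun_eq_iff indicator_def)
      ultimately show ?thesis by (simp add: set_borel_measurable_def)
    qed
    have sub: "{p<..<b} \<subseteq> {p<..}" by auto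
    have "norm (half_line_primitive x t b) \<le> 8 * (t powr (1/4) * (b - x) powr (-3/4))"
      by (rule half_line_primitive_decay[OF t x]) (use elim x in auto)
    then have "norm (half_line_primitive x t b) * (norm c + sqrt (b - p) * (?G + 1) / 2) \<le>
       8 * (t powr (1/4) * (b - x) powr (-3/4)) * (norm c + sqrt (b - p) * (?G + 1) / 2)"
      using elim G by (intro mult_right_mono) auto
    then show ?case
      using bounded_piece_estimate[OF t x p elim(1) g sub fb fmb] by (simp add: B_def R_def)
  qed
  from tendsto_le[OF trivial_limit_at_top_linorder lim2 lim1 this] show ?thesis by (simp add: R_def)
qed

section \<open>The initial datum\<close>

definition error_scale :: "real \<Rightarrow> real \<Rightarrow> real" where
  "error_scale x t = x powr (1/2) + t powr (1/6)"

lemma error_scale_nonneg: "error_scale x t \<ge> 0"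
  by (simp add: error_scale_def)

lemma sqrt_le_error_scale:
  assumes "x > 0" "t > 0"
  shows "sqrt (x + t powr (1/3)) \<le> error_scale x t"
proof -
  have "sqrt (x + t powr (1/3)) \<le> sqrt x + sqrt (t powr (1/3))"
    using assms by (intro sqrt_add_le_add_sqrt) auto
  also have "sqrt (t powr (1/3)) = t powr (1/6)"
    by (simp add: powr_half_sqrt[symmetric] powr_powr)
  finally show ?thesis using assms by (simp add: error_scale_def powr_half_sqrt)
qed

text \<open>
  At a positive distance from the origin the decay of the primitive gives \<open>O(t^(1/4))\<close>, better than needed. So
  a jump of the datum away from the origin does not enter the expansion.
\<close>

lemma half_line_primitive_away:
  assumes p: "p > 0"
  shows "\<exists>C\<ge>0. \<forall>x t. 0 < x \<longrightarrow> x < p / 2 \<longrightarrow> 0 < t \<longrightarrow> t < 1 \<longrightarrow>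
     norm (half_line_primitive x t p) \<le> C * error_scale x t"
proof (intro exI[of _ "8 * (p / 2) powr (-3/4)"] conjI allI impI)
  fix x t :: real assume x: "0 < x" "x < p / 2" and t: "0 < t" "t < 1"
  have "norm (half_line_primitive x t p) \<le> 8 * (t powr (1/4) * (p - x) powr (-3/4))"
    by (rule half_line_primitive_decay) (use x t p in auto)
  also have "\<dots> \<le> 8 * (error_scale x t * (p / 2) powr (-3/4))"
  proof (intro mult_left_mono mult_mono)
    show "(p - x) powr (-3/4) \<le> (p / 2) powr (-3/4)" using x p by (intro powr_mono2') auto
    have "t powr (1/4) \<le> t powr (1/6)" using t by (intro powr_mono') auto
    then show "t powr (1/4) \<le> error_scale x t" by (simp add: error_scale_def add_increasing)
  qed (auto simp: error_scale_nonneg)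
  finally show "norm (half_line_primitive x t p) \<le> 8 * (p / 2) powr (-3/4) * error_scale x t"
    by (simp add: mult_ac)
qed simp

lemma set_borel_measurable_subset_lebesgue:
  fixes f :: "real \<Rightarrow> complex"
  assumes "set_borel_measurable lebesgue A f" "B \<subseteq> A" "B \<in> sets lebesgue"
  shows "set_borel_measurable lebesgue B f"
proof -
  have "(\<lambda>y. indicat_real B y *\<^sub>R (indicat_real A y *\<^sub>R f y)) \<in> borel_measurable lebesgue"
    by (rule borel_measurable_scaleR[OF borel_measurable_indicator[OF assms(3)]])
       (use assms in \<open>auto simp: set_borel_measurable_def\<close>)
  moreover have "(\<lambda>y. indicat_real B y *\<^sub>R (indicat_real A y *\<^sub>R f y)) = (\<lambda>y. indicat_real B y *\<^sub>R f y)"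
    using assms(2) by (auto simp: fun_eq_iff indicator_def)
  ultimately show ?thesis by (simp add: set_borel_measurable_def)
qed

text \<open>
  Only a piece that starts at the origin contributes to the expansion; at any other left end the primitive itself is
  an error term.
\<close>

lemma H1_piece_estimate:
  fixes q0 :: "real \<Rightarrow> complex" and b :: ereal
  assumes q0: "set_integrable lebesgue {0<..} q0" and p: "0 \<le> p" "ereal p < b"
    and H1: "H1_on (einterval (ereal p) b) q0"
    and si: "\<And>x t. 0 < x \<Longrightarrow> 0 < t \<Longrightarrow> set_integrable lebesgue {0<..} (\<lambda>y. half_line_kernel x t y * q0 y)"
  shows "\<exists>C \<epsilon>. \<epsilon> > 0 \<and> (\<forall>x t. 0 < x \<longrightarrow> x < \<epsilon> \<longrightarrow> 0 < t \<longrightarrow> t < \<epsilon> \<longrightarrow>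
     norm ((LINT y:einterval (ereal p) b|lebesgue. half_line_kernel x t y * q0 y)
        - (if p = 0 then right_value q0 0 * half_line_primitive x t 0 else 0)) \<le> C * error_scale x t)"
proof -
  define S where "S = einterval (ereal p) b"
  obtain m where m: "p < m" "ereal m < b"
    using ereal_dense2[OF p(2)] by auto
  have ne: "S \<noteq> {}" using m by (auto simp: S_def einterval_def)
  have subS: "{p<..<m'} \<subseteq> S" if "ereal m' \<le> b" for m'
    using that by (auto simp: S_def einterval_def intro: less_le_trans[of _ "ereal m'"])
  obtain c g where g: "L2_on S g" and f: "AE y in lebesgue. y \<in> S \<longrightarrow> q0 y = c + (LINT s:{p<..<y}|lebesgue. g s)"
  proof (rule H1_representation[OF H1[folded S_def], of p])
    show "open S" unfolding S_def by (rule open_einterval)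
    show "p < y" if "y \<in> S" for y using that by (simp add: S_def einterval_def)
    show "{p<..y} \<subseteq> S" if "y \<in> S" for y
      using that by (auto simp: S_def einterval_def intro: le_less_trans[of _ "ereal y"])
  qed (use ne that in auto)
  have c: "right_value q0 p = c"
  proof (rule right_value_eq[OF L2_imp_set_integrable[OF g subS m(1)] m(1)])
    show "AE y in lebesgue. p < y \<and> y < m \<longrightarrow> q0 y = c + (LINT s:{p<..<y}|lebesgue. g s)"
      using f
    proof eventually_elim
      case (elim y)
      then show ?case using subsetD[OF subS[OF less_imp_le[OF m(2)]], of y] by auto
    qed
  qed (use m in auto)
  have q0m: "set_borel_measurable lebesgue {0<..} q0"
    using q0 unfolding set_integrable_def set_borel_measurable_def by auto
  define G where "G = L2_normsq S g"
  have G: "G \<ge> 0" unfolding G_def L2_normsq_def set_lebesgue_integral_def by (rule Bochner_Integration.integral_nonneg) auto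
  have main: "\<exists>C \<epsilon>. \<epsilon> > 0 \<and> (\<forall>x t. 0 < x \<longrightarrow> x < \<epsilon> \<longrightarrow> 0 < t \<longrightarrow> t < \<epsilon> \<longrightarrow>
     norm ((LINT y:S|lebesgue. half_line_kernel x t y * q0 y) - c * half_line_primitive x t p) \<le> C * error_scale x t)"
  proof (cases b)
    case (real b')
    have S: "S = {p<..<b'}" by (simp add: S_def real)
    have pb: "p < b'" using p(2) real by simp
    obtain C where C: "C \<ge> 0" "\<And>x t. 0 < x \<Longrightarrow> x < b' / 2 \<Longrightarrow> 0 < t \<Longrightarrow> t < 1 \<Longrightarrow>
       norm (half_line_primitive x t b') \<le> C * error_scale x t"
      using half_line_primitive_away[of b'] pb p(1) by auto
    define D where "D = norm c + sqrt (b' - p) * (G + 1) / 2"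
    have D: "D \<ge> 0" using pb G by (simp add: D_def)
    show ?thesis
    proof (rule exI[of _ "C * D + (G + 528) / 2"], rule exI[of _ "min 1 (b' / 2)"], intro conjI allI impI)
      show "min 1 (b' / 2) > 0" using pb p(1) by simp
      fix x t :: real assume xt: "0 < x" "x < min 1 (b' / 2)" "0 < t" "t < min 1 (b' / 2)"
      have f': "AE y in lebesgue. p < y \<and> y < b' \<longrightarrow> q0 y = c + (LINT s:{p<..<y}|lebesgue. g s)"
        using f by eventually_elim (simp add: S)
      have "norm ((LINT y:S|lebesgue. half_line_kernel x t y * q0 y) - c * half_line_primitive x t p) \<le>
        norm (half_line_primitive x t b') * D + sqrt (x + t powr (1/3)) * (G + 528) / 2"
        unfolding S D_def G_def
        by (rule bounded_piece_estimate[OF xt(3,1) p(1) pb g[unfolded S] order_refl f'])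
           (rule set_borel_measurable_subset_lebesgue[OF q0m], use p(1) in auto)
      also have "\<dots> \<le> C * error_scale x t * D + error_scale x t * (G + 528) / 2"
        using C(2)[of x t] xt D G sqrt_le_error_scale[OF xt(1,3)]
        by (intro add_mono mult_right_mono divide_right_mono) auto
      finally show "norm ((LINT y:S|lebesgue. half_line_kernel x t y * q0 y) - c * half_line_primitive x t p)
         \<le> (C * D + (G + 528) / 2) * error_scale x t" by (simp add: algebra_simps add_divide_distrib)
    qed
  next
    case PInf
    have S: "S = {p<..}" by (auto simp: S_def PInf einterval_def)
    show ?thesis
    proof (rule exI[of _ "(G + 528) / 2"], rule exI[of _ "1::real"], intro conjI allI impI)
      fix x t :: real assume xt: "0 < x" "x < 1" "0 < t" "t < 1"
      have "norm ((LINT y:S|lebesgue. half_line_kernel x t y * q0 y) - c * half_line_primitive x t p)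
          \<le> sqrt (x + t powr (1/3)) * (G + 528) / 2"
        unfolding S G_def
      proof (rule unbounded_piece_estimate[OF xt(3,1) p(1) g[unfolded S]])
        show "AE y in lebesgue. p < y \<longrightarrow> q0 y = c + (LINT s:{p<..<y}|lebesgue. g s)"
          using f by eventually_elim (simp add: S)
        show "set_borel_measurable lebesgue {p<..} q0"
          by (rule set_borel_measurable_subset_lebesgue[OF q0m]) (use p(1) in auto)
        show "set_integrable lebesgue {p<..} (\<lambda>y. half_line_kernel x t y * q0 y)"
          by (rule set_integrable_subset[OF si[OF xt(1,3)]]) (use p(1) in auto)
      qed
      also have "\<dots> \<le> error_scale x t * (G + 528) / 2"
        using sqrt_le_error_scale[OF xt(1,3)] G by (intro divide_right_mono mult_right_mono) auto
      finally show "norm ((LINT y:S|lebesgue. half_line_kernel x t y * q0 y) - c * half_line_primitive x t p)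
         \<le> (G + 528) / 2 * error_scale x t" by (simp add: mult_ac)
    qed simp
  next
    case MInf then show ?thesis using p(2) by simp
  qed
  show ?thesis
  proof (cases "p = 0")
    case True
    then show ?thesis using main c by (simp add: S_def)
  next
    case False
    then have p0: "p > 0" using p(1) by simp
    obtain C \<epsilon> where C: "\<epsilon> > 0" "\<And>x t. 0 < x \<Longrightarrow> x < \<epsilon> \<Longrightarrow> 0 < t \<Longrightarrow> t < \<epsilon> \<Longrightarrow>
     norm ((LINT y:S|lebesgue. half_line_kernel x t y * q0 y) - c * half_line_primitive x t p) \<le> C * error_scale x t"
      using main by blast
    obtain C' where C': "C' \<ge> 0" "\<And>x t. 0 < x \<Longrightarrow> x < p / 2 \<Longrightarrow> 0 < t \<Longrightarrow> t < 1 \<Longrightarrow>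
       norm (half_line_primitive x t p) \<le> C' * error_scale x t"
      using half_line_primitive_away[OF p0] by auto
    show ?thesis
    proof (rule exI[of _ "C + norm c * C'"], rule exI[of _ "min \<epsilon> (min 1 (p / 2))"], intro conjI allI impI)
      show "min \<epsilon> (min 1 (p / 2)) > 0" using C(1) p0 by simp
      fix x t :: real assume xt: "0 < x" "x < min \<epsilon> (min 1 (p / 2))" "0 < t" "t < min \<epsilon> (min 1 (p / 2))"
      let ?I = "LINT y:S|lebesgue. half_line_kernel x t y * q0 y"
      have "norm ?I \<le> norm (?I - c * half_line_primitive x t p) + norm (c * half_line_primitive x t p)"
        using norm_triangle_sub by (metis add.commute)
      also have "\<dots> \<le> C * error_scale x t + norm c * (C' * error_scale x t)"
        unfolding norm_mult using C(2)[of x t] C'(2)[of x t] xt by (intro add_mono mult_left_mono) auto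
      finally show "norm ((LINT y:einterval (ereal p) b|lebesgue. half_line_kernel x t y * q0 y)
        - (if p = 0 then right_value q0 0 * half_line_primitive x t 0 else 0)) \<le> (C + norm c * C') * error_scale x t"
        using False by (simp add: S_def algebra_simps)
    qed
  qed
qed

lemma admissible_initial_integrable:
  assumes "l \<ge> 0" "admissible_initial l q0"
  shows "set_integrable lebesgue {0<..} q0"
  unfolding set_integrable_def
proof (rule Bochner_Integration.integrable_bound)
  show "integrable lebesgue (\<lambda>x. indicat_real {0<..} x *\<^sub>R ((1 + \<bar>x\<bar>) powr l *\<^sub>R q0 x))"
    using assms(2) by (simp add: admissible_initial_def weighted_L1_def set_integrable_def)
  show "(\<lambda>x. indicat_real {0<..} x *\<^sub>R q0 x) \<in> borel_measurable lebesgue"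
    using assms(2) by (simp add: admissible_initial_def L2_on_def set_borel_measurable_def)
  have le: "norm (q0 x) \<le> (1 + \<bar>x\<bar>) powr l * norm (q0 x)" for x
  proof -
    have "1 \<le> (1 + \<bar>x\<bar>) powr l" using assms(1) by (intro ge_one_powr_ge_zero) auto
    from mult_right_mono[OF this norm_ge_zero] show ?thesis by simp
  qed
  have "norm (indicat_real {0<..} x *\<^sub>R q0 x) \<le> norm (indicat_real {0<..} x *\<^sub>R ((1 + \<bar>x\<bar>) powr l *\<^sub>R q0 x))" for x
    using le[of x] by (cases "0 < x") auto
  then show "AE x in lebesgue. norm (indicat_real {0<..} x *\<^sub>R q0 x) \<le> norm (indicat_real {0<..} x *\<^sub>R ((1 + \<bar>x\<bar>) powr l *\<^sub>R q0 x))"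
    by (intro AE_I2)
qed

lemma partition_indicator:
  fixes xs :: "nat \<Rightarrow> ereal"
  assumes "\<And>i. i < m \<Longrightarrow> xs i < xs (Suc i)" and "\<And>i. i \<le> m \<Longrightarrow> ereal y \<noteq> xs i"
  shows "indicat_real (einterval (xs 0) (xs m)) y = (\<Sum>i<m. indicat_real (einterval (xs i) (xs (Suc i))) y)"
  using assms
proof (induction m)
  case 0
  have "y \<notin> einterval (xs 0) (xs 0)" by (auto simp: einterval_def dest: less_asym)
  then show ?case by simp
next
  case (Suc m)
  have mono: "xs 0 \<le> xs m" using Suc.prems(1)
  proof (induction m)
    case (Suc k)
    then have "xs 0 \<le> xs k" by auto
    also have "xs k \<le> xs (Suc k)" using Suc.prems[of k] by (simp add: less_imp_le)
    finally show ?case .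
  qed simp
  have IH: "indicat_real (einterval (xs 0) (xs m)) y = (\<Sum>i<m. indicat_real (einterval (xs i) (xs (Suc i))) y)"
    using Suc by simp
  have step: "xs m < xs (Suc m)" and ne: "ereal y \<noteq> xs m" using Suc.prems(1)[of m] Suc.prems(2)[of m] by auto
  have "indicat_real (einterval (xs 0) (xs (Suc m))) y =
    indicat_real (einterval (xs 0) (xs m)) y + indicat_real (einterval (xs m) (xs (Suc m))) y"
    using mono step ne by (auto simp: indicator_def einterval_def) 
  then show ?case using IH by simp
qed

lemma initial_estimate:
  assumes l: "l \<ge> 0" and adm: "admissible_initial l q0"
    and si: "\<And>x t. 0 < x \<Longrightarrow> 0 < t \<Longrightarrow> set_integrable lebesgue {0<..} (\<lambda>y. half_line_kernel x t y * q0 y)"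
  shows "\<exists>C \<epsilon>. \<epsilon> > 0 \<and> (\<forall>x t. 0 < x \<longrightarrow> x < \<epsilon> \<longrightarrow> 0 < t \<longrightarrow> t < \<epsilon> \<longrightarrow>
     norm ((LINT y:{0<..}|lebesgue. half_line_kernel x t y * q0 y)
        - right_value q0 0 * half_line_primitive x t 0) \<le> C * error_scale x t)"
proof -
  have q0: "set_integrable lebesgue {0<..} q0" by (rule admissible_initial_integrable[OF l adm])
  obtain M :: nat and xs :: "nat \<Rightarrow> ereal" where xs: "xs 0 = 0" "xs (Suc M) = \<infinity>" "\<And>i. i \<le> M \<Longrightarrow> xs i < xs (Suc i)"
    "\<And>i. i \<le> M \<Longrightarrow> H1_on (einterval (xs i) (xs (Suc i))) q0"
    using adm unfolding admissible_initial_def by blast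
  have nonneg: "0 \<le> xs i \<and> (i > 0 \<longrightarrow> 0 < xs i)" if "i \<le> Suc M" for i
    using that
  proof (induction i)
    case (Suc i)
    then have "0 \<le> xs i" "xs i < xs (Suc i)" using xs(3)[of i] by auto
    then show ?case by (auto intro: le_less_trans less_imp_le)
  qed (simp add: xs(1))
  have fin: "\<exists>p\<ge>0. xs i = ereal p \<and> (p = 0 \<longleftrightarrow> i = 0)" if "i \<le> M" for i
  proof -
    have "xs i < \<infinity>" using xs(3)[OF that] by (cases "xs i") auto
    then show ?thesis using nonneg[of i] that xs(1) by (cases "xs i") (auto simp: zero_ereal_def)
  qed
  define I where "I = (\<lambda>i x t. LINT y:einterval (xs i) (xs (Suc i))|lebesgue. half_line_kernel x t y * q0 y)"
  define V where "V = (\<lambda>i x t. if i = (0::nat) then right_value q0 0 * half_line_primitive x t 0 else 0)"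
  have "\<exists>C \<epsilon>. \<epsilon> > 0 \<and> (\<forall>x t. 0 < x \<longrightarrow> x < \<epsilon> \<longrightarrow> 0 < t \<longrightarrow> t < \<epsilon> \<longrightarrow>
     norm (I i x t - V i x t) \<le> C * error_scale x t)" if i: "i \<le> M" for i
  proof -
    obtain p where p: "p \<ge> 0" "xs i = ereal p" "p = 0 \<longleftrightarrow> i = 0" using fin[OF i] by blast
    show ?thesis
      using H1_piece_estimate[OF q0 p(1), of "xs (Suc i)"] xs(3,4)[OF i] si p unfolding I_def V_def by simp
  qed
  then have "\<forall>i. \<exists>C \<epsilon>. i \<le> M \<longrightarrow> \<epsilon> > 0 \<and> (\<forall>x t. 0 < x \<longrightarrow> x < \<epsilon> \<longrightarrow> 0 < t \<longrightarrow> t < \<epsilon> \<longrightarrow>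
     norm (I i x t - V i x t) \<le> C * error_scale x t)" by blast
  then obtain C \<epsilon> where C: "\<And>i. i \<le> M \<Longrightarrow> \<epsilon> i > 0" "\<And>i x t. i \<le> M \<Longrightarrow> 0 < x \<Longrightarrow> x < \<epsilon> i \<Longrightarrow> 0 < t \<Longrightarrow> t < \<epsilon> i \<Longrightarrow>
     norm (I i x t - V i x t) \<le> C i * error_scale x t"
    by metis
  define e where "e = Min (\<epsilon> ` {..M})"
  have e: "e > 0" "\<And>i. i \<le> M \<Longrightarrow> e \<le> \<epsilon> i" using C(1) by (auto simp: e_def)
  show ?thesis
  proof (rule exI[of _ "\<Sum>i\<le>M. C i"], rule exI[of _ e], intro conjI allI impI)
    fix x t :: real assume xt: "0 < x" "x < e" "0 < t" "t < e"
    let ?h = "\<lambda>y. half_line_kernel x t y * q0 y"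
    let ?E = "\<lambda>i. einterval (xs i) (xs (Suc i))"
    have hsi: "set_integrable lebesgue (?E i) ?h" if "i \<le> M" for i
    proof (rule set_integrable_subset[OF si[OF xt(1,3)]])
      show "?E i \<subseteq> {0<..}"
      proof
        fix y assume "y \<in> ?E i"
        then have "xs i < ereal y" by (simp add: einterval_def)
        moreover have "0 \<le> xs i" using nonneg[of i] that by simp
        ultimately have "0 < ereal y" by (rule le_less_trans[rotated])
        then show "y \<in> {0<..}" by simp
      qed
    qed simp
    have "(LINT y:{0<..}|lebesgue. ?h y) = (LINT y|lebesgue. (\<Sum>i\<le>M. indicat_real (?E i) y *\<^sub>R ?h y))"
      unfolding set_lebesgue_integral_def
    proof (rule Bochner_Integration.integral_cong_AE)
      show "(\<lambda>y. indicat_real {0<..} y *\<^sub>R ?h y) \<in> borel_measurable lebesgue"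
        using si[OF xt(1,3)] by (auto simp: set_integrable_def)
      show "(\<lambda>y. \<Sum>i\<le>M. indicat_real (?E i) y *\<^sub>R ?h y) \<in> borel_measurable lebesgue"
        by (intro borel_measurable_sum) (use hsi in \<open>auto simp: set_integrable_def\<close>)
      have "finite (real_of_ereal ` xs ` {..M})" by simp
      then have "real_of_ereal ` xs ` {..M} \<in> null_sets lebesgue"
        by (intro null_sets_completionI finite_imp_null_set_lborel)
      then show "AE y in lebesgue. indicat_real {0<..} y *\<^sub>R ?h y = (\<Sum>i\<le>M. indicat_real (?E i) y *\<^sub>R ?h y)"
      proof (rule eventually_mono[OF AE_not_in])
        fix y assume y: "y \<notin> real_of_ereal ` xs ` {..M}"
        have "indicat_real (einterval (xs 0) (xs (Suc M))) y = (\<Sum>i<Suc M. indicat_real (?E i) y)"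
        proof (rule partition_indicator)
          show "xs i < xs (Suc i)" if "i < Suc M" for i using xs(3) that by simp
          show "ereal y \<noteq> xs i" if "i \<le> Suc M" for i
          proof (cases "i = Suc M")
            case True then show ?thesis using xs(2) by simp
          next
            case False
            then have "i \<le> M" using that by simp
            then show ?thesis using y by (metis atMost_iff imageI real_of_ereal.simps(1))
          qed
        qed
        moreover have "einterval (xs 0) (xs (Suc M)) = {0<..}"
          unfolding xs(1,2) by (auto simp: einterval_def)
        ultimately have "indicat_real {0<..} y = (\<Sum>i\<le>M. indicat_real (?E i) y)"
          by (simp add: lessThan_Suc_atMost)
        then show "indicat_real {0<..} y *\<^sub>R ?h y = (\<Sum>i\<le>M. indicat_real (?E i) y *\<^sub>R ?h y)"
          by (simp add: scaleR_sum_left)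
      qed
    qed
    also have "\<dots> = (\<Sum>i\<le>M. I i x t)"
      unfolding I_def set_lebesgue_integral_def
      by (rule Bochner_Integration.integral_sum) (use hsi in \<open>auto simp: set_integrable_def\<close>)
    finally have 1: "(LINT y:{0<..}|lebesgue. ?h y) = (\<Sum>i\<le>M. I i x t)" .
    have 2: "right_value q0 0 * half_line_primitive x t 0 = (\<Sum>i\<le>M. V i x t)"
      by (simp add: V_def sum.delta)
    have "norm ((LINT y:{0<..}|lebesgue. ?h y) - right_value q0 0 * half_line_primitive x t 0)
       = norm (\<Sum>i\<le>M. I i x t - V i x t)" unfolding 1 2 by (simp add: sum_subtractf)
    also have "\<dots> \<le> (\<Sum>i\<le>M. C i * error_scale x t)"
    proof (rule sum_norm_le)
      fix i assume "i \<in> {..M}"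
      then have i: "i \<le> M" by simp
      show "norm (I i x t - V i x t) \<le> C i * error_scale x t"
        by (rule C(2)[OF i]) (use xt e(2)[OF i] in auto)
    qed
    finally show "norm ((LINT y:{0<..}|lebesgue. ?h y) - right_value q0 0 * half_line_primitive x t 0)
       \<le> (\<Sum>i\<le>M. C i) * error_scale x t" by (simp add: sum_distrib_right)
  qed (rule e(1))
qed

text \<open>
  An improper contour integral is a limit that need not exist, so the equation rests on the convergence
  established for each contour.
\<close>

lemma initial_terms:
  assumes q0: "set_integrable lebesgue {0<..} q0" and x: "x > 0" and t: "t > 0"
  shows "set_integrable lebesgue {0<..} (\<lambda>y. half_line_kernel x t y * q0 y)"
    and "1 / (2 * of_real pi) * improper_contour_integral real_line (\<lambda>k. phase x t k * half_line_transform q0 k)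
     + 1 / (2 * of_real pi) * improper_contour_integral bdry_D
       (\<lambda>k. phase x t k * (\<alpha> * half_line_transform q0 (\<alpha> * k) + \<alpha>\<^sup>2 * half_line_transform q0 (\<alpha>\<^sup>2 * k)))
     = (LINT y:{0<..}|lebesgue. half_line_kernel x t y * q0 y)"
proof -
  let ?L = "\<lambda>\<beta> y. line_integral (\<lambda>k. 1) 1 (of_real x - \<beta> * of_real y) t"
  let ?J = "\<lambda>\<beta>. LINT y:{0<..}|lebesgue. ?L \<beta> y * q0 y"
  have a1: "Re \<alpha> = - 1 / 2" "\<bar>Im \<alpha>\<bar> = sqrt 3 / 2" by (simp_all add: alpha_eq(1))
  have a2: "Re (\<alpha>\<^sup>2) = - 1 / 2" "\<bar>Im (\<alpha>\<^sup>2)\<bar> = sqrt 3 / 2" unfolding alpha_eq(2) by simp_all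
  note R1 = ray_term[OF q0 t x a1] and R2 = ray_term[OF q0 t x a2]
  have R0: "set_integrable lebesgue {0<..} (\<lambda>y. ?L 1 y * q0 y)"
    "((\<lambda>r. contour_integral (real_line r) (\<lambda>k. phase x t k * half_line_transform q0 k)) \<longlongrightarrow> ?J 1) at_top"
    using real_line_term[OF q0 t, of x] by simp_all
  have T1: "improper_contour_integral real_line (\<lambda>k. phase x t k * half_line_transform q0 k) = ?J 1"
    unfolding improper_contour_integral_def using R0(2) by (intro tendsto_Lim) auto
  have T2: "improper_contour_integral bdry_D
       (\<lambda>k. phase x t k * (\<alpha> * half_line_transform q0 (\<alpha> * k) + \<alpha>\<^sup>2 * half_line_transform q0 (\<alpha>\<^sup>2 * k)))
     = \<alpha> * ?J \<alpha> + \<alpha>\<^sup>2 * ?J (\<alpha>\<^sup>2)"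
    unfolding improper_contour_integral_def
  proof (rule tendsto_Lim[OF trivial_limit_at_top_linorder])
    let ?C = "\<lambda>\<beta> r. contour_integral (bdry_D r) (\<lambda>k. phase x t k * half_line_transform q0 (\<beta> * k))"
    have L: "((\<lambda>r. \<alpha> * ?C \<alpha> r + \<alpha>\<^sup>2 * ?C (\<alpha>\<^sup>2) r) \<longlongrightarrow> \<alpha> * ?J \<alpha> + \<alpha>\<^sup>2 * ?J (\<alpha>\<^sup>2)) at_top"
      by (intro tendsto_intros R1(2) R2(2))
    have ev: "\<forall>\<^sub>F r in at_top. \<alpha> * ?C \<alpha> r + \<alpha>\<^sup>2 * ?C (\<alpha>\<^sup>2) r = contour_integral (bdry_D r)
       (\<lambda>k. phase x t k * (\<alpha> * half_line_transform q0 (\<alpha> * k) + \<alpha>\<^sup>2 * half_line_transform q0 (\<alpha>\<^sup>2 * k)))"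
      using eventually_gt_at_top[of 0]
    proof eventually_elim
      case (elim r)
      have "((\<lambda>k. \<alpha> * (phase x t k * half_line_transform q0 (\<alpha> * k)) + \<alpha>\<^sup>2 * (phase x t k * half_line_transform q0 (\<alpha>\<^sup>2 * k)))
         has_contour_integral (\<alpha> * ?C \<alpha> r + \<alpha>\<^sup>2 * ?C (\<alpha>\<^sup>2) r)) (bdry_D r)"
        by (intro has_contour_integral_add has_contour_integral_lmul has_contour_integral_integral R1(3) R2(3) elim)
      then show ?case by (subst contour_integral_unique[symmetric]) (auto simp: algebra_simps)
    qed
    show "((\<lambda>r. contour_integral (bdry_D r)
       (\<lambda>k. phase x t k * (\<alpha> * half_line_transform q0 (\<alpha> * k) + \<alpha>\<^sup>2 * half_line_transform q0 (\<alpha>\<^sup>2 * k))))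
      \<longlongrightarrow> \<alpha> * ?J \<alpha> + \<alpha>\<^sup>2 * ?J (\<alpha>\<^sup>2)) at_top"
      by (rule Lim_transform_eventually[OF L ev])
  qed
  have N: "half_line_kernel x t y * q0 y = 1 / (2 * of_real pi) * (?L 1 y * q0 y + (\<alpha> * (?L \<alpha> y * q0 y) + \<alpha>\<^sup>2 * (?L (\<alpha>\<^sup>2) y * q0 y)))" for y
    unfolding half_line_kernel_def airy_kernel_def by (simp add: algebra_simps)
  have m: "set_integrable lebesgue {0<..} (\<lambda>y. c * (?L \<beta> y * q0 y))" if "set_integrable lebesgue {0<..} (\<lambda>y. ?L \<beta> y * q0 y)" for c \<beta>
    using that by (intro set_integrable_mult_right) auto
  note A1 = set_integral_add[OF m[OF R1(1), of \<alpha>] m[OF R2(1), of "\<alpha>\<^sup>2"]]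
  note A2 = set_integral_add[OF R0(1) A1(1)]
  show "set_integrable lebesgue {0<..} (\<lambda>y. half_line_kernel x t y * q0 y)"
    unfolding N using A2(1) by (intro set_integrable_mult_right) auto
  have "(LINT y:{0<..}|lebesgue. half_line_kernel x t y * q0 y) = 1 / (2 * of_real pi) * (?J 1 + (\<alpha> * ?J \<alpha> + \<alpha>\<^sup>2 * ?J (\<alpha>\<^sup>2)))"
    unfolding N set_integral_mult_right A2(2) A1(2) ..
  then show "1 / (2 * of_real pi) * improper_contour_integral real_line (\<lambda>k. phase x t k * half_line_transform q0 k)
     + 1 / (2 * of_real pi) * improper_contour_integral bdry_D
       (\<lambda>k. phase x t k * (\<alpha> * half_line_transform q0 (\<alpha> * k) + \<alpha>\<^sup>2 * half_line_transform q0 (\<alpha>\<^sup>2 * k)))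
     = (LINT y:{0<..}|lebesgue. half_line_kernel x t y * q0 y)"
    unfolding T1 T2 by (simp add: algebra_simps)
qed

section \<open>The boundary datum\<close>

text \<open>
  Absorbs the factor \<open>k^2\<close> of the boundary term into half of the exponential decay.
\<close>

lemma square_exp_bound:
  fixes c \<rho> :: real
  assumes "c > 0" "\<rho> \<ge> 0"
  shows "\<rho>\<^sup>2 * exp (- (2 * c) * \<rho>) \<le> 2 / c\<^sup>2 * exp (- c * \<rho>)"
proof -
  have "1 + c * \<rho> + (c * \<rho>)\<^sup>2 / 2 \<le> exp (c * \<rho>)"
    by (rule exp_lower_Taylor_quadratic) (use assms in auto)
  then have "(c * \<rho>)\<^sup>2 / 2 \<le> exp (c * \<rho>)"
    using mult_nonneg_nonneg[of c \<rho>] assms by linarith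
  then have "\<rho>\<^sup>2 \<le> 2 / c\<^sup>2 * exp (c * \<rho>)"
    using assms by (simp add: power_mult_distrib field_simps)
  then have "\<rho>\<^sup>2 * exp (- (2 * c) * \<rho>) \<le> 2 / c\<^sup>2 * exp (c * \<rho>) * exp (- (2 * c) * \<rho>)"
    by (rule mult_right_mono) simp
  also have "\<dots> = 2 / c\<^sup>2 * exp (- c * \<rho>)"
    by (simp add: mult.assoc exp_add[symmetric])
  finally show ?thesis .
qed

lemma boundary_term_integrand:
  "3 * k\<^sup>2 * phase x t k * time_transform g0 (- \<omega> k) t =
     (LINT s:{0<..<t}|lebesgue. 3 * k\<^sup>2 * airy_phase (of_real x) (t - s) k * g0 s)"
proof -
  have "3 * k\<^sup>2 * phase x t k * time_transform g0 (- \<omega> k) t =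
     (LINT s:{0<..<t}|lebesgue. 3 * k\<^sup>2 * phase x t k * (exp (- \<i> * (- \<omega> k) * of_real s) * g0 s))"
    unfolding time_transform_def by (rule set_integral_mult_right[symmetric])
  moreover have "phase x t k * exp (- \<i> * (- \<omega> k) * of_real s) = airy_phase (of_real x) (t - s) k" for s
    unfolding phase_eq_airy_phase airy_phase_def exp_add[symmetric] by (simp add: \<omega>_def algebra_simps)
  then have "3 * k\<^sup>2 * phase x t k * (exp (- \<i> * (- \<omega> k) * of_real s) * g0 s)
     = 3 * k\<^sup>2 * airy_phase (of_real x) (t - s) k * g0 s" for s
    by (metis (no_types, lifting) mult.assoc)
  ultimately show ?thesis by (simp only:)
qed

lemma time_integral_airy_phase:
  assumes k: "k \<noteq> 0" and st: "s \<le> t"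
  shows "(LINT y:{s<..<t}|lebesgue. 3 * k\<^sup>2 * airy_phase z (t - y) k) =
     3 * (airy_phase z (t - s) k * (1 / (\<i> * k))) - 3 * (airy_phase z 0 k * (1 / (\<i> * k)))"
proof -
  let ?A = "\<lambda>y. - (3 * (airy_phase z (t - y) k * (1 / (\<i> * k))))"
  have H: "((\<lambda>y. 3 * k\<^sup>2 * airy_phase z (t - y) k) has_integral (?A t - ?A s)) {s..t}"
  proof (rule fundamental_theorem_of_calculus[OF st])
    fix y
    have "((\<lambda>w. - (3 * (exp (\<i> * k * z + \<i> * k ^ 3 * (of_real t - w)) * (1 / (\<i> * k))))) has_field_derivative
        3 * k\<^sup>2 * airy_phase z (t - y) k) (at (of_real y))"
      unfolding airy_phase_def using k
      by (auto intro!: derivative_eq_intros simp: power3_eq_cube power2_eq_square)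
    then have "((\<lambda>y. - (3 * (exp (\<i> * k * z + \<i> * k ^ 3 * (of_real t - of_real y)) * (1 / (\<i> * k))))) has_vector_derivative
        3 * k\<^sup>2 * airy_phase z (t - y) k) (at y within {s..t})"
      by (rule has_vector_derivative_at_within[OF has_vector_derivative_real_field])
    then show "(?A has_vector_derivative 3 * k\<^sup>2 * airy_phase z (t - y) k) (at y within {s..t})"
      by (simp add: airy_phase_def)
  qed
  have si: "set_integrable lebesgue {s<..<t} (\<lambda>y. 3 * k\<^sup>2 * airy_phase z (t - y) k)"
    by (intro continuous_set_integrable_lebesgue continuous_intros)
  have "(LINT y:{s<..<t}|lebesgue. 3 * k\<^sup>2 * airy_phase z (t - y) k) = ?A t - ?A s"
    unfolding set_lebesgue_integral_eq_integral(2)[OF si] integral_open_interval_real[symmetric]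
    by (rule integral_unique[OF H])
  then show ?thesis by simp
qed

lemma set_integrable_const_lebesgue:
  "set_integrable lebesgue {s<..<t} (\<lambda>_::real. c :: complex)"
  by (intro continuous_set_integrable_lebesgue continuous_intros)

text \<open>
  The time integral of the truncated boundary kernel. It is written over a horizontal segment, since there the
  weight \<open>1/(i k)\<close> is regular, whereas the rays meet the origin.
\<close>

definition boundary_primitive :: "real \<Rightarrow> real \<Rightarrow> real \<Rightarrow> complex" where
  "boundary_primitive x r \<sigma> =
     3 * (LINT \<xi>:{- (r / 2)..r / 2}|lborel. airy_phase (of_real x) \<sigma> (Complex \<xi> (sqrt 3 / 2 * r)) * (1 / (\<i> * Complex \<xi> (sqrt 3 / 2 * r))))
   - 3 * (LINT \<xi>:{- (r / 2)..r / 2}|lborel. airy_phase (of_real x) 0 (Complex \<xi> (sqrt 3 / 2 * r)) * (1 / (\<i> * Complex \<xi> (sqrt 3 / 2 * r))))"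

lemma set_integrable_horizontal:
  assumes "upper_weight g" "\<eta> > 0"
  shows "set_integrable lborel {a..b} (\<lambda>\<xi>. airy_phase z t (Complex \<xi> \<eta>) * g (Complex \<xi> \<eta>))"
  using continuous_on_subset[OF continuous_on_horizontal[OF assms] subset_UNIV] unfolding set_integrable_def
  by (intro borel_integrable_compact compact_Icc)

lemma boundary_primitive_eq:
  assumes r: "r > 0" and st: "s < t"
  shows "(LINT y:{s<..<t}|lebesgue. contour_integral (bdry_D r) (\<lambda>k. 3 * k\<^sup>2 * airy_phase (of_real x) (t - y) k))
     = boundary_primitive x r (t - s)"
proof -
  let ?e = "\<lambda>k y. 3 * k\<^sup>2 * airy_phase (of_real x) (t - y) k"
  let ?\<eta> = "sqrt 3 / 2 * r"
  let ?a = "Complex (- (r / 2)) ?\<eta>" and ?b = "Complex (r / 2) ?\<eta>"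
  have eta: "?\<eta> > 0" using r by simp
  have cont: "continuous_on UNIV (\<lambda>p. ?e (fst p) (snd p))" by (intro continuous_intros)
  have "compact ((\<lambda>p. ?e (fst p) (snd p)) ` (closed_segment ?a ?b \<times> {s..t}))"
    by (intro compact_continuous_image continuous_on_subset[OF cont] compact_Times) auto
  then obtain B where B: "\<And>p. p \<in> closed_segment ?a ?b \<times> {s..t} \<Longrightarrow> norm (?e (fst p) (snd p)) \<le> B"
    by (force dest!: compact_imp_bounded simp: bounded_iff)
  have bd: "norm (?e k y) \<le> B" if "k \<in> closed_segment ?a ?b" "y \<in> {s<..<t}" for k y
    using B[of "(k, y)"] that by auto
  have hor: "contour_integral (bdry_D r) (\<lambda>k. ?e k y) = contour_integral (linepath ?a ?b) (\<lambda>k. ?e k y)" for y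
  proof -
    have "contour_integral (bdry_D r) (\<lambda>k. ?e k y) = (LINT \<xi>:{- (r / 2)..r / 2}|lborel. ?e (Complex \<xi> ?\<eta>) y)"
      by (rule contour_integral_bdry_D[OF _ r]) (intro holomorphic_intros)
    also have "\<dots> = contour_integral (linepath ?a ?b) (\<lambda>k. ?e k y)"
      by (rule horizontal_segment_contour_integral[symmetric]) (use r eta in \<open>auto intro!: holomorphic_intros\<close>)
    finally show ?thesis .
  qed
  have im: "Im k = ?\<eta>" if "k \<in> closed_segment ?a ?b" for k
    using that by (auto simp: closed_segment_same_Im)
  have "(LINT y:{s<..<t}|lebesgue. contour_integral (bdry_D r) (\<lambda>k. ?e k y)) =
     (LINT y:{s<..<t}|lebesgue. contour_integral (linepath ?a ?b) (\<lambda>k. ?e k y) * 1)"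
    unfolding hor by simp
  also have "\<dots> = contour_integral (linepath ?a ?b) (\<lambda>k. LINT y:{s<..<t}|lebesgue. ?e k y * 1)"
    by (rule contour_integral_unique[symmetric, OF has_contour_integral_parameter[OF set_integrable_const_lebesgue cont bd]])
  also have "\<dots> = contour_integral (linepath ?a ?b)
     (\<lambda>k. 3 * (airy_phase (of_real x) (t - s) k * (1 / (\<i> * k))) - 3 * (airy_phase (of_real x) 0 k * (1 / (\<i> * k))))"
  proof (rule contour_integral_cong[OF refl])
    fix k assume "k \<in> path_image (linepath ?a ?b)"
    then have "k \<noteq> 0" using im[of k] eta by auto
    then show "(LINT y:{s<..<t}|lebesgue. ?e k y * 1) =
       3 * (airy_phase (of_real x) (t - s) k * (1 / (\<i> * k))) - 3 * (airy_phase (of_real x) 0 k * (1 / (\<i> * k)))"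
      using time_integral_airy_phase[of k s t "of_real x"] st by simp
  qed
  also have "\<dots> = (LINT \<xi>:{- (r / 2)..r / 2}|lborel.
      3 * (airy_phase (of_real x) (t - s) (Complex \<xi> ?\<eta>) * (1 / (\<i> * Complex \<xi> ?\<eta>)))
      - 3 * (airy_phase (of_real x) 0 (Complex \<xi> ?\<eta>) * (1 / (\<i> * Complex \<xi> ?\<eta>))))"
    by (rule horizontal_segment_contour_integral) (use r eta in \<open>auto intro!: holomorphic_intros\<close>)
  also have "\<dots> = boundary_primitive x r (t - s)"
  proof -
    have si: "set_integrable lborel {- (r / 2)..r / 2} (\<lambda>\<xi>. airy_phase (of_real x) \<sigma> (Complex \<xi> ?\<eta>) * (1 / (\<i> * Complex \<xi> ?\<eta>)))" for \<sigma>
      by (rule set_integrable_horizontal[OF upper_weight_inverse eta])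
    have si3: "set_integrable lborel {- (r / 2)..r / 2} (\<lambda>\<xi>. 3 * (airy_phase (of_real x) \<sigma> (Complex \<xi> ?\<eta>) * (1 / (\<i> * Complex \<xi> ?\<eta>))))" for \<sigma>
      using si by (intro set_integrable_mult_right) auto
    show ?thesis
      unfolding boundary_primitive_def set_integral_diff(2)[OF si3 si3] set_integral_mult_right ..
  qed
  finally show ?thesis .
qed

text \<open>
  The part at time \<open>0\<close> disappears in the limit, because \<open>exp (i k x)/(i k)\<close> decays exponentially as
  the segment rises; this is the statement that \<open>I(x, 0) = 0\<close>.
\<close>

lemma boundary_primitive_limit:
  assumes x: "x > 0" and \<sigma>: "\<sigma> > 0"
  shows "((\<lambda>r. boundary_primitive x r \<sigma>) \<longlongrightarrow> 6 * of_real pi * airy_primitive (of_real x) \<sigma>) at_top"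
proof -
  let ?f = "\<lambda>\<sigma> r \<xi>. airy_phase (of_real x) \<sigma> (Complex \<xi> (sqrt 3 / 2 * r)) * (1 / (\<i> * Complex \<xi> (sqrt 3 / 2 * r)))"
  have 1: "((\<lambda>r. LINT \<xi>:{- (r / 2)..r / 2}|lborel. ?f \<sigma> r \<xi>) \<longlongrightarrow> line_integral (\<lambda>k. 1 / (\<i> * k)) 1 (of_real x) \<sigma>) at_top"
    by (rule sector_limit[OF upper_weight_inverse \<sigma> x]) simp
  define c where "c = sqrt 3 / 2"
  have c: "c > 0" by (simp add: c_def)
  have 2: "((\<lambda>r. LINT \<xi>:{- (r / 2)..r / 2}|lborel. ?f 0 r \<xi>) \<longlongrightarrow> 0) at_top"
  proof (rule Lim_null_comparison)
    show "((\<lambda>r. r * (exp (- (c * r) * x) * (1 / (c * r)))) \<longlongrightarrow> 0) at_top"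
      using c x by real_asymp
    show "\<forall>\<^sub>F r in at_top. norm (LINT \<xi>:{- (r / 2)..r / 2}|lborel. ?f 0 r \<xi>) \<le> r * (exp (- (c * r) * x) * (1 / (c * r)))"
      using eventually_gt_at_top[of 0]
    proof eventually_elim
      case (elim r)
      have eta: "sqrt 3 / 2 * r > 0" using elim by simp
      let ?K = "exp (- (c * r) * x) * (1 / (c * r))"
      have si: "set_integrable lborel {- (r / 2)..r / 2} (?f 0 r)"
        by (rule set_integrable_horizontal[OF upper_weight_inverse eta])
      have ki: "integrable lborel (\<lambda>\<xi>. indicat_real {- (r / 2)..r / 2} \<xi> *\<^sub>R ?K)"
        using elim by simp
      have "norm (LINT \<xi>:{- (r / 2)..r / 2}|lborel. ?f 0 r \<xi>) \<le> (LINT \<xi>|lborel. indicat_real {- (r / 2)..r / 2} \<xi> *\<^sub>R ?K)"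
        unfolding set_lebesgue_integral_def
      proof (rule Bochner_Integration.integral_norm_bound_integral[OF si[unfolded set_integrable_def] ki])
        fix \<xi>
        have "c * r \<le> norm (Complex \<xi> (c * r))" using abs_Im_le_cmod[of "Complex \<xi> (c * r)"] by simp
        then have "norm (1 / (\<i> * Complex \<xi> (c * r))) \<le> 1 / (c * r)"
          using elim c by (simp add: norm_divide norm_mult frac_le)
        then have "norm (airy_phase (of_real x) 0 (Complex \<xi> (c * r))) * norm (1 / (\<i> * Complex \<xi> (c * r))) \<le> ?K"
          unfolding norm_airy_phase by (intro mult_mono) auto
        then have "norm (?f 0 r \<xi>) \<le> ?K" by (simp only: norm_mult c_def)
        then show "norm (indicat_real {- (r / 2)..r / 2} \<xi> *\<^sub>R ?f 0 r \<xi>) \<le> indicat_real {- (r / 2)..r / 2} \<xi> *\<^sub>R ?K"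
          by (simp add: indicator_def)
      qed
      also have "\<dots> = r * ?K" using elim by simp
      finally show ?case .
    qed
  qed
  have "((\<lambda>r. boundary_primitive x r \<sigma>) \<longlongrightarrow> 3 * line_integral (\<lambda>k. 1 / (\<i> * k)) 1 (of_real x) \<sigma> - 3 * 0) at_top"
    unfolding boundary_primitive_def by (intro tendsto_intros 1 2)
  then show ?thesis by (simp add: airy_primitive_def)
qed

text \<open>
  Integration by parts is carried out at a finite truncation \<open>r\<close>, where the kernel is integrable in time; only
  the primitive has a limit that is bounded uniformly in \<open>x\<close>.
\<close>

lemma boundary_term:
  assumes x: "x > 0" and t: "0 < t" "t < b" and g: "L2_on {0<..<b} g"
    and f: "AE s in lebesgue. 0 < s \<and> s < b \<longrightarrow> g0 s = c0 + (LINT u:{0<..<s}|lebesgue. g u)"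
    and g0: "set_integrable lebesgue {0<..<t} g0"
  shows "norm (1 / (2 * of_real pi) * improper_contour_integral bdry_D
       (\<lambda>k. 3 * k\<^sup>2 * phase x t k * time_transform g0 (- \<omega> k) t) - 3 * c0 * airy_primitive (of_real x) t)
     \<le> 3 * (sqrt t * (L2_normsq {0<..<b} g + 1) / 2)"
proof -
  let ?W = "\<lambda>\<sigma>. airy_primitive (of_real x) \<sigma>"
  let ?e = "\<lambda>k s. 3 * k\<^sup>2 * airy_phase (of_real x) (t - s) k"
  let ?c = "\<lambda>r s. contour_integral (bdry_D r) (\<lambda>k. ?e k s)"
  define c where "c = sqrt 3 / 4 * x"
  have c: "c > 0" using x by (simp add: c_def)
  define B where "B = 3 * (2 / c\<^sup>2)"
  have B: "B \<ge> 0" by (simp add: B_def)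
  have cont: "continuous_on UNIV (\<lambda>p. ?e (fst p) (snd p))" by (intro continuous_intros)
  have bound: "norm (?e k s) \<le> B * exp (- c * \<rho>)"
    if "\<rho> \<ge> 0" "k = of_real \<rho> * cis (2 * pi / 3) \<or> k = of_real \<rho> * cis (pi / 3)" for k s \<rho>
  proof -
    have nk: "norm k = \<rho>" using that by (auto simp: norm_mult)
    have "norm (airy_phase (of_real x) (t - s) k) \<le> exp (- (sqrt 3 / 2 * x) * \<rho>)"
      by (rule norm_airy_phase_ray[OF that(1) _ that(2)]) simp
    moreover have "- (sqrt 3 / 2 * x) * \<rho> = - (2 * c) * \<rho>" by (simp add: c_def)
    ultimately have "\<rho>\<^sup>2 * norm (airy_phase (of_real x) (t - s) k) \<le> \<rho>\<^sup>2 * exp (- (2 * c) * \<rho>)"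
      by (intro mult_left_mono) (simp_all only: zero_le_power2)
    then have "norm (?e k s) \<le> 3 * (\<rho>\<^sup>2 * exp (- (2 * c) * \<rho>))"
      by (simp add: norm_mult norm_power nk)
    also have "\<dots> \<le> 3 * (2 / c\<^sup>2 * exp (- c * \<rho>))"
      by (intro mult_left_mono square_exp_bound c that) auto
    finally show ?thesis by (simp add: B_def)
  qed
  have hci: "((\<lambda>k. LINT s:{0<..<t}|lebesgue. ?e k s * g0 s) has_contour_integral
      (LINT s:{0<..<t}|lebesgue. ?c r s * g0 s)) (bdry_D r)" if "r > 0" for r
    by (rule bdry_D_has_contour_integral[OF g0 cont c _ that]) (rule bound)
  have ni: "set_integrable lebesgue {0<..<t} (\<lambda>s. ?c r s)" if "r > 0" for r
  proof -
    have "set_integrable lebesgue {0<..<t} (\<lambda>s. ?c r s * 1)"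
      by (rule bdry_D_set_integrable[OF set_integrable_const_lebesgue cont c _ that]) (rule bound)
    then show ?thesis by simp
  qed
  have nb: "norm (?c r s) \<le> 2 * B / c" if "r > 0" "s \<in> {0<..<t}" for r s
    by (rule bdry_D_bound[OF set_integrable_const_lebesgue cont c _ that]) (rule bound)
  have sub: "{0<..<t} \<subseteq> {0<..<b}" using t by auto
  have gi: "set_integrable lebesgue {0<..<t} g" by (rule L2_imp_set_integrable[OF g sub t(1)])
  have ft: "AE s in lebesgue. 0 < s \<and> s < t \<longrightarrow> g0 s = c0 + (LINT u:{0<..<s}|lebesgue. g u)"
    using f by eventually_elim (use t in auto)
  have gm: "set_borel_measurable lebesgue {0<..<t} g0"
    using g0 unfolding set_integrable_def set_borel_measurable_def by auto
  let ?P = "\<lambda>r s. boundary_primitive x r (t - s)"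
  have IBP: "(LINT s:{0<..<t}|lebesgue. ?c r s * g0 s) = c0 * ?P r 0 + (LINT s:{0<..<t}|lebesgue. ?P r s * g s)"
    and Pi: "set_integrable lebesgue {0<..<t} (\<lambda>s. ?P r s * g s)" if "r > 0" for r
    by (rule ac_integration_by_parts[OF ni[OF that] gi ft boundary_primitive_eq[OF that] boundary_primitive_eq[OF that] gm];
        use t in simp)+
  have Pb: "norm (?P r s) \<le> t * (2 * B / c)" if r: "r \<ge> 1" and s: "s \<in> {0<..<t}" for r s
  proof -
    have r0: "r > 0" using r by simp
    have si: "set_integrable lebesgue {s<..<t} (\<lambda>y. ?c r y)"
      by (rule set_integrable_subset[OF ni[OF r0]]) (use s in auto)
    have "norm (?P r s) \<le> (LINT y:{s<..<t}|lebesgue. norm (?c r y))"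
      using boundary_primitive_eq[OF r0, of s t x] norm_set_integral_le[OF si] s by simp
    also have "\<dots> \<le> (LINT y|lebesgue. indicat_real {s<..<t} y * (2 * B / c))"
      unfolding set_lebesgue_integral_def
    proof (rule integral_mono)
      show "integrable lebesgue (\<lambda>y. indicat_real {s<..<t} y *\<^sub>R norm (?c r y))"
        using integrable_norm[OF si[unfolded set_integrable_def]] by simp
      show "integrable lebesgue (\<lambda>y. indicat_real {s<..<t} y * (2 * B / c))"
        using s by (intro integrable_mult_left) (auto intro!: integrable_real_indicator)
      show "indicat_real {s<..<t} y *\<^sub>R norm (?c r y) \<le> indicat_real {s<..<t} y * (2 * B / c)" for y
        using nb[OF r0, of y] s by (auto simp: indicator_def)
    qed
    also have "\<dots> = (t - s) * (2 * B / c)" using s by simp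
    also have "\<dots> \<le> t * (2 * B / c)" using s B c by (intro mult_right_mono) auto
    finally show ?thesis .
  qed
  have Pl: "((\<lambda>r. ?P r s) \<longlongrightarrow> 6 * of_real pi * ?W (t - s)) at_top" if "s < t" for s
    using boundary_primitive_limit[OF x, of "t - s"] that by simp
  have Pi1: "set_integrable lebesgue {0<..<t} (\<lambda>s. ?P r s * g s)" if "r \<ge> 1" for r
    by (rule Pi) (use that in simp)
  have Pl': "((\<lambda>r. ?P r s) \<longlongrightarrow> 6 * of_real pi * ?W (t - s)) at_top" if "s \<in> {0<..<t}" for s
    by (rule Pl) (use that in simp)
  let ?J = "LINT s:{0<..<t}|lebesgue. (6 * of_real pi * ?W (t - s)) * g s"
  have Wi: "set_integrable lebesgue {0<..<t} (\<lambda>s. (6 * of_real pi * ?W (t - s)) * g s)"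
    by (rule dominated_kernel_integrable[OF gi Pi1 Pb Pl'])
  have "((\<lambda>r. LINT s:{0<..<t}|lebesgue. ?P r s * g s) \<longlongrightarrow> ?J) at_top"
    by (rule dominated_kernel_tendsto[OF gi Pi1 Pb Pl'])
  then have L: "((\<lambda>r. c0 * ?P r 0 + (LINT s:{0<..<t}|lebesgue. ?P r s * g s)) \<longlongrightarrow> c0 * (6 * of_real pi * ?W (t - 0)) + ?J) at_top"
    by (intro tendsto_add tendsto_mult tendsto_const Pl t)
  have "improper_contour_integral bdry_D (\<lambda>k. 3 * k\<^sup>2 * phase x t k * time_transform g0 (- \<omega> k) t) = c0 * (6 * of_real pi * ?W (t - 0)) + ?J"
    unfolding improper_contour_integral_def boundary_term_integrand
  proof (rule tendsto_Lim[OF trivial_limit_at_top_linorder Lim_transform_eventually[OF L]])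
    show "\<forall>\<^sub>F r in at_top. c0 * ?P r 0 + (LINT s:{0<..<t}|lebesgue. ?P r s * g s)
       = contour_integral (bdry_D r) (\<lambda>k. LINT s:{0<..<t}|lebesgue. ?e k s * g0 s)"
      using eventually_gt_at_top[of 0]
    proof eventually_elim
      case (elim r)
      show ?case unfolding contour_integral_unique[OF hci[OF elim]] IBP[OF elim] ..
    qed
  qed
  then have eq: "1 / (2 * of_real pi) * improper_contour_integral bdry_D
       (\<lambda>k. 3 * k\<^sup>2 * phase x t k * time_transform g0 (- \<omega> k) t) - 3 * c0 * ?W t = 1 / (2 * of_real pi) * ?J"
    by (simp add: algebra_simps)
  have "norm ?J \<le> (LINT s|lebesgue. (6 * pi) * (indicat_real {0<..<t} s *\<^sub>R norm (g s)))"
    unfolding set_lebesgue_integral_def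
  proof (rule Bochner_Integration.integral_norm_bound_integral[OF Wi[unfolded set_integrable_def]])
    show "integrable lebesgue (\<lambda>s. (6 * pi) * (indicat_real {0<..<t} s *\<^sub>R norm (g s)))"
      using integrable_norm[OF gi[unfolded set_integrable_def]] by (intro integrable_mult_right) simp
    fix s
    show "norm (indicat_real {0<..<t} s *\<^sub>R (6 * of_real pi * ?W (t - s) * g s)) \<le> (6 * pi) * (indicat_real {0<..<t} s *\<^sub>R norm (g s))"
    proof (cases "s \<in> {0<..<t}")
      case True
      have "norm (?W (t - s)) \<le> 1" by (rule norm_airy_primitive_le_1) (use True x in auto)
      then have "norm (?W (t - s)) * norm (g s) \<le> 1 * norm (g s)" by (rule mult_right_mono) simp
      then show ?thesis using True by (simp add: norm_mult)
    qed simp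
  qed
  also have "\<dots> = (6 * pi) * (LINT s:{0<..<t}|lebesgue. norm (g s))"
    unfolding set_lebesgue_integral_def by (rule integral_mult_right_zero)
  also have "\<dots> \<le> (6 * pi) * (sqrt (t - 0) * (L2_normsq {0<..<b} g + 1) / 2)"
    by (intro mult_left_mono L2_integral_norm_le[OF g sub t(1)]) auto
  finally have "norm ?J \<le> (6 * pi) * (sqrt t * (L2_normsq {0<..<b} g + 1) / 2)" by simp
  then have "1 / (2 * pi) * norm ?J \<le> 1 / (2 * pi) * ((6 * pi) * (sqrt t * (L2_normsq {0<..<b} g + 1) / 2))"
    by (intro mult_left_mono) auto
  then show ?thesis unfolding eq by (simp add: norm_mult norm_divide)
qed

lemma boundary_estimate:
  assumes adm: "admissible_boundary T g0"
  shows "\<exists>C \<epsilon>. \<epsilon> > 0 \<and> (\<forall>x t. 0 < x \<longrightarrow> 0 < t \<longrightarrow> t < \<epsilon> \<longrightarrow>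
     norm (1 / (2 * of_real pi) * improper_contour_integral bdry_D
       (\<lambda>k. 3 * k\<^sup>2 * phase x t k * time_transform g0 (- \<omega> k) t) - 3 * right_value g0 0 * airy_primitive (of_real x) t)
     \<le> C * error_scale x t)"
proof -
  obtain K :: nat and ts :: "nat \<Rightarrow> real" where ts: "ts 0 = 0" "\<And>i. i \<le> K \<Longrightarrow> ts i < ts (Suc i)"
    "\<And>i. i \<le> K \<Longrightarrow> H1_on {ts i <..< ts (Suc i)} g0"
    using adm unfolding admissible_boundary_def by blast
  define b where "b = ts 1"
  have b: "b > 0" "H1_on {0<..<b} g0" using ts(2)[of 0] ts(3)[of 0] ts(1) by (auto simp: b_def)
  have g02: "L2_on {0<..<b} g0" using b(2) by (simp add: H1_on_def)
  obtain c g where g: "L2_on {0<..<b} g" and f: "AE s in lebesgue. s \<in> {0<..<b} \<longrightarrow> g0 s = c + (LINT u:{0<..<s}|lebesgue. g u)"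
    by (rule H1_representation[OF b(2), of 0]) (use b(1) in auto)
  have f': "AE s in lebesgue. 0 < s \<and> s < b \<longrightarrow> g0 s = c + (LINT u:{0<..<s}|lebesgue. g u)" using f by simp
  have c: "right_value g0 0 = c"
    by (rule right_value_eq[OF L2_imp_set_integrable[OF g order_refl b(1)] b(1) f'])
  define G where "G = L2_normsq {0<..<b} g"
  have G: "G \<ge> 0" unfolding G_def L2_normsq_def set_lebesgue_integral_def by (rule Bochner_Integration.integral_nonneg) auto
  show ?thesis
  proof (rule exI[of _ "3 * ((G + 1) / 2)"], rule exI[of _ "min 1 b"], intro conjI allI impI)
    show "min 1 b > 0" using b(1) by simp
    fix x t :: real assume xt: "0 < x" "0 < t" "t < min 1 b"
    have tb: "t < b" using xt by simp
    have g0t: "set_integrable lebesgue {0<..<t} g0"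
      by (rule L2_imp_set_integrable[OF g02 _ xt(2)]) (use tb in auto)
    have "sqrt t \<le> error_scale x t"
    proof -
      have "t powr (1/2) \<le> t powr (1/6)" using xt by (intro powr_mono') auto
      then show ?thesis using xt by (simp add: error_scale_def powr_half_sqrt add_increasing)
    qed
    then have "3 * (sqrt t * (G + 1) / 2) \<le> 3 * (error_scale x t * (G + 1) / 2)"
      using G by (intro mult_left_mono divide_right_mono mult_right_mono) auto
    also have "\<dots> = 3 * ((G + 1) / 2) * error_scale x t" by simp
    finally show "norm (1 / (2 * of_real pi) * improper_contour_integral bdry_D
       (\<lambda>k. 3 * k\<^sup>2 * phase x t k * time_transform g0 (- \<omega> k) t) - 3 * right_value g0 0 * airy_primitive (of_real x) t)
       \<le> 3 * ((G + 1) / 2) * error_scale x t"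
      using boundary_term[OF xt(1,2) tb g f' g0t] unfolding c G_def by linarith
  qed
qed

section \<open>The local expansion\<close>

theorem mainTheorem2:
  fixes l T R :: real
    and q0 g0 :: "real \<Rightarrow> complex"
    and q :: "real \<Rightarrow> real \<Rightarrow> complex"
  assumes "l \<ge> 0" and "T > 0" and "R > 0"
    and "admissible_initial l q0"
    and "admissible_boundary T g0"
    and "L2_solution T q0 g0 q"
    and "\<And>x t. 0 < x \<Longrightarrow> 0 < t \<Longrightarrow> t \<le> T \<Longrightarrow> q x t = solution_formula q0 g0 x t"
  shows "(\<lambda>(x, t). cmod (q x t - q_loc R q0 g0 x t))
           \<in> O[at (0, 0) within {0<..} \<times> {0<..T}](\<lambda>(x, t). \<bar>x\<bar> powr (1/2) + \<bar>t\<bar> powr (1/6))"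
proof -
  have q0: "set_integrable lebesgue {0<..} q0" by (rule admissible_initial_integrable[OF assms(1,4)])
  obtain C1 e1 where 1: "e1 > 0" "\<And>x t. 0 < x \<Longrightarrow> x < e1 \<Longrightarrow> 0 < t \<Longrightarrow> t < e1 \<Longrightarrow>
     norm ((LINT y:{0<..}|lebesgue. half_line_kernel x t y * q0 y)
        - right_value q0 0 * half_line_primitive x t 0) \<le> C1 * error_scale x t"
    using initial_estimate[OF assms(1,4) initial_terms(1)[OF q0]] by blast
  obtain C2 e2 where 2: "e2 > 0" "\<And>x t. 0 < x \<Longrightarrow> 0 < t \<Longrightarrow> t < e2 \<Longrightarrow>
     norm (1 / (2 * of_real pi) * improper_contour_integral bdry_D
       (\<lambda>k. 3 * k\<^sup>2 * phase x t k * time_transform g0 (- \<omega> k) t) - 3 * right_value g0 0 * airy_primitive (of_real x) t)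
     \<le> C2 * error_scale x t"
    using boundary_estimate[OF assms(5)] by blast
  have main: "norm (q x t - q_loc R q0 g0 x t) \<le> (C1 + C2) * error_scale x t"
    if xt: "0 < x" "x < e1" "0 < t" "t \<le> T" "t < e1" "t < e2" for x t
  proof -
    define A where "A = (LINT y:{0<..}|lebesgue. half_line_kernel x t y * q0 y) - right_value q0 0 * half_line_primitive x t 0"
    define B where "B = 1 / (2 * of_real pi) * improper_contour_integral bdry_D
       (\<lambda>k. 3 * k\<^sup>2 * phase x t k * time_transform g0 (- \<omega> k) t) - 3 * right_value g0 0 * airy_primitive (of_real x) t"
    have "q x t - q_loc R q0 g0 x t = A - B"
      unfolding assms(7)[OF xt(1,3,4)] solution_formula_def q_loc_def A_def B_def initial_terms(2)[OF q0 xt(1,3), symmetric]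
        half_line_primitive_0 I_eq_airy_primitive[OF assms(3) xt(1,3)]
      by (simp add: algebra_simps)
    then have "norm (q x t - q_loc R q0 g0 x t) \<le> norm A + norm B" by (simp add: norm_triangle_ineq4)
    also have "\<dots> \<le> C1 * error_scale x t + C2 * error_scale x t"
      unfolding A_def B_def by (intro add_mono 1(2) 2(2)) (use xt in auto)
    finally show ?thesis by (simp add: algebra_simps)
  qed
  show ?thesis
  proof (rule bigoI[of _ "C1 + C2"])
    show "\<forall>\<^sub>F z in at (0, 0) within {0<..} \<times> {0<..T}.
        norm (case z of (x, t) \<Rightarrow> cmod (q x t - q_loc R q0 g0 x t))
        \<le> (C1 + C2) * norm (case z of (x, t) \<Rightarrow> \<bar>x\<bar> powr (1/2) + \<bar>t\<bar> powr (1/6))"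
      unfolding eventually_at
    proof (intro exI[of _ "min e1 e2"] conjI ballI impI)
      show "min e1 e2 > 0" using 1(1) 2(1) by simp
      fix z :: "real \<times> real"
      assume z: "z \<in> {0<..} \<times> {0<..T}" "z \<noteq> (0, 0) \<and> dist z (0, 0) < min e1 e2"
      obtain x t where xt: "z = (x, t)" by (cases z)
      have "dist x 0 \<le> dist z (0, 0)" "dist t 0 \<le> dist z (0, 0)"
        using dist_fst_le[of z "(0, 0)"] dist_snd_le[of z "(0, 0)"] by (simp_all add: xt)
      then have "norm (q x t - q_loc R q0 g0 x t) \<le> (C1 + C2) * error_scale x t"
        using z by (intro main) (auto simp: xt)
      then show "norm (case z of (x, t) \<Rightarrow> cmod (q x t - q_loc R q0 g0 x t))
        \<le> (C1 + C2) * norm (case z of (x, t) \<Rightarrow> \<bar>x\<bar> powr (1/2) + \<bar>t\<bar> powr (1/6))"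
        using z by (simp add: xt error_scale_def)
    qed
  qed
qed

end
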